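(* Let $n>5$ be an integer and let $N$ be the homogeneous norm on the anisotropic Heisenberg group $\mathbb{R}^{2n+1}$ associated with the fundamental solution $N^{-2n}$ of the sub-Laplacian. Let $k\ge1$ and let $d\mu=\frac{\exp(-\cosh(N^{k}))}{Z}\,d\lambda$, where $\lambda$ is Lebesgue measure on $\mathbb{R}^{2n+1}$ and $Z$ is the normalization constant making $\mu$ a probability measure. Then for every $q\ge2$ the $q$-Poincaré inequality holds for $\mu$: there is a constant $c\in(0,\infty)$, independent of $f$, such that $$\int\Big|f-\int f\,d\mu\Big|^{q}\,d\mu\ \le\ c\int|\nabla f|^{q}\,d\mu$$ for all functions $f$ for which the right-hand side is well defined.
   Context: The anisotropic Heisenberg group is $\mathbb{R}^{2n+1}$, with points $(x,t)=(x_1,\dots,x_{2n},t)$ and group law $$(x,t)\circ(\eta,\tau)=\Big(x+\eta,\ t+\tau+\tfrac{x_1\eta_{n+1}}{2}-\tfrac{x_{n+1}\eta_1}{2}+\sum_{j=2}^n (x_j\eta_{j+n}-\eta_j x_{j+n})\Big).$$ The sub-gradient is $\nabla=(X_1,\dots,X_{2n})$, where $X_1=\partial_{x_1}-\frac{x_{n+1}}{2}\partial_t$, $X_{n+1}=\partial_{x_{n+1}}+\frac{x_1}{2}\partial_t$, $X_j=\partial_{x_j}-x_{j+n}\partial_t$ for $j=2,\dots,n$, and $X_j=\partial_{x_j}+x_{j-n}\partial_t$ for $j=n+2,\dots,2n$; $|\nabla f|^2=\sum_j (X_jf)^2$; the sub-Laplacian is $\sum_{j=1}^{2n}X_j^2$.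 The norm $N$ is given explicitly by $$N(x,t)=\frac{\left(B^{2}+t^{2}\right)^{\frac{1}{4n}}\left(AB+t^{2}+A\sqrt{B^{2}+t^{2}}\right)^{\frac{1}{2}-\frac{1}{4n}}}{\left(B+\sqrt{B^{2}+t^{2}}\right)^{\frac{1}{2}}}\quad((x,t)\ne0),\qquad N(0,0)=0,$$ with $A=\frac{x_1^2+x_{n+1}^2}{2}+\frac12\sum_{2\le j\le 2n,\,j\ne n+1}x_j^2$ and $B=\frac{x_1^2+x_{n+1}^2}{4}+\frac12\sum_{2\le j\le 2n,\,j\ne n+1}x_j^2$. The inequality is understood for real-valued $\mu$-integrable functions $f$ with (weak) sub-gradient. *)

theory Defs
  imports "HOL-Analysis.Analysis"
begin

text \<open>
  Points of the group are pairs \<open>(x, t)\<close> with \<open>x\<close> in \<open>\<real>\<^sup>2\<^sup>n\<close>, where \<open>n = CARD('n)\<close>. The coordinates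
  \<open>x\<^sub>1, \<dots>, x\<^sub>n\<close> are \<open>x $ Inl j\<close> and \<open>x\<^sub>n\<^sub>+\<^sub>1, \<dots>, x\<^sub>2\<^sub>n\<close> are \<open>x $ Inr j\<close>, for \<open>j :: 'n\<close>.
  The parameter \<open>e :: 'n\<close> used throughout is the index playing the role of \<open>1\<close>,
  so \<open>Inl e\<close> and \<open>Inr e\<close> are the directions \<open>1\<close> and \<open>n + 1\<close> carrying the different weight.
\<close>

type_synonym 'n heis = "(real ^ ('n + 'n)) \<times> real"

definition heis_mult :: "'n::finite \<Rightarrow> 'n heis \<Rightarrow> 'n heis \<Rightarrow> 'n heis" where
  "heis_mult e p r = (case p of (x, t) \<Rightarrow> case r of (y, s) \<Rightarrow>
     (x + y,
      t + s + x $ Inl e * y $ Inr e / 2 - x $ Inr e * y $ Inl e / 2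
        + (\<Sum>j\<in>UNIV - {e}. x $ Inl j * y $ Inr j - y $ Inl j * x $ Inr j)))"

definition ddx :: "'n::finite + 'n \<Rightarrow> ('n heis \<Rightarrow> real) \<Rightarrow> 'n heis \<Rightarrow> real" where
  "ddx i \<phi> p = frechet_derivative \<phi> (at p) (axis i 1, 0)"

definition ddt :: "('n::finite heis \<Rightarrow> real) \<Rightarrow> 'n heis \<Rightarrow> real" where
  "ddt \<phi> p = frechet_derivative \<phi> (at p) (0, 1)"

fun Xfield :: "'n::finite \<Rightarrow> 'n + 'n \<Rightarrow> ('n heis \<Rightarrow> real) \<Rightarrow> 'n heis \<Rightarrow> real" where
  "Xfield e (Inl j) \<phi> (x, t) =
     ddx (Inl j) \<phi> (x, t) - (if j = e then x $ Inr j / 2 else x $ Inr j) * ddt \<phi> (x, t)"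
| "Xfield e (Inr j) \<phi> (x, t) =
     ddx (Inr j) \<phi> (x, t) + (if j = e then x $ Inl j / 2 else x $ Inl j) * ddt \<phi> (x, t)"

text \<open>\<open>C\<^sup>m\<close> functions on the whole space, and test functions (smooth with compact support).\<close>

primrec Cm :: "nat \<Rightarrow> ('a::euclidean_space \<Rightarrow> real) \<Rightarrow> bool" where
  "Cm 0 \<phi> \<longleftrightarrow> continuous_on UNIV \<phi>"
| "Cm (Suc m) \<phi> \<longleftrightarrow>
     \<phi> differentiable_on UNIV \<and> (\<forall>v. Cm m (\<lambda>p. frechet_derivative \<phi> (at p) v))"

definition test_function :: "('a::euclidean_space \<Rightarrow> real) \<Rightarrow> bool" where
  "test_function \<phi> \<longleftrightarrow> (\<forall>m. Cm m \<phi>) \<and> compact (closure {p. \<phi> p \<noteq> 0})"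

definition locally_integrable :: "('a::euclidean_space \<Rightarrow> real) \<Rightarrow> bool" where
  "locally_integrable f \<longleftrightarrow> (\<forall>K. compact K \<longrightarrow> set_integrable lebesgue K f)"

text \<open>
  \<open>G p $ i\<close> is the weak derivative \<open>X\<^sub>i f\<close> at \<open>p\<close>. The coefficient of \<open>\<partial>\<^sub>t\<close> in \<open>X\<^sub>i\<close> depends neither
  on \<open>x\<^sub>i\<close> nor on \<open>t\<close>, so the formal adjoint of \<open>X\<^sub>i\<close> is \<open>- X\<^sub>i\<close>. The Euclidean norm
  \<open>norm (G p)\<close> is the length \<open>|\<nabla>f|\<close> of the sub-gradient.
\<close>

definition weak_subgradient ::
    "'n::finite \<Rightarrow> ('n heis \<Rightarrow> real) \<Rightarrow> ('n heis \<Rightarrow> real ^ ('n + 'n)) \<Rightarrow> bool" where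
  "weak_subgradient e f G \<longleftrightarrow>
     locally_integrable f \<and>
     (\<forall>i. locally_integrable (\<lambda>p. G p $ i) \<and>
        (\<forall>\<phi>. test_function \<phi> \<longrightarrow>
           (\<integral>p. f p * Xfield e i \<phi> p \<partial>lebesgue) = - (\<integral>p. G p $ i * \<phi> p \<partial>lebesgue)))"

definition A_fun :: "'n::finite \<Rightarrow> real ^ ('n + 'n) \<Rightarrow> real" where
  "A_fun e x = ((x $ Inl e)\<^sup>2 + (x $ Inr e)\<^sup>2) / 2
     + (1/2) * (\<Sum>i\<in>UNIV - {Inl e, Inr e}. (x $ i)\<^sup>2)"

definition B_fun :: "'n::finite \<Rightarrow> real ^ ('n + 'n) \<Rightarrow> real" where
  "B_fun e x = ((x $ Inl e)\<^sup>2 + (x $ Inr e)\<^sup>2) / 4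
     + (1/2) * (\<Sum>i\<in>UNIV - {Inl e, Inr e}. (x $ i)\<^sup>2)"

definition heis_norm :: "'n::finite \<Rightarrow> 'n heis \<Rightarrow> real" where
  "heis_norm e p = (case p of (x, t) \<Rightarrow>
     let n = real CARD('n); A = A_fun e x; B = B_fun e x in
     if x = 0 \<and> t = 0 then 0
     else (B\<^sup>2 + t\<^sup>2) powr (1 / (4 * n))
            * (A * B + t\<^sup>2 + A * sqrt (B\<^sup>2 + t\<^sup>2)) powr (1/2 - 1 / (4 * n))
            / (B + sqrt (B\<^sup>2 + t\<^sup>2)) powr (1/2))"

definition heis_Z :: "'n::finite \<Rightarrow> real \<Rightarrow> real" where
  "heis_Z e k = (\<integral>p. exp (- cosh (heis_norm e p powr k)) \<partial>lebesgue)"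

definition heis_measure :: "'n::finite \<Rightarrow> real \<Rightarrow> 'n heis measure" where
  "heis_measure e k =
     density lebesgue (\<lambda>p. ennreal (exp (- cosh (heis_norm e p powr k)) / heis_Z e k))"

text \<open>The fields are left-invariant: \<open>X\<^sub>i \<phi>\<close> at \<open>p\<close> is the derivative at \<open>s = 0\<close> of
  \<open>\<phi>\<close> along the curve \<open>p \<circ> (s e\<^sub>i, 0)\<close>.\<close>

lemma heis_mult_axis:
  "heis_mult e (x, t) (s *\<^sub>R axis (Inl j) 1, 0) =
     (x, t) + s *\<^sub>R ((axis (Inl j) 1, 0) - (if j = e then x $ Inr j / 2 else x $ Inr j) *\<^sub>R (0, 1))"
  "heis_mult e (x, t) (s *\<^sub>R axis (Inr j) 1, 0) =
     (x, t) + s *\<^sub>R ((axis (Inr j) 1, 0) + (if j = e then x $ Inl j / 2 else x $ Inl j) *\<^sub>R (0, 1))"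
proof -
  have *: "(\<Sum>k\<in>UNIV - {e}. s * (u k * axis j 1 $ k)) = (if j = e then 0 else s * u j)"
    for u :: "'a \<Rightarrow> real"
  proof -
    have "(\<Sum>k\<in>UNIV - {e}. s * (u k * axis j 1 $ k)) = (\<Sum>k\<in>UNIV - {e}. if k = j then s * u k else 0)"
      by (intro sum.cong) (auto simp: axis_def)
    then show ?thesis by simp
  qed
  have [simp]: "axis (Inl j) 1 $ Inl k = (axis j 1 :: real^'a) $ k"
    "axis (Inr j) 1 $ Inr k = (axis j 1 :: real^'a) $ k"
    "axis (Inl j) (1::real) $ Inr k = 0" "axis (Inr j) (1::real) $ Inl k = 0" for k
    by (auto simp: axis_def)
  show "heis_mult e (x, t) (s *\<^sub>R axis (Inl j) 1, 0) =
     (x, t) + s *\<^sub>R ((axis (Inl j) 1, 0) - (if j = e then x $ Inr j / 2 else x $ Inr j) *\<^sub>R (0, 1))"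
    using *[of "\<lambda>k. x $ Inr k"]
    by (auto simp: heis_mult_def axis_def sum_negf algebra_simps)
  show "heis_mult e (x, t) (s *\<^sub>R axis (Inr j) 1, 0) =
     (x, t) + s *\<^sub>R ((axis (Inr j) 1, 0) + (if j = e then x $ Inl j / 2 else x $ Inl j) *\<^sub>R (0, 1))"
    using *[of "\<lambda>k. x $ Inl k"]
    by (auto simp: heis_mult_def axis_def algebra_simps)
qed

lemma Xfield_left_invariant:
  assumes "\<phi> differentiable (at p)"
  shows "((\<lambda>s. \<phi> (heis_mult e p (s *\<^sub>R axis i 1, 0))) has_real_derivative Xfield e i \<phi> p) (at 0)"
proof -
  have D: "(\<phi> has_derivative frechet_derivative \<phi> (at p)) (at p)"
    using assms frechet_derivative_works by blast
  interpret L: bounded_linear "frechet_derivative \<phi> (at p)"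
    using D has_derivative_bounded_linear by blast
  have *: "((\<lambda>s. \<phi> (p + s *\<^sub>R v)) has_real_derivative frechet_derivative \<phi> (at p) v) (at 0)" for v
  proof -
    have "((\<lambda>s. p + s *\<^sub>R v) has_derivative (\<lambda>s. s *\<^sub>R v)) (at 0)"
      by (auto intro!: derivative_eq_intros)
    moreover have "(\<phi> has_derivative frechet_derivative \<phi> (at p)) (at (p + 0 *\<^sub>R v))"
      using D by simp
    ultimately have "((\<lambda>s. \<phi> (p + s *\<^sub>R v)) has_derivative
        (\<lambda>s. frechet_derivative \<phi> (at p) (s *\<^sub>R v))) (at 0)"
      by (rule has_derivative_compose)
    moreover have "(\<lambda>s. frechet_derivative \<phi> (at p) (s *\<^sub>R v)) = (*) (frechet_derivative \<phi> (at p) v)"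
      by (rule ext) (metis L.scaleR mult.commute real_scaleR_def)
    ultimately show ?thesis
      unfolding has_field_derivative_def by metis
  qed
  obtain x t where p: "p = (x, t)" by (cases p)
  show ?thesis
  proof (cases i)
    case (Inl j)
    then show ?thesis
      using *[of "(axis i 1, 0) - (if j = e then x $ Inr j / 2 else x $ Inr j) *\<^sub>R (0, 1)"]
      unfolding p Inl heis_mult_axis L.diff[unfolded p] L.scaleR[unfolded p]
      by (simp only: Xfield.simps ddx_def ddt_def real_scaleR_def)
  next
    case (Inr j)
    then show ?thesis
      using *[of "(axis i 1, 0) + (if j = e then x $ Inl j / 2 else x $ Inl j) *\<^sub>R (0, 1)"]
      unfolding p Inr heis_mult_axis L.add[unfolded p] L.scaleR[unfolded p]
      by (simp only: Xfield.simps ddx_def ddt_def real_scaleR_def)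
  qed
qed

end

theory Submission
  imports Defs "HOL-Probability.Probability"
begin

text \<open>
  Write \<open>V = cosh (N\<^sup>k)\<close>. The proof combines an inequality that controls \<open>f\<close> far out by its
  sub-gradient and by its values on a ball (\<open>weighted_U_bound\<close>) with a Poincare inequality on
  that ball (\<open>local_poincare\<close>), and then passes from smooth to weakly differentiable functions.

  For the first part put \<open>a = (x\<^sub>1\<^sup>2 + x\<^sub>n\<^sub>+\<^sub>1\<^sup>2) / 4\<close>, let \<open>s\<close> be half the sum of the squares of the other
  coordinates of \<open>x\<close>, and put \<open>B = a + s\<close>, \<open>P = B\<^sup>2 + t\<^sup>2\<close>, \<open>r = sqrt P\<close>. In these variables the norm
  becomes simple: \<open>4 n log N = 2 log r - log (r + B) + (2 n - 1) log (r + a)\<close> (\<open>heis_norm_eq\<close>).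
  On the \<open>t\<close>-axis the sub-gradient of \<open>N\<close> vanishes, so a field that merely points along
  \<open>- \<nabla>N\<close> gives nothing there. What helps is that, leaving the axis, \<open>N\<close> decreases in the
  directions counted by \<open>s\<close> and increases in those counted by \<open>a\<close>. Let \<open>E\<^sub>a\<close> and \<open>E\<^sub>s\<close> be the radial
  horizontal fields \<open>\<Sum> x\<^sub>i X\<^sub>i\<close> over the two groups of coordinates, and \<open>T\<close> the rotational horizontal
  field, which acts on functions of \<open>(a, s, t)\<close> as \<open>2 B \<partial>\<^sub>t\<close>. The polynomial horizontal field
  \<open>Y = - (t\<^sup>2 + B\<^sup>2) E\<^sub>a + (t\<^sup>2 - B\<^sup>2) E\<^sub>s - 2 s t T\<close> satisfies

  \<^item> \<open>Y (4 n log N) \<le> - 2 r B\<close> (\<open>hY_L\<close>),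

  \<^item> \<open>Y P = - 4 B\<^sup>2 P\<close> (\<open>hY_P\<close>),

  \<^item> \<open>div Y = (2 n - 4) t\<^sup>2 - (2 n + 4) B\<^sup>2 - 4 s B\<close> (\<open>hY_div\<close>).

  Thus \<open>div Y - Y V\<close> is large everywhere outside a ball: near the axis because of \<open>div Y\<close>, and
  elsewhere because \<open>V\<close> grows faster than every power of \<open>N\<close> (\<open>div_drift_bounds\<close>). Integrating
  the divergence of \<open>|u|\<^sup>q exp (- V) Y\<close>, multiplied by a cutoff, and using Young's inequality gives the
  bound. The outer cutoff is a decreasing function of \<open>P\<close>; since \<open>Y P \<le> 0\<close>, its derivative has the
  favourable sign and leaves no error term, however fast \<open>u\<close> grows.

  The local inequality holds because each element of a bounded set of the group is a product of
  boundedly many steps along the coordinate horizontal directions (vertical elements are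
  commutators), and right translations preserve Lebesgue measure (\<open>controlled_cball\<close>).

  For a general \<open>f\<close>, convolution on the left with a smooth approximate unit commutes with the
  left-invariant fields, so it turns the weak sub-gradient into a classical one
  (\<open>mollify_has_hderiv\<close>). With a compactly supported cutoff in place, Jensen's inequality on the
  gradient side and Fatou's lemma on the other side give the inequality for \<open>f\<close>
  (\<open>cutoff_poincare\<close>), and a second use of Fatou's lemma removes the cutoff.
\<close>

section \<open>Group law and invariance of Lebesgue measure\<close>

text \<open>The skew form behind the group law: \<open>(x, t) \<circ> (y, \<tau>) = (x + y, t + \<tau> + heis_form x y)\<close>. All the
  group axioms reduce to bilinearity, and the inverse of \<open>p\<close> is \<open>- p\<close> because the form is alternating.\<close>

definition heis_form :: "'n::finite \<Rightarrow> real ^ ('n + 'n) \<Rightarrow> real ^ ('n + 'n) \<Rightarrow> real" where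
  "heis_form e x y = x $ Inl e * y $ Inr e / 2 - x $ Inr e * y $ Inl e / 2
        + (\<Sum>j\<in>UNIV - {e}. x $ Inl j * y $ Inr j - y $ Inl j * x $ Inr j)"

lemma heis_mult_eq:
  "heis_mult e p r = (fst p + fst r, snd p + snd r + heis_form e (fst p) (fst r))"
  by (simp add: heis_mult_def heis_form_def split_beta)

lemma bounded_bilinear_heis_form: "bounded_bilinear (heis_form e)"
proof -
  have "bilinear (heis_form e)"
    unfolding bilinear_def heis_form_def
    by (auto intro!: linearI simp: algebra_simps sum.distrib sum_distrib_left sum_subtractf
        add_divide_distrib diff_divide_distrib)
  then show ?thesis by (simp add: bilinear_conv_bounded_bilinear)
qed

interpretation heis_form: bounded_bilinear "heis_form e" for e :: "'n::finite"
  by (rule bounded_bilinear_heis_form)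

lemma heis_form_self [simp]: "heis_form e x x = 0"
  by (simp add: heis_form_def)

lemma heis_form_commute: "heis_form e y x = - heis_form e x y"
  unfolding heis_form_def by (simp add: sum_subtractf algebra_simps)

lemmas heis_form_simps = heis_form.add_left heis_form.add_right heis_form.diff_left heis_form.diff_right heis_form.minus_left heis_form.minus_right
  heis_form.scaleR_left heis_form.scaleR_right heis_form.zero_left heis_form.zero_right

lemma heis_mult_assoc: "heis_mult e (heis_mult e p q) r = heis_mult e p (heis_mult e q r)"
  by (simp add: heis_mult_eq heis_form_simps)

lemma heis_mult_0 [simp]: "heis_mult e p 0 = p" "heis_mult e 0 p = p"
  by (simp_all add: heis_mult_eq heis_form_simps)

lemma heis_mult_minus [simp]: "heis_mult e p (- p) = 0" "heis_mult e (- p) p = 0"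
  by (simp_all add: heis_mult_eq heis_form_simps prod_eq_iff)

lemma heis_mult_cancel [simp]:
  "heis_mult e p (heis_mult e (- p) q) = q" "heis_mult e (- p) (heis_mult e p q) = q"
  by (simp_all flip: heis_mult_assoc)

lemma heis_mult_cancel_right [simp]:
  "heis_mult e (heis_mult e q p) (- p) = q" "heis_mult e (heis_mult e q (- p)) p = q"
  by (simp_all add: heis_mult_assoc)

lemma heis_minus_mult: "- heis_mult e p q = heis_mult e (- q) (- p)"
  by (simp add: heis_mult_eq heis_form_simps prod_eq_iff heis_form_commute[of e "fst q" "fst p"])

lemma continuous_heis_mult [continuous_intros]:
  assumes "continuous_on S f" "continuous_on S g"
  shows "continuous_on S (\<lambda>z. heis_mult e (f z) (g z))"
  unfolding heis_mult_eq
  by (intro continuous_intros assms heis_form.continuous_on)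

lemma continuous_heis_mult_pair: "continuous_on UNIV (\<lambda>z. heis_mult e (fst z) (snd z))"
  by (intro continuous_intros)

lemma measurable_heis_mult [measurable (raw)]:
  assumes "f \<in> borel_measurable M" "g \<in> borel_measurable M"
  shows "(\<lambda>z. heis_mult e (f z) (g z)) \<in> borel_measurable M"
proof -
  have "(\<lambda>z. heis_mult e (fst z) (snd z)) \<in> borel_measurable borel"
    by (intro borel_measurable_continuous_onI continuous_heis_mult_pair)
  then show ?thesis
    using measurable_compose[OF borel_measurable_Pair[OF assms], of "\<lambda>z. heis_mult e (fst z) (snd z)" borel] by simp
qed

lemma heis_mult_bounded:
  "\<exists>\<rho>'\<ge>0. \<forall>p q. norm p \<le> \<rho> \<longrightarrow> norm q \<le> \<sigma> \<longrightarrow> norm (heis_mult e p q) \<le> \<rho>'"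
proof -
  have "compact ((\<lambda>z. heis_mult e (fst z) (snd z)) ` (cball 0 \<rho> \<times> cball 0 \<sigma>))"
    by (rule compact_continuous_image[OF _ compact_Times[OF compact_cball compact_cball]])
       (rule continuous_on_subset[OF continuous_heis_mult_pair], simp)
  then obtain b where b: "\<forall>p\<in>cball 0 \<rho>. \<forall>q\<in>cball 0 \<sigma>. norm (heis_mult e p q) \<le> b"
    by (auto dest!: compact_imp_bounded simp: bounded_iff simp del: split_paired_All)
  have "norm (heis_mult e p q) \<le> max 0 b" if "norm p \<le> \<rho>" "norm q \<le> \<sigma>" for p q
    using that b[THEN bspec, of p, THEN bspec, of q] by (simp add: le_max_iff_disj)
  then show ?thesis
    by (intro exI[of _ "max 0 b"]) auto
qed

lemma nn_integral_lborel_translate: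
  fixes f :: "'a::euclidean_space \<Rightarrow> ennreal"
  assumes [measurable]: "f \<in> borel_measurable borel"
  shows "(\<integral>\<^sup>+x. f (c + x) \<partial>lborel) = (\<integral>\<^sup>+x. f x \<partial>lborel)"
  by (subst (2) lborel_distr_plus[of c, symmetric]) (simp add: nn_integral_distr)

lemma nn_integral_lborel_uminus:
  fixes f :: "'a::euclidean_space \<Rightarrow> ennreal"
  assumes [measurable]: "f \<in> borel_measurable borel"
  shows "(\<integral>\<^sup>+x. f (- x) \<partial>lborel) = (\<integral>\<^sup>+x. f x \<partial>lborel)"
  by (subst (2) lborel_affine[of "-1" 0])
     (simp_all add: density_1 nn_integral_distr)

text \<open>Left and right translations are both of this form, with \<open>b\<close> linear; the shear is a translation
  in \<open>t\<close> on each vertical line, so Fubini reduces the claim to translation invariance.\<close>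

lemma nn_integral_lborel_shear:
  fixes f :: "'a::euclidean_space \<times> real \<Rightarrow> ennreal"
  assumes [measurable]: "f \<in> borel_measurable borel" "b \<in> borel_measurable borel"
  shows "(\<integral>\<^sup>+p. f (fst p + x0, snd p + t0 + b (fst p)) \<partial>lborel) = (\<integral>\<^sup>+p. f p \<partial>lborel)"
proof -
  have [measurable]: "f \<in> borel_measurable (borel \<Otimes>\<^sub>M borel)"
    by (simp add: borel_prod)
  have "(\<integral>\<^sup>+p. f (fst p + x0, snd p + t0 + b (fst p)) \<partial>lborel)
      = (\<integral>\<^sup>+x. (\<integral>\<^sup>+t. f (x + x0, t + t0 + b x) \<partial>lborel) \<partial>lborel)"
    by (simp flip: lborel_prod add: lborel.nn_integral_fst[symmetric] split_beta')
  also have "\<dots> = (\<integral>\<^sup>+x. (\<integral>\<^sup>+t. f (x0 + x, t) \<partial>lborel) \<partial>lborel)"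
  proof (rule nn_integral_cong)
    fix x
    have "(\<lambda>t. f (x0 + x, t)) \<in> borel_measurable borel" by measurable
    from nn_integral_lborel_translate[OF this, of "t0 + b x"]
    show "(\<integral>\<^sup>+t. f (x + x0, t + t0 + b x) \<partial>lborel) = (\<integral>\<^sup>+t. f (x0 + x, t) \<partial>lborel)"
      by (simp add: add_ac)
  qed
  also have "\<dots> = (\<integral>\<^sup>+x. (\<integral>\<^sup>+t. f (x, t) \<partial>lborel) \<partial>lborel)"
    by (rule nn_integral_lborel_translate[of "\<lambda>x. \<integral>\<^sup>+t. f (x, t) \<partial>lborel"]) measurable
  also have "\<dots> = (\<integral>\<^sup>+p. f p \<partial>lborel)"
    by (simp flip: lborel_prod add: lborel.nn_integral_fst[symmetric] split_beta')
  finally show ?thesis .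
qed

lemma nn_integral_heis_right:
  assumes [measurable]: "f \<in> borel_measurable borel"
  shows "(\<integral>\<^sup>+p. f (heis_mult e p h) \<partial>lborel) = (\<integral>\<^sup>+p. f p \<partial>lborel)"
  using nn_integral_lborel_shear[of f "\<lambda>x. heis_form e x (fst h)" "fst h" "snd h"]
  by (simp add: heis_mult_eq borel_measurable_continuous_onI heis_form.continuous_on continuous_on_const continuous_on_id)

lemma nn_integral_heis_left:
  assumes [measurable]: "f \<in> borel_measurable borel"
  shows "(\<integral>\<^sup>+p. f (heis_mult e h p) \<partial>lborel) = (\<integral>\<^sup>+p. f p \<partial>lborel)"
  using nn_integral_lborel_shear[of f "\<lambda>x. heis_form e (fst h) x" "fst h" "snd h"]
  by (simp add: heis_mult_eq borel_measurable_continuous_onI heis_form.continuous_on continuous_on_const continuous_on_id add.commute)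

lemma distr_lborel_eqI:
  assumes [measurable]: "T \<in> borel_measurable borel"
    and "\<And>f. f \<in> borel_measurable borel \<Longrightarrow> (\<integral>\<^sup>+x. f (T x) \<partial>lborel) = (\<integral>\<^sup>+x. f x \<partial>lborel)"
  shows "distr lborel borel T = lborel"
proof (rule measure_eqI)
  fix A assume "A \<in> sets (distr lborel borel T)"
  then have [measurable]: "A \<in> sets borel" by simp
  have "emeasure (distr lborel borel T) A = (\<integral>\<^sup>+x. indicator A x \<partial>distr lborel borel T)"
    by simp
  also have "\<dots> = (\<integral>\<^sup>+x. indicator A (T x) \<partial>lborel)"
    by (intro nn_integral_distr) simp_all
  also have "\<dots> = emeasure lborel A"
    using assms(2)[of "indicator A"] by simp
  finally show "emeasure (distr lborel borel T) A = emeasure lborel A" .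
qed simp

lemma distr_heis_right: "distr lborel borel (\<lambda>p. heis_mult e p h) = lborel"
  by (rule distr_lborel_eqI) (simp_all add: nn_integral_heis_right)

text \<open>The substitution \<open>g = h \<circ> p\<^sup>-\<^sup>1\<close>, by which the two ways of writing a convolution agree.\<close>

lemma distr_heis_left_minus: "distr lborel borel (\<lambda>p. heis_mult e h (- p)) = lborel"
  by (rule distr_lborel_eqI)
     (simp_all add: nn_integral_lborel_uminus[of "\<lambda>p. _ (heis_mult e h p)"] nn_integral_heis_left)

section \<open>Powers and Jensen's inequality\<close>

text \<open>A convex function lies above its tangents; for powers this is Young's inequality.\<close>

lemma powr_tangent:
  fixes z b q :: real
  assumes "z \<ge> 0" "b \<ge> 0" "q \<ge> 1"
  shows "z powr q \<ge> b powr q + q * b powr (q - 1) * (z - b)"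
proof (cases "b = 0 \<or> q = 1")
  case True
  then show ?thesis using assms by auto
next
  case False
  then have q: "q > 1" and b: "b > 0" using assms by auto
  have "z * b powr (q - 1) \<le> z powr q / q + (b powr (q - 1)) powr (q / (q - 1)) / (q / (q - 1))"
    using q assms by (intro Youngs_inequality) (auto simp: field_simps)
  also have "(b powr (q - 1)) powr (q / (q - 1)) = b powr q"
    using q by (simp add: powr_powr)
  finally have "q * (z * b powr (q - 1)) \<le> z powr q + (q - 1) * b powr q"
    using q by (simp add: field_simps)
  moreover have "b powr q = b powr (q - 1) * b"
    using b by (simp add: powr_diff)
  ultimately show ?thesis by (simp add: algebra_simps)
qed

text \<open>Integrate the tangent inequality at \<open>b = \<bar>\<integral>X\<bar>\<close> and use \<open>b \<le> \<integral>\<bar>X\<bar>\<close>. The right-hand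
  side lives in the extended reals, so that it may be infinite.\<close>

lemma (in prob_space) jensen_powr:
  fixes X :: "'a \<Rightarrow> 'b::{banach, second_countable_topology}"
  assumes X: "integrable M X" and q: "q \<ge> 1"
  shows "ennreal (norm (\<integral>x. X x \<partial>M) powr q) \<le> (\<integral>\<^sup>+x. ennreal (norm (X x) powr q) \<partial>M)"
proof (cases "(\<integral>\<^sup>+x. ennreal (norm (X x) powr q) \<partial>M) = \<infinity>")
  case False
  have [measurable]: "X \<in> borel_measurable M" using X by simp
  have I: "integrable M (\<lambda>x. norm (X x) powr q)"
    using False by (intro integrableI_nonneg) (auto simp: top.not_eq_extremum)
  let ?b = "norm (\<integral>x. X x \<partial>M)"
  have "?b powr q \<le> ?b powr q + q * ?b powr (q - 1) * ((\<integral>x. norm (X x) \<partial>M) - ?b)"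
    using q integral_norm_bound[of M X] by simp
  also have "\<dots> = (\<integral>x. ?b powr q + q * ?b powr (q - 1) * (norm (X x) - ?b) \<partial>M)"
    using X by (simp add: prob_space)
  also have "\<dots> \<le> (\<integral>x. norm (X x) powr q \<partial>M)"
    using X I q by (intro integral_mono) (auto intro!: powr_tangent)
  finally show ?thesis
    using I by (simp add: nn_integral_eq_integral ennreal_leI)
qed simp

lemma powr_add_le:
  fixes a b q :: real
  assumes "a \<ge> 0" "b \<ge> 0" "q \<ge> 0"
  shows "(a + b) powr q \<le> 2 powr q * (a powr q + b powr q)"
proof -
  have "(a + b) powr q \<le> (2 * max a b) powr q"
    using assms by (intro powr_mono2) auto
  also have "\<dots> = 2 powr q * (max a b) powr q"
    using assms by (simp add: powr_mult)
  also have "max a b powr q \<le> a powr q + b powr q"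
    using assms by (auto simp: max_def)
  finally show ?thesis by simp
qed

section \<open>Differentiation along the horizontal directions\<close>

text \<open>Right multiplication by \<open>hstep i s\<close> is the flow of \<open>X\<^sub>i\<close> for time \<open>s\<close>.\<close>

definition hstep :: "'n::finite + 'n \<Rightarrow> real \<Rightarrow> 'n heis" where
  "hstep i s = (s *\<^sub>R axis i 1, 0)"

lemma hstep_0 [simp]: "hstep i 0 = 0"
  by (simp add: hstep_def zero_prod_def)

lemma hstep_add: "heis_mult e (hstep i s) (hstep i t) = hstep i (s + t)"
  by (simp add: heis_mult_eq hstep_def heis_form_simps scaleR_left_distrib)

lemma heis_mult_hstep_hstep [simp]:
  "heis_mult e (heis_mult e p (hstep i s)) (hstep i t) = heis_mult e p (hstep i (s + t))"
  by (simp add: heis_mult_assoc hstep_add)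

lemma continuous_hstep [continuous_intros]:
  "continuous_on S f \<Longrightarrow> continuous_on S (\<lambda>z. hstep i (f z))"
  unfolding hstep_def by (intro continuous_intros)

lemma measurable_hstep [measurable (raw)]:
  assumes "f \<in> borel_measurable M"
  shows "(\<lambda>z. hstep i (f z)) \<in> borel_measurable M"
proof -
  have "hstep i \<in> borel_measurable borel"
    using continuous_hstep[OF continuous_on_id] by (intro borel_measurable_continuous_onI) simp
  then show ?thesis using assms by (rule measurable_compose[rotated])
qed

lemma norm_hstep [simp]: "norm (hstep i s) = \<bar>s\<bar>"
  by (simp add: hstep_def norm_Pair)

lemma cball_in_borel [measurable]: "cball a r \<in> sets (borel :: 'a::metric_space measure)"
  by simp

text \<open>Differentiability is only required along the flow lines of one field, since mollification gives
  just these derivatives at once, without any statement about total differentiability.\<close>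

definition has_hderiv ::
    "'n::finite \<Rightarrow> 'n + 'n \<Rightarrow> ('n heis \<Rightarrow> real) \<Rightarrow> ('n heis \<Rightarrow> real) \<Rightarrow> bool" where
  "has_hderiv e i u d \<longleftrightarrow>
     (\<forall>p. ((\<lambda>s. u (heis_mult e p (hstep i s))) has_real_derivative d p) (at 0))"

lemma has_hderiv_at:
  assumes "has_hderiv e i u d"
  shows "((\<lambda>s. u (heis_mult e p (hstep i s))) has_real_derivative d (heis_mult e p (hstep i s))) (at s)"
proof -
  have "((\<lambda>t. u (heis_mult e p (hstep i (t + s)))) has_real_derivative
      d (heis_mult e p (hstep i s))) (at 0)"
    using assms[unfolded has_hderiv_def, rule_format, of "heis_mult e p (hstep i s)"]
    by (simp add: add.commute)
  then show ?thesis
    using DERIV_shift[of "\<lambda>s. u (heis_mult e p (hstep i s))" "d (heis_mult e p (hstep i s))" 0 s]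
    by simp
qed

lemma has_hderiv_scaled_at:
  assumes "has_hderiv e i u d"
  shows "((\<lambda>v. u (heis_mult e p (hstep i (v * s)))) has_real_derivative
           s * d (heis_mult e p (hstep i (v * s)))) (at v)"
proof -
  have "((\<lambda>v. v * s) has_real_derivative s) (at v)"
    by (auto intro!: derivative_eq_intros)
  from DERIV_chain2[where f = "\<lambda>s. u (heis_mult e p (hstep i s))" and g = "\<lambda>v. v * s",
      OF has_hderiv_at[OF assms] this]
  show ?thesis by (simp add: mult.commute)
qed

lemma has_hderiv_mult:
  assumes "has_hderiv e i u d" "has_hderiv e i v c"
  shows "has_hderiv e i (\<lambda>p. u p * v p) (\<lambda>p. d p * v p + u p * c p)"
  using assms unfolding has_hderiv_def
  by (auto intro!: derivative_eq_intros simp: mult.commute)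

definition horiz_C1 ::
    "'n::finite \<Rightarrow> ('n heis \<Rightarrow> real) \<Rightarrow> ('n heis \<Rightarrow> real ^ ('n + 'n)) \<Rightarrow> bool" where
  "horiz_C1 e u g \<longleftrightarrow> continuous_on UNIV u \<and> continuous_on UNIV g \<and>
     (\<forall>i. has_hderiv e i u (\<lambda>p. g p $ i))"

lemma horiz_C1_measurable [measurable_dest]:
  "horiz_C1 e u g \<Longrightarrow> u \<in> borel_measurable borel" "horiz_C1 e u g \<Longrightarrow> g \<in> borel_measurable borel"
  by (auto simp: horiz_C1_def intro: borel_measurable_continuous_onI)

lemma integrable_continuous_bounded_support:
  fixes f :: "'a::euclidean_space \<Rightarrow> real"
  assumes "continuous_on UNIV f" "\<And>p. norm p > \<rho> \<Longrightarrow> f p = 0"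
  shows "integrable lborel f"
proof -
  have "integrable lborel (\<lambda>x. indicator (cball 0 \<rho>) x *\<^sub>R f x)"
    by (rule borel_integrable_compact) (use assms in \<open>auto intro: continuous_on_subset\<close>)
  moreover have "(\<lambda>x. indicator (cball 0 \<rho>) x *\<^sub>R f x) = f"
    using assms(2) by (auto simp: indicator_def fun_eq_iff not_le)
  ultimately show ?thesis by simp
qed

text \<open>Integrating \<open>d\<close> along a flow line of length one gives \<open>u (p \<circ> hstep i 1) - u p\<close>; integrated over
  \<open>p\<close> this vanishes by right invariance, while by Fubini it is the integral of \<open>d\<close>. Applied to
  products, this is integration by parts.\<close>

lemma integral_hderiv_eq_0:
  assumes d: "has_hderiv e i u d" and c: "continuous_on UNIV u" "continuous_on UNIV d"
    and z: "\<And>p. norm p > \<rho> \<Longrightarrow> u p = 0" "\<And>p. norm p > \<rho> \<Longrightarrow> d p = 0"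
  shows "(\<integral>p. d p \<partial>lborel) = 0"
proof -
  obtain \<rho>' where \<rho>': "\<And>p q. norm p \<le> \<rho> \<Longrightarrow> norm q \<le> 1 \<Longrightarrow> norm (heis_mult e p q) \<le> \<rho>'"
    using heis_mult_bounded[of \<rho> 1 e] by blast
  have out: "d (heis_mult e p (hstep i s)) = 0" if "s \<in> {0..1}" "norm p > \<rho>'" for p s
  proof (rule z, rule ccontr)
    assume "\<not> norm (heis_mult e p (hstep i s)) > \<rho>"
    then have "norm (heis_mult e (heis_mult e p (hstep i s)) (hstep i (- s))) \<le> \<rho>'"
      using that by (intro \<rho>') auto
    then show False using that by simp
  qed
  define F where "F = (\<lambda>p s. indicator {0..1::real} s *\<^sub>R d (heis_mult e p (hstep i s)))"
  have cd: "continuous_on S (\<lambda>z. d (heis_mult e (f z) (hstep i (g z))))"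
    if "continuous_on S f" "continuous_on S g" for S :: "'b::topological_space set" and f g
    by (rule continuous_on_compose2[OF c(2)]) (auto intro!: continuous_intros that)
  have "integrable (lborel \<Otimes>\<^sub>M lborel) (\<lambda>z. indicator (cball 0 \<rho>' \<times> {0..1}) z *\<^sub>R
      d (heis_mult e (fst z) (hstep i (snd z))))"
    unfolding lborel_prod
    by (rule borel_integrable_compact)
       (intro compact_Times compact_cball compact_Icc, intro cd continuous_intros)
  moreover have "(\<lambda>z. indicator (cball 0 \<rho>' \<times> {0..1}) z *\<^sub>R
      d (heis_mult e (fst z) (hstep i (snd z)))) = (\<lambda>(p, s). F p s)"
    \<comment> \<open>The integrand vanishes unless \<open>p\<close> lies in the enlarged ball, so it is integrable on the product.\<close>
    using out by (auto simp: F_def fun_eq_iff indicator_def split: if_splits)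
  ultimately have int: "integrable (lborel \<Otimes>\<^sub>M lborel) (\<lambda>(p, s). F p s)" by simp
  have 1: "(\<integral>s. F p s \<partial>lborel) = u (heis_mult e p (hstep i 1)) - u p" for p
  proof -
    have "continuous_on {0..1} (\<lambda>s. d (heis_mult e p (hstep i s)))"
      by (intro cd continuous_intros)
    then have "(\<integral>s. F p s \<partial>lborel) = u (heis_mult e p (hstep i 1)) - u (heis_mult e p (hstep i 0))"
      unfolding F_def using has_hderiv_at[OF d, of p]
      by (intro integral_FTC_atLeastAtMost)
         (auto simp: has_real_derivative_iff_has_vector_derivative
           intro: has_vector_derivative_at_within)
    then show ?thesis by simp
  qed
  have 2: "(\<integral>p. w (heis_mult e p h) \<partial>lborel) = (\<integral>p. w p \<partial>lborel)" 
    if "continuous_on UNIV w" for w :: "'a heis \<Rightarrow> real" and h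
  proof -
    have [measurable]: "w \<in> borel_measurable borel" using that by (rule borel_measurable_continuous_onI)
    show ?thesis
      by (subst (2) distr_heis_right[of e h, symmetric]) (simp add: integral_distr)
  qed
  have iu: "integrable lborel u"
    by (rule integrable_continuous_bounded_support[OF c(1) z(1)])
  have iu': "integrable lborel (\<lambda>p. u (heis_mult e p (hstep i 1)))"
  proof -
    have [measurable]: "u \<in> borel_measurable borel" using c(1) by (rule borel_measurable_continuous_onI)
    have "integrable (distr lborel borel (\<lambda>p. heis_mult e p (hstep i 1))) u"
      unfolding distr_heis_right by (rule iu)
    then show ?thesis by (simp add: integrable_distr_eq)
  qed
  have "(\<integral>s. (\<integral>p. F p s \<partial>lborel) \<partial>lborel) = (\<integral>p. (\<integral>s. F p s \<partial>lborel) \<partial>lborel)"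
    by (rule lborel_pair.Fubini_integral[OF int])
  also have "\<dots> = 0"
    unfolding 1 using iu iu' 2[OF c(1)] by simp
  also have "(\<integral>s. (\<integral>p. F p s \<partial>lborel) \<partial>lborel) = (\<integral>s. indicator {0..1::real} s *\<^sub>R (\<integral>p. d p \<partial>lborel) \<partial>lborel)"
    unfolding F_def using 2[OF c(2)] by simp
  also have "\<dots> = (\<integral>p. d p \<partial>lborel)"
    by simp
  finally show ?thesis .
qed

lemma jensen_unit_interval:
  fixes X :: "real \<Rightarrow> real"
  assumes X: "continuous_on {0..1} X" and q: "q \<ge> 1"
  shows "ennreal (\<bar>\<integral>v. indicator {0..1} v *\<^sub>R X v \<partial>lborel\<bar> powr q)
    \<le> (\<integral>\<^sup>+v. ennreal (\<bar>X v\<bar> powr q) * indicator {0..1} v \<partial>lborel)"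
proof -
  let ?M = "restrict_space lborel {0..1::real}"
  interpret prob_space ?M
    by (intro prob_spaceI) (simp add: emeasure_restrict_space space_restrict_space)
  have "integrable ?M X"
    using borel_integrable_atLeastAtMost'[OF X]
    by (simp add: set_integrable_def integrable_restrict_space)
  from jensen_powr[OF this q] show ?thesis
    by (simp add: integral_restrict_space nn_integral_restrict_space set_lebesgue_integral_def)
qed

section \<open>The local Poincare inequality\<close>

abbreviation ball_energy where
  "ball_energy q \<rho> g \<equiv> \<integral>\<^sup>+p. ennreal (norm (g p) powr q) * indicator (cball 0 \<rho>) p \<partial>lborel"

abbreviation shift_energy where
  "shift_energy e q \<rho> u h \<equiv>
     \<integral>\<^sup>+p. ennreal (\<bar>u (heis_mult e p h) - u p\<bar> powr q) * indicator (cball 0 \<rho>) p \<partial>lborel"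

abbreviation ball_osc where
  "ball_osc q \<rho> u \<equiv> \<integral>\<^sup>+p. (\<integral>\<^sup>+p'. ennreal (\<bar>u p - u p'\<bar> powr q)
     * indicator (cball 0 \<rho>) p * indicator (cball 0 \<rho>) p' \<partial>lborel) \<partial>lborel"

text \<open>The increment of \<open>u\<close> is the mean of \<open>s\<close> times its derivative along the segment; Jensen moves the
  power inside the mean, and each right translate of the ball stays in the larger ball.\<close>

lemma step_poincare:
  assumes u: "horiz_C1 e u g" and q: "q \<ge> 1"
    and \<rho>': "\<And>p v. norm p \<le> \<rho> \<Longrightarrow> \<bar>v\<bar> \<le> \<bar>s\<bar> \<Longrightarrow> norm (heis_mult e p (hstep i v)) \<le> \<rho>'"
  shows "(\<integral>\<^sup>+p. ennreal (\<bar>u (heis_mult e p (hstep i s)) - u p\<bar> powr q) * indicator (cball 0 \<rho>) p \<partial>lborel)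
    \<le> ennreal (\<bar>s\<bar> powr q) * (ball_energy q \<rho>' g)"
proof -
  note [measurable] = horiz_C1_measurable[OF u]
  have cg: "continuous_on UNIV g" and dg: "has_hderiv e i u (\<lambda>p. g p $ i)"
    using u by (auto simp: horiz_C1_def)
  define G where "G p = ennreal (norm (g p) powr q) * indicator (cball 0 \<rho>') p" for p
  have [measurable]: "G \<in> borel_measurable borel" unfolding G_def by measurable
  have "(\<integral>\<^sup>+p. ennreal (\<bar>u (heis_mult e p (hstep i s)) - u p\<bar> powr q) * indicator (cball 0 \<rho>) p \<partial>lborel)
    \<le> (\<integral>\<^sup>+p. (\<integral>\<^sup>+v. ennreal (\<bar>s\<bar> powr q) * G (heis_mult e p (hstep i (v * s))) * indicator {0..1} v \<partial>lborel) \<partial>lborel)"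
  proof (intro nn_integral_mono)
    fix p
    let ?X = "\<lambda>v. s * g (heis_mult e p (hstep i (v * s))) $ i"
    have cX: "continuous_on {0..1} ?X"
      by (intro continuous_intros continuous_on_compose2[OF cg]) auto
    show "ennreal (\<bar>u (heis_mult e p (hstep i s)) - u p\<bar> powr q) * indicator (cball 0 \<rho>) p
        \<le> (\<integral>\<^sup>+v. ennreal (\<bar>s\<bar> powr q) * G (heis_mult e p (hstep i (v * s))) * indicator {0..1} v \<partial>lborel)"
    proof (cases "norm p \<le> \<rho>")
      case True
      have "(\<integral>v. indicator {0..1} v *\<^sub>R ?X v \<partial>lborel)
          = u (heis_mult e p (hstep i (1 * s))) - u (heis_mult e p (hstep i (0 * s)))"
        using has_hderiv_scaled_at[OF dg, of p s] cX
        by (intro integral_FTC_atLeastAtMost)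
           (auto simp: has_real_derivative_iff_has_vector_derivative
            intro: has_vector_derivative_at_within)
      then have "ennreal (\<bar>u (heis_mult e p (hstep i s)) - u p\<bar> powr q)
          \<le> (\<integral>\<^sup>+v. ennreal (\<bar>?X v\<bar> powr q) * indicator {0..1} v \<partial>lborel)"
        using jensen_unit_interval[OF cX q] by simp
      also have "\<dots> \<le> (\<integral>\<^sup>+v. ennreal (\<bar>s\<bar> powr q) * G (heis_mult e p (hstep i (v * s))) * indicator {0..1} v \<partial>lborel)"
      proof (rule nn_integral_mono)
        fix v :: real
        show "ennreal (\<bar>?X v\<bar> powr q) * indicator {0..1} v
          \<le> ennreal (\<bar>s\<bar> powr q) * G (heis_mult e p (hstep i (v * s))) * indicator {0..1} v"
        proof (cases "v \<in> {0..1}")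
          case v: True
          then have "norm (heis_mult e p (hstep i (v * s))) \<le> \<rho>'"
            using True by (intro \<rho>') (auto simp: abs_mult mult_left_le_one_le)
          moreover have "\<bar>?X v\<bar> powr q \<le> \<bar>s\<bar> powr q * norm (g (heis_mult e p (hstep i (v * s)))) powr q"
            using q component_le_norm_cart[of "g (heis_mult e p (hstep i (v * s)))" i]
            by (auto simp: abs_mult powr_mult intro!: mult_left_mono powr_mono2)
          ultimately show ?thesis using v by (simp add: G_def ennreal_leI flip: ennreal_mult)
        qed simp
      qed
      finally show ?thesis using True by simp
    qed simp
  qed
  also have "\<dots> = (\<integral>\<^sup>+v. (\<integral>\<^sup>+p. ennreal (\<bar>s\<bar> powr q) * G (heis_mult e p (hstep i (v * s))) * indicator {0..1} v \<partial>lborel) \<partial>lborel)"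
    by (rule lborel_pair.Fubini') measurable
  also have "\<dots> = (\<integral>\<^sup>+v. (ennreal (\<bar>s\<bar> powr q) * (\<integral>\<^sup>+p. G p \<partial>lborel)) * indicator {0..1::real} v \<partial>lborel)"
    by (simp add: nn_integral_multc nn_integral_cmult nn_integral_heis_right)
  also have "\<dots> = ennreal (\<bar>s\<bar> powr q) * (\<integral>\<^sup>+p. G p \<partial>lborel)"
    by (simp add: nn_integral_cmult)
  finally show ?thesis by (simp add: G_def)
qed

text \<open>A bounded set \<open>H\<close> is controlled if right translations by its elements change \<open>u\<close>, in \<open>L\<^sup>q\<close> of any ball, by
  at most a multiple of the energy of a larger ball, uniformly in \<open>u\<close> and in \<open>h \<in> H\<close>. The
  quantification over all balls is what makes the notion stable under products.\<close>

definition controlled :: "'n::finite \<Rightarrow> real \<Rightarrow> 'n heis set \<Rightarrow> bool" where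
  "controlled e q H \<longleftrightarrow> bounded H \<and>
     (\<forall>\<rho>. \<exists>C\<ge>0. \<exists>\<rho>'. \<forall>u g. horiz_C1 e u g \<longrightarrow> (\<forall>h\<in>H.
        (shift_energy e q \<rho> u h)
          \<le> ennreal C * (ball_energy q \<rho>' g)))"

lemma controlled_subset: "controlled e q H \<Longrightarrow> H' \<subseteq> H \<Longrightarrow> controlled e q H'"
  unfolding controlled_def by (meson bounded_subset subsetD)

lemma controlled_step:
  assumes "q \<ge> 1"
  shows "controlled e q {hstep i s | s. \<bar>s\<bar> \<le> S}"
  unfolding controlled_def
proof (intro conjI allI)
  show "bounded {hstep i s | s. \<bar>s\<bar> \<le> S}"
    by (rule boundedI[of _ S]) auto
  fix \<rho>
  obtain \<rho>' where \<rho>': "\<And>p r. norm p \<le> \<rho> \<Longrightarrow> norm r \<le> S \<Longrightarrow> norm (heis_mult e p r) \<le> \<rho>'"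
    using heis_mult_bounded[of \<rho> S e] by blast
  show "\<exists>C\<ge>0. \<exists>\<rho>'. \<forall>u g. horiz_C1 e u g \<longrightarrow> (\<forall>h\<in>{hstep i s | s. \<bar>s\<bar> \<le> S}.
        (shift_energy e q \<rho> u h)
          \<le> ennreal C * (ball_energy q \<rho>' g))"
  proof (intro exI conjI allI impI ballI)
    show "0 \<le> S powr q" by simp
    fix u g h assume u: "horiz_C1 e u g" and "h \<in> {hstep i s | s. \<bar>s\<bar> \<le> S}"
    then obtain s where s: "h = hstep i s" "\<bar>s\<bar> \<le> S" by auto
    have "(shift_energy e q \<rho> u h)
      \<le> ennreal (\<bar>s\<bar> powr q) * (ball_energy q \<rho>' g)"
      unfolding s(1) by (rule step_poincare[OF u assms]) (use s \<rho>' in auto)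
    also have "\<dots> \<le> ennreal (S powr q) * (ball_energy q \<rho>' g)"
      using s assms by (intro mult_right_mono ennreal_leI powr_mono2) auto
    finally show "(shift_energy e q \<rho> u h)
      \<le> ennreal (S powr q) * (ball_energy q \<rho>' g)" .
  qed
qed

text \<open>Telescoping \<open>u (p h\<^sub>1 h\<^sub>2) - u p\<close> through \<open>u (p h\<^sub>1)\<close>; the first difference is moved back to \<open>p\<close> by right
  invariance, at the price of a larger ball.\<close>

lemma controlled_mult:
  assumes H1: "controlled e q H1" and H2: "controlled e q H2" and q: "q \<ge> 1"
  shows "controlled e q {heis_mult e h1 h2 | h1 h2. h1 \<in> H1 \<and> h2 \<in> H2}"
  unfolding controlled_def
proof (intro conjI allI)
  have "bounded H1" "bounded H2"
    using H1 H2 by (simp_all add: controlled_def)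
  then obtain b1 b2 where b: "\<And>h. h \<in> H1 \<Longrightarrow> norm h \<le> b1" "\<And>h. h \<in> H2 \<Longrightarrow> norm h \<le> b2"
    using \<open>bounded H1\<close> \<open>bounded H2\<close> unfolding bounded_iff by blast
  obtain b3 where "\<And>p r. norm p \<le> b1 \<Longrightarrow> norm r \<le> b2 \<Longrightarrow> norm (heis_mult e p r) \<le> b3"
    using heis_mult_bounded[of b1 b2 e] by blast
  with b show "bounded {heis_mult e h1 h2 | h1 h2. h1 \<in> H1 \<and> h2 \<in> H2}"
    by (intro boundedI[of _ b3]) auto
  fix \<rho>
  obtain \<rho>1 where \<rho>1: "\<And>p r. norm p \<le> \<rho> \<Longrightarrow> norm r \<le> b1 \<Longrightarrow> norm (heis_mult e p r) \<le> \<rho>1"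
    using heis_mult_bounded[of \<rho> b1 e] by blast
  define I where "I g r = (ball_energy q r g)"
    for g :: "'a heis \<Rightarrow> real ^ ('a + 'a)" and r
  define D where "D u h r = (shift_energy e q r u h)"
    for u h r
  have ctrl: "\<exists>C\<ge>0. \<exists>\<rho>'. \<forall>u g. horiz_C1 e u g \<longrightarrow> (\<forall>h\<in>H. D u h \<rho> \<le> ennreal C * I g \<rho>')"
    if "controlled e q H" for H \<rho>
    using that unfolding controlled_def D_def I_def by (elim conjE allE)
  obtain C1 r1 where 1: "C1 \<ge> 0" "\<And>u g h. horiz_C1 e u g \<Longrightarrow> h \<in> H1 \<Longrightarrow> D u h \<rho> \<le> ennreal C1 * I g r1"
    using ctrl[OF H1, of \<rho>] by blast
  obtain C2 r2 where 2: "C2 \<ge> 0" "\<And>u g h. horiz_C1 e u g \<Longrightarrow> h \<in> H2 \<Longrightarrow> D u h \<rho>1 \<le> ennreal C2 * I g r2"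
    using ctrl[OF H2, of \<rho>1] by blast
  have I_mono: "I g r \<le> I g r'" if "r \<le> r'" for g r r'
    unfolding I_def using that by (intro nn_integral_mono mult_left_mono) (auto simp: indicator_def)
  have "\<forall>u g. horiz_C1 e u g \<longrightarrow> (\<forall>h\<in>{heis_mult e h1 h2 | h1 h2. h1 \<in> H1 \<and> h2 \<in> H2}.
        D u h \<rho> \<le> ennreal (2 powr q * (C1 + C2)) * I g (max r1 r2))"
  proof (intro allI impI ballI)
    fix u g h assume u: "horiz_C1 e u g" and "h \<in> {heis_mult e h1 h2 | h1 h2. h1 \<in> H1 \<and> h2 \<in> H2}"
    then obtain h1 h2 where h: "h = heis_mult e h1 h2" "h1 \<in> H1" "h2 \<in> H2" by auto
    note [measurable] = horiz_C1_measurable[OF u]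
    define W where "W p = ennreal (\<bar>u (heis_mult e p h2) - u p\<bar> powr q) * indicator (cball 0 \<rho>1) p" for p
    have [measurable]: "W \<in> borel_measurable borel" unfolding W_def by measurable
    have "D u h \<rho> \<le> (\<integral>\<^sup>+p. ennreal (2 powr q) * (W (heis_mult e p h1) +
        ennreal (\<bar>u (heis_mult e p h1) - u p\<bar> powr q) * indicator (cball 0 \<rho>) p) \<partial>lborel)"
      unfolding D_def
    proof (rule nn_integral_mono)
      fix p
      show "ennreal (\<bar>u (heis_mult e p h) - u p\<bar> powr q) * indicator (cball 0 \<rho>) p
        \<le> ennreal (2 powr q) * (W (heis_mult e p h1) +
           ennreal (\<bar>u (heis_mult e p h1) - u p\<bar> powr q) * indicator (cball 0 \<rho>) p)"
      proof (cases "norm p \<le> \<rho>")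
        case True
        then have n: "norm (heis_mult e p h1) \<le> \<rho>1" using h b by (intro \<rho>1) auto
        have "\<bar>u (heis_mult e p h) - u p\<bar> powr q
          \<le> (\<bar>u (heis_mult e (heis_mult e p h1) h2) - u (heis_mult e p h1)\<bar> + \<bar>u (heis_mult e p h1) - u p\<bar>) powr q"
          using q unfolding h(1) heis_mult_assoc by (intro powr_mono2) auto
        also have "\<dots> \<le> 2 powr q * (\<bar>u (heis_mult e (heis_mult e p h1) h2) - u (heis_mult e p h1)\<bar> powr q
            + \<bar>u (heis_mult e p h1) - u p\<bar> powr q)"
          using q by (intro powr_add_le) auto
        finally show ?thesis using True n
          by (simp add: W_def flip: ennreal_plus ennreal_mult)
      qed simp
    qed
    also have "\<dots> = ennreal (2 powr q) * (D u h2 \<rho>1 + D u h1 \<rho>)"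
      by (simp add: nn_integral_cmult nn_integral_add nn_integral_heis_right D_def W_def[symmetric])
    also have "\<dots> \<le> ennreal (2 powr q) * (ennreal C2 * I g (max r1 r2) + ennreal C1 * I g (max r1 r2))"
      using 1(2)[OF u h(2)] 2(2)[OF u h(3)]
      by (intro mult_left_mono add_mono order.trans[OF 1(2)[OF u h(2)]] order.trans[OF 2(2)[OF u h(3)]] I_mono) auto
    also have "\<dots> = ennreal (2 powr q * (C1 + C2)) * I g (max r1 r2)"
      using 1(1) 2(1) by (simp add: ennreal_mult ennreal_plus algebra_simps)
    finally show "D u h \<rho> \<le> ennreal (2 powr q * (C1 + C2)) * I g (max r1 r2)" .
  qed
  then show "\<exists>C\<ge>0. \<exists>\<rho>'. \<forall>u g. horiz_C1 e u g \<longrightarrow> (\<forall>h\<in>{heis_mult e h1 h2 | h1 h2. h1 \<in> H1 \<and> h2 \<in> H2}.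
        (shift_energy e q \<rho> u h)
          \<le> ennreal C * (ball_energy q \<rho>' g))"
    using 1(1) 2(1) unfolding D_def I_def by (intro exI[of _ "2 powr q * (C1 + C2)"]) auto
qed

lemma heis_form_axis: "heis_form e (axis (Inl e) 1) (axis (Inr e) 1) = 1 / 2"
  by (simp add: heis_form_def axis_def)

text \<open>The vertical direction is not horizontal, but \<open>(0, \<alpha> \<beta>)\<close> is the commutator of steps of length \<open>\<alpha>\<close> and
  \<open>\<beta>\<close> in the two directions of the distinguished plane.\<close>

lemma controlled_vertical:
  assumes q: "q \<ge> 1"
  shows "controlled e q {(0, t) | t. \<bar>t\<bar> \<le> T}"
proof -
  let ?S = "\<lambda>i. {hstep i s | s. \<bar>s\<bar> \<le> sqrt T}"
  let ?P = "\<lambda>A B. {heis_mult e h1 h2 | h1 h2. h1 \<in> A \<and> h2 \<in> B}"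
  have "controlled e q (?P (?P (?S (Inl e)) (?S (Inr e))) (?P (?S (Inl e)) (?S (Inr e))))"
    by (intro controlled_mult controlled_step q)
  moreover have "{(0, t) | t. \<bar>t\<bar> \<le> T} \<subseteq> ?P (?P (?S (Inl e)) (?S (Inr e))) (?P (?S (Inl e)) (?S (Inr e)))"
  proof (rule subsetI)
    fix h :: "'a heis" assume "h \<in> {(0, t) | t. \<bar>t\<bar> \<le> T}"
    then obtain t where h: "h = (0, t)" and t: "\<bar>t\<bar> \<le> T" by auto
    \<comment> \<open>Both step lengths stay below \<open>sqrt T\<close>, uniformly in \<open>t\<close>.\<close>
    define \<alpha> where "\<alpha> = sqrt \<bar>t\<bar>"
    define \<beta> where "\<beta> = sgn t * sqrt \<bar>t\<bar>"
    have ab: "\<alpha> * \<beta> = t"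
      by (simp add: \<alpha>_def \<beta>_def mult.left_commute sgn_mult_abs)
    have b: "\<bar>\<alpha>\<bar> \<le> sqrt T" "\<bar>\<beta>\<bar> \<le> sqrt T"
      using t by (auto simp: \<alpha>_def \<beta>_def abs_mult abs_sgn_eq)
    have "(0, t) = heis_mult e (heis_mult e (hstep (Inl e) \<alpha>) (hstep (Inr e) \<beta>))
       (heis_mult e (hstep (Inl e) (- \<alpha>)) (hstep (Inr e) (- \<beta>)))"
      unfolding ab[symmetric]
      by (simp add: heis_mult_eq hstep_def heis_form_simps heis_form_axis heis_form_commute[of e "axis (Inr e) 1" "axis (Inl e) 1"])
    moreover have "hstep (Inl e) \<alpha> \<in> ?S (Inl e)" "hstep (Inl e) (- \<alpha>) \<in> ?S (Inl e)"
      "hstep (Inr e) \<beta> \<in> ?S (Inr e)" "hstep (Inr e) (- \<beta>) \<in> ?S (Inr e)"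
      using b by auto
    ultimately show "h \<in> ?P (?P (?S (Inl e)) (?S (Inr e))) (?P (?S (Inl e)) (?S (Inr e)))"
      unfolding h by blast
  qed
  ultimately show ?thesis by (rule controlled_subset)
qed

text \<open>Coordinates of \<open>x\<close> are added one at a time by a right step; each step shifts \<open>t\<close> by a bounded amount,
  which is why the induction is over all \<open>T\<close>.\<close>

lemma controlled_coords:
  assumes q: "q \<ge> 1" and "finite F"
  shows "controlled e q {(x, t) | x t. (\<forall>i. \<bar>x $ i\<bar> \<le> S) \<and> (\<forall>i. i \<notin> F \<longrightarrow> x $ i = 0) \<and> \<bar>t\<bar> \<le> T}"
  using assms(2)
proof (induction F arbitrary: T rule: finite_induct)
  case empty
  show ?case
    by (rule controlled_subset[OF controlled_vertical[OF q, of e T]]) (auto simp: vec_eq_iff)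
next
  case (insert i F)
  obtain K where K: "K > 0" "\<And>x y. norm (heis_form e x y) \<le> norm x * norm y * K"
    using heis_form.pos_bounded[of e] by blast
  define T' where "T' = T + real CARD('a + 'a) * S * \<bar>S\<bar> * K"
  let ?H = "{(x, t) | x t. (\<forall>i. \<bar>x $ i\<bar> \<le> S) \<and> (\<forall>i. i \<notin> F \<longrightarrow> x $ i = 0) \<and> \<bar>t\<bar> \<le> T'}"
  show ?case
  proof (rule controlled_subset[OF controlled_mult[OF insert.IH[of T'] controlled_step[OF q, of e i S] q]], clarify)
    fix x :: "real ^ ('a + 'a)" and t :: real
    assume x: "\<forall>i. \<bar>x $ i\<bar> \<le> S" "\<forall>j. j \<notin> insert i F \<longrightarrow> x $ j = 0" and t: "\<bar>t\<bar> \<le> T"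
    define y where "y = x - x $ i *\<^sub>R axis i 1"
    have y: "y $ j = (if j = i then 0 else x $ j)" for j
      by (simp add: y_def axis_def)
    have S: "S \<ge> 0" using x(1) abs_ge_zero order.trans by blast
    have "norm y \<le> (\<Sum>j\<in>UNIV. \<bar>y $ j\<bar>)" by (rule norm_le_l1_cart)
    also have "\<dots> \<le> (\<Sum>j\<in>(UNIV :: ('a + 'a) set). S)" using x(1) S by (intro sum_mono) (simp add: y)
    finally have ny: "norm y \<le> real CARD('a + 'a) * S" by simp
    have "\<bar>heis_form e y (x $ i *\<^sub>R axis i 1)\<bar> \<le> norm y * norm (x $ i *\<^sub>R axis i 1 :: real ^ ('a + 'a)) * K"
      using K(2)[of y "x $ i *\<^sub>R axis i 1"] by simp
    also have "\<dots> \<le> (real CARD('a + 'a) * S) * \<bar>S\<bar> * K"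
      using ny x(1) S K(1) by (intro mult_mono) (auto simp: order.trans[OF _ abs_ge_self])
    finally have "\<bar>t - heis_form e y (x $ i *\<^sub>R axis i 1)\<bar> \<le> T'"
      using t unfolding T'_def by linarith
    moreover have "\<forall>j. \<bar>y $ j\<bar> \<le> S" "\<forall>j. j \<notin> F \<longrightarrow> y $ j = 0"
      using x S by (auto simp: y)
    ultimately have "(y, t - heis_form e y (x $ i *\<^sub>R axis i 1)) \<in> ?H" by auto
    moreover have "(x, t) = heis_mult e (y, t - heis_form e y (x $ i *\<^sub>R axis i 1)) (hstep i (x $ i))"
      by (simp add: heis_mult_eq hstep_def y_def)
    ultimately show "\<exists>h1 h2. (x, t) = heis_mult e h1 h2 \<and> h1 \<in> ?H \<and> h2 \<in> {hstep i s | s. \<bar>s\<bar> \<le> S}"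
      using x(1) by blast
  qed
qed

lemma controlled_cball:
  assumes q: "q \<ge> 1"
  shows "controlled e q (cball 0 \<sigma>)"
proof (rule controlled_subset[OF controlled_coords[OF q, of UNIV e \<sigma> \<sigma>]])
  show "(cball 0 \<sigma> :: 'a heis set) \<subseteq> {(x, t) | x t. (\<forall>i. \<bar>x $ i\<bar> \<le> \<sigma>) \<and> (\<forall>i. i \<notin> UNIV \<longrightarrow> x $ i = 0) \<and> \<bar>t\<bar> \<le> \<sigma>}"
  proof (rule subsetI)
    fix h :: "'a heis" assume h: "h \<in> cball 0 \<sigma>"
    obtain x t where xt: "h = (x, t)" by (cases h)
    have "norm x \<le> \<sigma>" "\<bar>t\<bar> \<le> \<sigma>"
      using h norm_fst_le[of x t] norm_snd_le[of t x] by (auto simp: xt)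
    moreover have "\<bar>x $ i\<bar> \<le> \<sigma>" for i
      using \<open>norm x \<le> \<sigma>\<close> component_le_norm_cart[of x i] by simp
    ultimately show "h \<in> {(x, t) | x t. (\<forall>i. \<bar>x $ i\<bar> \<le> \<sigma>) \<and> (\<forall>i. i \<notin> UNIV \<longrightarrow> x $ i = 0) \<and> \<bar>t\<bar> \<le> \<sigma>}"
      unfolding xt by blast
  qed
qed simp

text \<open>Substituting \<open>p' = p \<circ> h\<close> turns the double integral into an integral over \<open>h\<close> of translation
  differences, where \<open>h\<close> ranges over a bounded set.\<close>

lemma local_poincare:
  fixes e :: "'n::finite"
  assumes q: "q \<ge> 1"
  shows "\<exists>C\<ge>0. \<exists>\<rho>'. \<forall>u g. horiz_C1 e u g \<longrightarrow>
    (ball_osc q \<rho> u)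
      \<le> ennreal C * (ball_energy q \<rho>' g)"
proof -
  obtain \<sigma> where \<sigma>: "\<And>p r. norm p \<le> \<rho> \<Longrightarrow> norm r \<le> \<rho> \<Longrightarrow> norm (heis_mult e p r) \<le> \<sigma>"
    using heis_mult_bounded[of \<rho> \<rho> e] by blast
  obtain C \<rho>' where C: "C \<ge> 0" and *: "\<And>u g h. horiz_C1 e u g \<Longrightarrow> h \<in> cball 0 \<sigma> \<Longrightarrow>
        (shift_energy e q \<rho> u h)
          \<le> ennreal C * (ball_energy q \<rho>' g)"
    using controlled_cball[OF q, of e \<sigma>] unfolding controlled_def by meson
  define V where "V = measure lborel (cball 0 \<sigma> :: 'n heis set)"
  have V: "emeasure lborel (cball 0 \<sigma> :: 'n heis set) = ennreal V"
    unfolding V_def using emeasure_compact_finite[OF compact_cball, of 0 \<sigma>]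
    by (intro emeasure_eq_ennreal_measure) (simp add: less_top)
  show ?thesis
  proof (rule exI[of _ "C * V"], intro conjI, goal_cases)
    case 2
    show ?case
  proof (rule exI[of _ \<rho>'], intro allI impI)
    fix u g assume u: "horiz_C1 e u g"
    note [measurable] = horiz_C1_measurable[OF u]
    let ?I = "ball_energy q \<rho>' g"
    have "(ball_osc q \<rho> u)
      = (\<integral>\<^sup>+p. (\<integral>\<^sup>+h. ennreal (\<bar>u p - u (heis_mult e p h)\<bar> powr q) * indicator (cball 0 \<rho>) p * indicator (cball 0 \<rho>) (heis_mult e p h) \<partial>lborel) \<partial>lborel)"
    proof (rule nn_integral_cong)
      fix p
      have "(\<lambda>p'. ennreal (\<bar>u p - u p'\<bar> powr q) * indicator (cball 0 \<rho>) p * indicator (cball 0 \<rho>) p')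
          \<in> borel_measurable borel"
        by measurable
      from nn_integral_heis_left[OF this, of e p]
      show "(\<integral>\<^sup>+p'. ennreal (\<bar>u p - u p'\<bar> powr q) * indicator (cball 0 \<rho>) p * indicator (cball 0 \<rho>) p' \<partial>lborel)
        = (\<integral>\<^sup>+h. ennreal (\<bar>u p - u (heis_mult e p h)\<bar> powr q) * indicator (cball 0 \<rho>) p * indicator (cball 0 \<rho>) (heis_mult e p h) \<partial>lborel)"
        by simp
    qed
    also have "\<dots> \<le> (\<integral>\<^sup>+p. (\<integral>\<^sup>+h. ennreal (\<bar>u (heis_mult e p h) - u p\<bar> powr q) * indicator (cball 0 \<rho>) p * indicator (cball 0 \<sigma>) h \<partial>lborel) \<partial>lborel)"
    proof (intro nn_integral_mono)
      fix p h
      have "norm h \<le> \<sigma>" if "norm p \<le> \<rho>" "norm (heis_mult e p h) \<le> \<rho>"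
        using \<sigma>[of "- p" "heis_mult e p h"] that by simp
      then show "ennreal (\<bar>u p - u (heis_mult e p h)\<bar> powr q) * indicator (cball 0 \<rho>) p * indicator (cball 0 \<rho>) (heis_mult e p h)
        \<le> ennreal (\<bar>u (heis_mult e p h) - u p\<bar> powr q) * indicator (cball 0 \<rho>) p * indicator (cball 0 \<sigma>) h"
        by (auto simp: indicator_def abs_minus_commute)
    qed
    also have "\<dots> = (\<integral>\<^sup>+h. (\<integral>\<^sup>+p. ennreal (\<bar>u (heis_mult e p h) - u p\<bar> powr q) * indicator (cball 0 \<rho>) p * indicator (cball 0 \<sigma>) h \<partial>lborel) \<partial>lborel)"
      by (rule lborel_pair.Fubini') measurable
    also have "\<dots> \<le> (\<integral>\<^sup>+(h :: 'n heis). (ennreal C * ?I) * indicator (cball 0 \<sigma>) h \<partial>lborel)"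
    proof (rule nn_integral_mono)
      fix h :: "'n heis"
      show "(\<integral>\<^sup>+p. ennreal (\<bar>u (heis_mult e p h) - u p\<bar> powr q) * indicator (cball 0 \<rho>) p * indicator (cball 0 \<sigma>) h \<partial>lborel)
        \<le> (ennreal C * ?I) * indicator (cball 0 \<sigma>) h"
        using *[OF u, of h] by (cases "h \<in> cball 0 \<sigma>") (auto simp: nn_integral_multc)
    qed
    also have "\<dots> = ennreal C * ?I * ennreal V"
      by (subst nn_integral_cmult_indicator) (simp_all add: V)
    also have "\<dots> = ennreal (C * V) * ?I"
      using C by (simp add: ennreal_mult V_def ac_simps)
    finally show "(ball_osc q \<rho> u)
      \<le> ennreal (C * V) * ?I" .
  qed
  qed (use C in \<open>simp add: V_def\<close>)
qed

section \<open>The norm in the variables a, s, t\<close>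

text \<open>The letters are those of the introduction: \<open>ha\<close>, \<open>hs\<close>, \<open>hB\<close>, \<open>hP\<close>, \<open>hr\<close> stand for \<open>a\<close>, \<open>s\<close>, \<open>B\<close>, \<open>P\<close>, \<open>r\<close>. A name
  with an additional \<open>d\<close> and an index argument \<open>i\<close> is the derivative along \<open>X\<^sub>i\<close>.\<close>

definition ha :: "'n::finite \<Rightarrow> 'n heis \<Rightarrow> real" where
  "ha e p = ((fst p $ Inl e)\<^sup>2 + (fst p $ Inr e)\<^sup>2) / 4"

definition hs :: "'n::finite \<Rightarrow> 'n heis \<Rightarrow> real" where
  "hs e p = (\<Sum>i\<in>UNIV - {Inl e, Inr e}. (fst p $ i)\<^sup>2) / 2"

definition hB :: "'n::finite \<Rightarrow> 'n heis \<Rightarrow> real" where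
  "hB e p = ha e p + hs e p"

definition hP :: "'n::finite \<Rightarrow> 'n heis \<Rightarrow> real" where
  "hP e p = (hB e p)\<^sup>2 + (snd p)\<^sup>2"

definition hr :: "'n::finite \<Rightarrow> 'n heis \<Rightarrow> real" where
  "hr e p = sqrt (hP e p)"

lemma ha_nonneg [simp]: "0 \<le> ha e p" and hs_nonneg [simp]: "0 \<le> hs e p"
  by (simp_all add: ha_def hs_def sum_nonneg)

lemma hB_nonneg [simp]: "0 \<le> hB e p"
  by (simp add: hB_def)

lemma hP_nonneg [simp]: "0 \<le> hP e p"
  by (simp add: hP_def)

lemma hr_nonneg [simp]: "0 \<le> hr e p"
  by (simp add: hr_def)

lemma hr_pos_iff [simp]: "0 < hr e p \<longleftrightarrow> 0 < hP e p"
  by (simp add: hr_def)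

lemma hr_squared [simp]: "(hr e p)\<^sup>2 = hP e p"
  by (simp add: hr_def)

lemma hB_le_hr: "hB e p \<le> hr e p"
  by (rule power2_le_imp_le) (simp_all add: hP_def)

lemma B_fun_eq: "B_fun e (fst p) = hB e p"
  by (simp add: B_fun_def hB_def ha_def hs_def)

lemma A_fun_eq: "A_fun e (fst p) = hB e p + ha e p"
  by (simp add: A_fun_def hB_def ha_def hs_def field_simps)

lemma norm_fst_le_hB: "(norm (fst p))\<^sup>2 \<le> 4 * hB e p"
proof -
  have "(norm (fst p))\<^sup>2 = (\<Sum>i\<in>UNIV. (fst p $ i)\<^sup>2)"
    by (simp add: norm_vec_def L2_set_def sum_nonneg)
  also have "\<dots> = (\<Sum>i\<in>{Inl e, Inr e}. (fst p $ i)\<^sup>2) + (\<Sum>i\<in>UNIV - {Inl e, Inr e}. (fst p $ i)\<^sup>2)"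
    by (subst sum.subset_diff[of "{Inl e, Inr e}"]) simp_all
  also have "\<dots> = 4 * ha e p + 2 * hs e p"
    by (simp add: ha_def hs_def)
  finally show ?thesis using hs_nonneg[of e p] by (simp add: hB_def)
qed

lemma hP_eq_0_iff [simp]: "hP e p = 0 \<longleftrightarrow> p = 0"
proof
  assume "hP e p = 0"
  then have "hB e p = 0" "snd p = 0" by (auto simp: hP_def add_nonneg_eq_0_iff)
  then show "p = 0" using norm_fst_le_hB[of p e] by (simp add: prod_eq_iff)
qed (simp add: hP_def hB_def ha_def hs_def)

lemma hP_pos_iff: "0 < hP e p \<longleftrightarrow> p \<noteq> 0"
  by (metis hP_eq_0_iff hP_nonneg less_eq_real_def less_irrefl)

text \<open>Sublevel sets of the polynomial \<open>P\<close> are bounded. The constants are crude: \<open>z \<le> (z\<^sup>2 + 1) / 2\<close>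
  removes the square root.\<close>

lemma norm_le_of_hP: "hP e p \<le> R \<Longrightarrow> norm p \<le> 2 * R + 2"
proof -
  assume P: "hP e p \<le> R"
  have R: "0 \<le> R" using P hP_nonneg order.trans by blast
  have B: "(hB e p)\<^sup>2 \<le> R" "(snd p)\<^sup>2 \<le> R"
    using P by (auto simp: hP_def intro: order.trans[rotated])
  have aux: "z \<le> (R + 1) / 2" if "z\<^sup>2 \<le> R" for z :: real
    using that sum_squares_bound[of z 1] by simp
  have "(norm p)\<^sup>2 = (norm (fst p))\<^sup>2 + (snd p)\<^sup>2"
    by (cases p) (simp add: norm_Pair)
  also have "\<dots> \<le> 4 * ((R + 1) / 2) + R"
    using norm_fst_le_hB[of p e] aux[OF B(1)] B(2) by linarith
  also have "\<dots> \<le> (2 * R + 2)\<^sup>2"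
    using R by (simp add: power2_eq_square algebra_simps)
  finally show ?thesis by (rule power2_le_imp_le) (use R in simp)
qed

lemma continuous_ha [continuous_intros]: "continuous_on S f \<Longrightarrow> continuous_on S (\<lambda>z. ha e (f z))"
  unfolding ha_def by (intro continuous_intros) auto

lemma continuous_hs [continuous_intros]: "continuous_on S f \<Longrightarrow> continuous_on S (\<lambda>z. hs e (f z))"
  unfolding hs_def by (intro continuous_intros) auto

lemma continuous_hB [continuous_intros]: "continuous_on S f \<Longrightarrow> continuous_on S (\<lambda>z. hB e (f z))"
  unfolding hB_def by (intro continuous_intros)

lemma continuous_hP [continuous_intros]: "continuous_on S f \<Longrightarrow> continuous_on S (\<lambda>z. hP e (f z))"
  unfolding hP_def by (intro continuous_intros)

lemma continuous_hr [continuous_intros]: "continuous_on S f \<Longrightarrow> continuous_on S (\<lambda>z. hr e (f z))"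
  unfolding hr_def by (intro continuous_intros)

lemma borel_hP [measurable]: "hP e \<in> borel_measurable borel"
  using continuous_hP[OF continuous_on_id] by (intro borel_measurable_continuous_onI) simp

text \<open>\<open>X\<^sub>i t\<close> is a multiple of the \<open>i\<close>-th component of the rotated vector \<open>J x\<close>, with factor one half in the
  distinguished plane (\<open>hdt\<close>).\<close>

definition hJ :: "'n heis \<Rightarrow> 'n::finite + 'n \<Rightarrow> real" where
  "hJ p i = (case i of Inl j \<Rightarrow> - (fst p $ Inr j) | Inr j \<Rightarrow> fst p $ Inl j)"

definition hda :: "'n::finite \<Rightarrow> 'n heis \<Rightarrow> 'n + 'n \<Rightarrow> real" where
  "hda e p i = (if i \<in> {Inl e, Inr e} then fst p $ i / 2 else 0)"

definition hds :: "'n::finite \<Rightarrow> 'n heis \<Rightarrow> 'n + 'n \<Rightarrow> real" where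
  "hds e p i = (if i \<in> {Inl e, Inr e} then 0 else fst p $ i)"

definition hdt :: "'n::finite \<Rightarrow> 'n heis \<Rightarrow> 'n + 'n \<Rightarrow> real" where
  "hdt e p i = (if i \<in> {Inl e, Inr e} then hJ p i / 2 else hJ p i)"

lemma continuous_hJ [continuous_intros]: "continuous_on S (\<lambda>p. hJ p i)"
  unfolding hJ_def by (cases i) (auto intro!: continuous_intros)

lemma continuous_hda [continuous_intros]: "continuous_on S (\<lambda>p. hda e p i)"
  unfolding hda_def by (cases "i \<in> {Inl e, Inr e}") (auto intro!: continuous_intros)

lemma continuous_hds [continuous_intros]: "continuous_on S (\<lambda>p. hds e p i)"
  unfolding hds_def by (cases "i \<in> {Inl e, Inr e}") (auto intro!: continuous_intros)

lemma continuous_hdt [continuous_intros]: "continuous_on S (\<lambda>p. hdt e p i)"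
  unfolding hdt_def by (cases "i \<in> {Inl e, Inr e}") (auto intro!: continuous_intros)

lemma heis_form_axis_right: "heis_form e (fst p) (axis i 1) = hdt e p i"
proof (cases i)
  case (Inl j)
  then show ?thesis
    using heis_mult_axis(1)[of e "fst p" 0 1 j] by (auto simp: heis_mult_eq hdt_def hJ_def)
next
  case (Inr j)
  then show ?thesis
    using heis_mult_axis(2)[of e "fst p" 0 1 j] by (auto simp: heis_mult_eq hdt_def hJ_def)
qed

lemma heis_mult_hstep_eq:
  "heis_mult e p (hstep i s) = (fst p + s *\<^sub>R axis i 1, snd p + s * hdt e p i)"
  by (simp add: heis_mult_eq hstep_def heis_form_simps heis_form_axis_right)

lemma hderiv_coord: "((\<lambda>s. fst (heis_mult e p (hstep i s)) $ j) has_real_derivative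
    (if i = j then 1 else 0)) (at 0)"
  unfolding heis_mult_hstep_eq by (auto intro!: derivative_eq_intros simp: axis_def)

lemma hderiv_J: "((\<lambda>s. hJ (heis_mult e p (hstep i s)) i) has_real_derivative 0) (at 0)"
  unfolding heis_mult_hstep_eq hJ_def
  by (cases i) (auto intro!: derivative_eq_intros simp: axis_def)

lemma hderiv_t: "((\<lambda>s. snd (heis_mult e p (hstep i s))) has_real_derivative hdt e p i) (at 0)"
  unfolding heis_mult_hstep_eq by (auto intro!: derivative_eq_intros)

lemma hderiv_a: "((\<lambda>s. ha e (heis_mult e p (hstep i s))) has_real_derivative hda e p i) (at 0)"
  unfolding ha_def hda_def
  by (auto intro!: derivative_eq_intros hderiv_coord)

lemma hderiv_s: "((\<lambda>s. hs e (heis_mult e p (hstep i s))) has_real_derivative hds e p i) (at 0)"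
proof -
  have "((\<lambda>s. hs e (heis_mult e p (hstep i s))) has_real_derivative
    (\<Sum>j\<in>UNIV - {Inl e, Inr e}. 2 * (fst p $ j) * (if i = j then 1 else 0)) / 2) (at 0)"
    unfolding hs_def
    by (auto intro!: derivative_eq_intros hderiv_coord sum.cong)
  also have "(\<Sum>j\<in>UNIV - {Inl e, Inr e}. 2 * (fst p $ j) * (if i = j then 1 else 0)) / 2 = hds e p i"
    by (simp add: hds_def if_distrib sum.delta cong: if_cong)
  finally show ?thesis .
qed

lemma hderiv_B: "((\<lambda>s. hB e (heis_mult e p (hstep i s))) has_real_derivative hda e p i + hds e p i) (at 0)"
  unfolding hB_def by (intro derivative_intros hderiv_a hderiv_s)

definition hdP :: "'n::finite \<Rightarrow> 'n heis \<Rightarrow> 'n + 'n \<Rightarrow> real" where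
  "hdP e p i = 2 * hB e p * hda e p i + 2 * hB e p * hds e p i + 2 * snd p * hdt e p i"

lemma hderiv_P: "((\<lambda>s. hP e (heis_mult e p (hstep i s))) has_real_derivative hdP e p i) (at 0)"
  unfolding hP_def hdP_def
  by (auto intro!: derivative_eq_intros hderiv_B hderiv_t simp: algebra_simps)

lemma hderiv_r:
  assumes "0 < hP e p"
  shows "((\<lambda>s. hr e (heis_mult e p (hstep i s))) has_real_derivative
    (hB e p / hr e p) * hda e p i + (hB e p / hr e p) * hds e p i + (snd p / hr e p) * hdt e p i) (at 0)"
proof -
  have r: "hr e p > 0" using assms by simp
  have "((\<lambda>s. hr e (heis_mult e p (hstep i s))) has_real_derivative
      inverse (sqrt (hP e (heis_mult e p (hstep i 0)))) / 2 * hdP e p i) (at 0)"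
    unfolding hr_def
    by (rule DERIV_chain2[OF DERIV_real_sqrt hderiv_P]) (use assms in simp)
  moreover have "inverse (hr e p) / 2 * hdP e p i =
     (hB e p / hr e p) * hda e p i + (hB e p / hr e p) * hds e p i + (snd p / hr e p) * hdt e p i"
    using r by (simp add: hdP_def field_simps del: hr_pos_iff)
  ultimately show ?thesis by (simp only: hr_def[symmetric] heis_mult_0 hstep_0)
qed

text \<open>\<open>L = 4 n log N\<close> off the origin (see \<open>heis_norm_eq\<close>). It is a function of \<open>a\<close>, \<open>s\<close>, \<open>t\<close> alone, whose partial
  derivatives are \<open>hLa\<close>, \<open>hLs\<close>, \<open>hLt\<close>.\<close>

definition hL :: "'n::finite \<Rightarrow> 'n heis \<Rightarrow> real" where
  "hL e p = 2 * ln (hr e p) - ln (hr e p + hB e p) + (2 * real CARD('n) - 1) * ln (hr e p + ha e p)"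

definition hLa :: "'n::finite \<Rightarrow> 'n heis \<Rightarrow> real" where
  "hLa e p = 2 * (hB e p / hr e p) / hr e p - (hB e p / hr e p + 1) / (hr e p + hB e p)
     + (2 * real CARD('n) - 1) * ((hB e p / hr e p + 1) / (hr e p + ha e p))"

definition hLs :: "'n::finite \<Rightarrow> 'n heis \<Rightarrow> real" where
  "hLs e p = 2 * (hB e p / hr e p) / hr e p - (hB e p / hr e p + 1) / (hr e p + hB e p)
     + (2 * real CARD('n) - 1) * ((hB e p / hr e p) / (hr e p + ha e p))"

definition hLt :: "'n::finite \<Rightarrow> 'n heis \<Rightarrow> real" where
  "hLt e p = 2 * (snd p / hr e p) / hr e p - (snd p / hr e p) / (hr e p + hB e p)
     + (2 * real CARD('n) - 1) * ((snd p / hr e p) / (hr e p + ha e p))"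

definition hdL :: "'n::finite \<Rightarrow> 'n heis \<Rightarrow> 'n + 'n \<Rightarrow> real" where
  "hdL e p i = hLa e p * hda e p i + hLs e p * hds e p i + hLt e p * hdt e p i"

lemma DERIV_ln_at_0:
  "(f has_real_derivative d) (at 0) \<Longrightarrow> 0 < f 0 \<Longrightarrow> ((\<lambda>s. ln (f s)) has_real_derivative d / f 0) (at 0)"
  using DERIV_chain2[where f = ln, OF DERIV_ln_divide] by fastforce

lemma hderiv_L:
  assumes "0 < hP e p"
  shows "((\<lambda>s. hL e (heis_mult e p (hstep i s))) has_real_derivative hdL e p i) (at 0)"
proof -
  have r: "hr e p > 0" "hr e p + hB e p > 0" "hr e p + ha e p > 0"
    using assms by (auto intro!: add_pos_nonneg)
  let ?c = "\<lambda>s. heis_mult e p (hstep i s)"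
  let ?r' = "(hB e p / hr e p) * hda e p i + (hB e p / hr e p) * hds e p i + (snd p / hr e p) * hdt e p i"
  have D1: "((\<lambda>s. ln (hr e (?c s))) has_real_derivative ?r' / hr e p) (at 0)"
    using DERIV_ln_at_0[OF hderiv_r[OF assms]] r by simp
  have D2: "((\<lambda>s. ln (hr e (?c s) + hB e (?c s))) has_real_derivative
      (?r' + (hda e p i + hds e p i)) / (hr e p + hB e p)) (at 0)"
    using DERIV_ln_at_0[OF DERIV_add[OF hderiv_r[OF assms] hderiv_B]] r by simp
  have D3: "((\<lambda>s. ln (hr e (?c s) + ha e (?c s))) has_real_derivative
      (?r' + hda e p i) / (hr e p + ha e p)) (at 0)"
    using DERIV_ln_at_0[OF DERIV_add[OF hderiv_r[OF assms] hderiv_a]] r by simp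
  show ?thesis
    unfolding hL_def
    by (rule DERIV_cong[OF DERIV_add[OF DERIV_diff[OF DERIV_cmult[OF D1] D2] DERIV_cmult[OF D3]]])
       (simp add: hdL_def hLa_def hLs_def hLt_def divide_inverse algebra_simps)
qed

lemma sum_planes:
  "(\<Sum>i\<in>UNIV. f i) = f (Inl e) + f (Inr e) + (\<Sum>i\<in>UNIV - {Inl e, Inr e}. f i)"
  for f :: "'n::finite + 'n \<Rightarrow> real"
  by (subst sum.subset_diff[of "{Inl e, Inr e}"]) simp_all

lemma sum_UNIV_sum: "(\<Sum>i\<in>UNIV. f i) = (\<Sum>j\<in>UNIV. f (Inl j)) + (\<Sum>j\<in>UNIV. (f (Inr j) :: real))"
  for f :: "'n::finite + 'n \<Rightarrow> real"
  by (simp only: UNIV_Plus_UNIV[symmetric] sum.Plus finite o_def)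

lemma sum_rest_xJ: "(\<Sum>i\<in>UNIV - {Inl e, Inr e}. fst p $ i * hJ p i) = 0"
proof -
  have "(\<Sum>i\<in>UNIV. fst p $ i * hJ p i) = 0"
    unfolding sum_UNIV_sum by (simp add: hJ_def flip: sum.distrib)
  then show ?thesis unfolding sum_planes[of _ e] by (simp add: hJ_def)
qed

lemma sum_rest_JJ: "(\<Sum>i\<in>UNIV - {Inl e, Inr e}. (hJ p i)\<^sup>2) = 2 * hs e p"
proof -
  have "(\<Sum>i\<in>UNIV. (hJ p i)\<^sup>2) = (\<Sum>i\<in>UNIV. (fst p $ i)\<^sup>2)"
    unfolding sum_UNIV_sum by (simp add: hJ_def)
  then show ?thesis unfolding sum_planes[of _ e] by (simp add: hJ_def hs_def)
qed

lemma sum_rest_xx: "(\<Sum>i\<in>UNIV - {Inl e, Inr e}. (fst p $ i)\<^sup>2) = 2 * hs e p"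
  by (simp add: hs_def)

text \<open>Outside the distinguished plane only the diagonal terms survive, since \<open>x\<close> and \<open>J x\<close> are orthogonal
  in each plane. All sums over coordinates below are brought to this form.\<close>

lemma sum_rest_quadratic:
  "(\<Sum>i\<in>UNIV - {Inl e, Inr e}. c1 * (fst p $ i)\<^sup>2 + c2 * (fst p $ i * hJ p i) + c3 * (hJ p i)\<^sup>2)
    = 2 * hs e p * (c1 + c3)"
  by (simp add: sum.distrib sum_rest_xJ sum_rest_JJ sum_rest_xx flip: sum_distrib_left)
     (simp add: algebra_simps)

section \<open>The polynomial horizontal field\<close>

text \<open>The components of the field \<open>Y\<close>. Near the \<open>t\<close>-axis, where \<open>t\<^sup>2\<close> dominates, \<open>Y\<close> points inwards in the
  distinguished plane and outwards in the other coordinates, as the behaviour of \<open>N\<close> there requires; the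
  sign change at \<open>t\<^sup>2 = B\<^sup>2\<close> and the rotational term take care of the region where \<open>N\<close> increases
  with \<open>s\<close>.\<close>

definition hY :: "'n::finite \<Rightarrow> 'n heis \<Rightarrow> 'n + 'n \<Rightarrow> real" where
  "hY e p i = fst p $ i * (if i \<in> {Inl e, Inr e} then - ((snd p)\<^sup>2 + (hB e p)\<^sup>2) else (snd p)\<^sup>2 - (hB e p)\<^sup>2)
     - 2 * hs e p * snd p * hJ p i"

text \<open>On a function of \<open>(a, s, t)\<close> with partial derivatives \<open>ca\<close>, \<open>cs\<close>, \<open>ct\<close>, the fields \<open>E\<^sub>a\<close>, \<open>E\<^sub>s\<close>, \<open>T\<close> act as
  \<open>2 a \<partial>\<^sub>a\<close>, \<open>2 s \<partial>\<^sub>s\<close>, \<open>2 B \<partial>\<^sub>t\<close>.\<close>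

lemma hY_deriv_sum:
  "(\<Sum>i\<in>UNIV. hY e p i * (ca * hda e p i + cs * hds e p i + ct * hdt e p i))
    = - 2 * ha e p * hP e p * ca + 2 * hs e p * ((snd p)\<^sup>2 - (hB e p)\<^sup>2) * cs
      - 4 * hs e p * snd p * hB e p * ct"
proof -
  let ?t = "snd p" and ?s = "hs e p"
  define w where "w = ?t\<^sup>2 - (hB e p)\<^sup>2"
  have Y: "hY e p i = w * fst p $ i - 2 * ?s * ?t * hJ p i" if "i \<in> UNIV - {Inl e, Inr e}" for i
    using that by (simp add: hY_def w_def)
  have "(\<Sum>i\<in>UNIV - {Inl e, Inr e}. hY e p i * (ca * hda e p i + cs * hds e p i + ct * hdt e p i))
    = (\<Sum>i\<in>UNIV - {Inl e, Inr e}. (w * cs) * (fst p $ i)\<^sup>2 + (w * ct - 2 * ?s * ?t * cs) * (fst p $ i * hJ p i)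
         + (- 2 * ?s * ?t * ct) * (hJ p i)\<^sup>2)"
    by (intro sum.cong)
       (auto simp: Y hda_def hds_def hdt_def power2_eq_square algebra_simps)
  then show ?thesis
    unfolding sum_planes[of _ e] sum_rest_quadratic
    by (simp add: hY_def hda_def hds_def hdt_def hJ_def w_def[symmetric])
       (simp add: hP_def hB_def ha_def field_simps power2_eq_square)
qed

lemma hY_norm: "(\<Sum>i\<in>UNIV. (hY e p i)\<^sup>2) \<le> 8 * (hP e p)\<^sup>2 * hB e p"
proof -
  let ?t = "snd p" and ?s = "hs e p"
  define w where "w = ?t\<^sup>2 - (hB e p)\<^sup>2"
  define b where "b = 2 * ?s * ?t"
  have Y: "hY e p i = w * fst p $ i - b * hJ p i" if "i \<in> UNIV - {Inl e, Inr e}" for i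
    using that by (simp add: hY_def w_def b_def)
  have "(\<Sum>i\<in>UNIV - {Inl e, Inr e}. (hY e p i)\<^sup>2)
    = (\<Sum>i\<in>UNIV - {Inl e, Inr e}. w\<^sup>2 * (fst p $ i)\<^sup>2 + (- 2 * w * b) * (fst p $ i * hJ p i) + b\<^sup>2 * (hJ p i)\<^sup>2)"
    by (intro sum.cong)
       (auto simp: Y power2_eq_square algebra_simps)
  then have eq: "(\<Sum>i\<in>UNIV. (hY e p i)\<^sup>2) = 4 * ha e p * ((hP e p)\<^sup>2 + b\<^sup>2) + 2 * ?s * (w\<^sup>2 + b\<^sup>2)"
    unfolding sum_planes[of _ e] sum_rest_quadratic
    by (simp add: hY_def hJ_def b_def[symmetric])
       (simp add: hP_def ha_def field_simps power2_eq_square)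
  have w: "w\<^sup>2 \<le> (hP e p)\<^sup>2"
    unfolding w_def hP_def using zero_le_mult_iff[of "?t\<^sup>2" "(hB e p)\<^sup>2"]
    by (simp add: power2_diff power2_sum mult.commute)
  have "?s\<^sup>2 \<le> (hB e p)\<^sup>2" by (rule power_mono) (simp_all add: hB_def)
  then have "b\<^sup>2 \<le> 4 * ((hB e p)\<^sup>2 * ?t\<^sup>2)"
    by (simp add: b_def power_mult_distrib mult_right_mono)
  also have "\<dots> \<le> (hP e p)\<^sup>2"
    using sum_squares_bound[of "(hB e p)\<^sup>2" "?t\<^sup>2"] by (simp add: hP_def power2_sum algebra_simps)
  finally have b: "b\<^sup>2 \<le> (hP e p)\<^sup>2" .
  have "4 * ha e p * ((hP e p)\<^sup>2 + b\<^sup>2) + 2 * ?s * (w\<^sup>2 + b\<^sup>2)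
    \<le> 4 * ha e p * (2 * (hP e p)\<^sup>2) + 4 * ?s * (2 * (hP e p)\<^sup>2)"
    using w b by (intro add_mono mult_mono) auto
  then show ?thesis unfolding eq by (simp add: hB_def algebra_simps)
qed

text \<open>\<open>X\<^sub>i\<close> applied to the \<open>i\<close>-th component of \<open>Y\<close>; the sum over \<open>i\<close> is the divergence.\<close>

definition hdY :: "'n::finite \<Rightarrow> 'n heis \<Rightarrow> 'n + 'n \<Rightarrow> real" where
  "hdY e p i =
     (if i \<in> {Inl e, Inr e}
      then - ((snd p)\<^sup>2 + (hB e p)\<^sup>2) - fst p $ i * (2 * snd p * hdt e p i + 2 * hB e p * (hda e p i + hds e p i))
      else (snd p)\<^sup>2 - (hB e p)\<^sup>2 + fst p $ i * (2 * snd p * hdt e p i - 2 * hB e p * (hda e p i + hds e p i)))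
     - 2 * (hds e p i * snd p + hs e p * hdt e p i) * hJ p i"

lemma hderiv_Y: "has_hderiv e i (\<lambda>p. hY e p i) (\<lambda>p. hdY e p i)"
  unfolding has_hderiv_def hY_def hdY_def
  by (auto intro!: derivative_eq_intros hderiv_coord hderiv_t hderiv_B hderiv_s hderiv_J
      simp: algebra_simps)

lemma continuous_hY [continuous_intros]: "continuous_on S (\<lambda>p. hY e p i)"
  unfolding hY_def by (cases "i \<in> {Inl e, Inr e}") (auto intro!: continuous_intros)

lemma continuous_hdY [continuous_intros]: "continuous_on S (\<lambda>p. hdY e p i)"
  unfolding hdY_def by (cases "i \<in> {Inl e, Inr e}") (auto intro!: continuous_intros)

lemma card_rest: "real (card (UNIV - {Inl e, Inr e :: 'n::finite + 'n})) = 2 * real CARD('n) - 2"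
proof -
  have "real CARD('n + 'n) = 1 + 1 + real (card (UNIV - {Inl e, Inr e :: 'n + 'n}))"
    using sum_planes[of "\<lambda>_. 1" e] by (simp only: sum_constant mult_1_right)
  moreover have "real CARD('n + 'n) = real CARD('n) + real CARD('n)"
    using sum_UNIV_sum[of "\<lambda>_ :: 'n + 'n. 1"] by (simp only: sum_constant mult_1_right)
  ultimately show ?thesis by linarith
qed

lemma hY_div:
  fixes e :: "'n::finite"
  shows "(\<Sum>i\<in>UNIV. hdY e p i)
    = (2 * real CARD('n) - 4) * (snd p)\<^sup>2 - (2 * real CARD('n) + 4) * (hB e p)\<^sup>2 - 4 * hs e p * hB e p"
proof -
  let ?t = "snd p" and ?s = "hs e p" and ?B = "hB e p"
  have "(\<Sum>i\<in>UNIV - {Inl e, Inr e}. hdY e p i)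
    = (\<Sum>i\<in>UNIV - {Inl e, Inr e}. (?t\<^sup>2 - ?B\<^sup>2) + ((- 2 * ?B) * (fst p $ i)\<^sup>2 + 0 * (fst p $ i * hJ p i)
         + (- 2 * ?s) * (hJ p i)\<^sup>2))"
    by (intro sum.cong) (auto simp: hdY_def hda_def hds_def hdt_def power2_eq_square algebra_simps)
  also have "\<dots> = (2 * real CARD('n) - 2) * (?t\<^sup>2 - ?B\<^sup>2) + 2 * ?s * (- 2 * ?B - 2 * ?s)"
    by (subst sum.distrib, subst sum_rest_quadratic, simp only: sum_constant card_rest, simp)
  finally show ?thesis
    unfolding sum_planes[of _ e]
    by (simp add: hdY_def hda_def hds_def hdt_def hJ_def)
       (simp add: hB_def ha_def field_simps power2_eq_square)
qed

text \<open>\<open>Y\<close> decreases \<open>P\<close>, so a cutoff that decreases with \<open>P\<close> increases along \<open>Y\<close>.\<close>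

lemma hY_P: "(\<Sum>i\<in>UNIV. hY e p i * hdP e p i) = - 4 * (hB e p)\<^sup>2 * hP e p"
  unfolding hdP_def hY_deriv_sum
  by (simp add: hP_def hB_def power2_eq_square algebra_simps)

text \<open>With \<open>G = (2 n - 1) / (r + a)\<close> the terms without \<open>G\<close> in \<open>- 2 (t\<^sup>2 - B\<^sup>2) L\<^sub>s + 4 t B L\<^sub>t\<close> add up to exactly \<open>2 r\<close>, and
  those with \<open>G\<close> are nonnegative; this cancellation is the reason for the coefficients of \<open>Y\<close>. In the
  distinguished plane \<open>L\<^sub>a \<ge> 2 / r\<close>, so that moving inwards is always profitable.\<close>

lemma hY_L:
  fixes e :: "'n::finite"
  assumes P: "0 < hP e p" and n: "CARD('n) \<ge> 2"
  shows "(\<Sum>i\<in>UNIV. hY e p i * hdL e p i) \<le> - 2 * hr e p * hB e p"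
proof -
  define a s B r t n where "a = ha e p" "s = hs e p" "B = hB e p" "r = hr e p" "t = snd p" "n = real CARD('n)"
  note d = this
  have r: "r > 0" and a: "a \<ge> 0" and s: "s \<ge> 0" and B: "B = a + s" and n2: "n \<ge> 2"
    using P n by (auto simp: d hB_def)
  have rr: "r\<^sup>2 = B\<^sup>2 + t\<^sup>2" and P: "hP e p = r\<^sup>2"
    by (auto simp: d hP_def hr_def)
  have B0: "B \<ge> 0" using B a s by simp
  define G where "G = (2 * n - 1) / (r + a)"
  have G: "G \<ge> 0" using n2 r a by (simp add: G_def)
  have b: "(B / r + 1) / (r + B) = 1 / r"
  proof -
    have "B / r + 1 = (r + B) / r" using r by (simp add: field_simps)
    then show ?thesis using r B0 by simp
  qed
  have La: "hLa e p = 2 * B / r\<^sup>2 - 1 / r + G * (B / r + 1)"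
    unfolding hLa_def d[symmetric] b by (simp add: G_def power2_eq_square field_simps)
  have Ls: "hLs e p = 2 * B / r\<^sup>2 - 1 / r + G * (B / r)"
    unfolding hLs_def d[symmetric] b by (simp add: G_def power2_eq_square)
  have "t * (t / r / (r + B)) = t\<^sup>2 / (r + B) / r" by (simp add: power2_eq_square)
  also have "t\<^sup>2 = (r - B) * (r + B)" using rr by (simp add: power2_eq_square algebra_simps)
  also have "(r - B) * (r + B) / (r + B) / r = (r - B) / r" using r B0 by simp
  finally have b': "t * (t / r / (r + B)) = (r - B) / r" .
  have "t * hLt e p = 2 * t\<^sup>2 / r\<^sup>2 - t * (t / r / (r + B)) + G * (t\<^sup>2 / r)"
    unfolding hLt_def d[symmetric]
    by (simp add: G_def power2_eq_square divide_inverse ring_distribs mult_ac)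
  then have Lt: "t * hLt e p = 2 * t\<^sup>2 / r\<^sup>2 - (r - B) / r + G * (t\<^sup>2 / r)"
    unfolding b' .
  have "(2 * n - 1) * (r + a) \<le> (2 * n - 1) * (r + B)"
    using n2 B s by (intro mult_left_mono) auto
  then have "(2 * n - 1) * (r + a) / ((r + a) * r) \<le> (2 * n - 1) * (r + B) / ((r + a) * r)"
    using r a by (intro divide_right_mono) auto
  also have "(2 * n - 1) * (r + a) / ((r + a) * r) = (2 * n - 1) / r"
    using r a by simp
  also have "(2 * n - 1) * (r + B) / ((r + a) * r) = G * ((r + B) / r)"
    by (simp add: G_def)
  also have "(r + B) / r = B / r + 1" using r by (simp add: field_simps)
  finally have "(2 * n - 1) / r \<le> G * (B / r + 1)" .
  moreover have "(2 * n - 1) / r \<ge> 3 / r" using n2 r by (intro divide_right_mono) auto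
  moreover have "2 * B / r\<^sup>2 \<ge> 0" using B0 by simp
  ultimately have La2: "hLa e p \<ge> 2 / r" unfolding La by (simp add: field_simps)
  have "2 * a * r\<^sup>2 * (2 / r) \<le> 2 * a * r\<^sup>2 * hLa e p"
    using La2 a by (intro mult_left_mono) auto
  then have 1: "4 * a * r \<le> 2 * a * r\<^sup>2 * hLa e p"
    using r by (simp add: power2_eq_square)
  have t2: "t\<^sup>2 = r\<^sup>2 - B\<^sup>2" using rr by simp
  \<comment> \<open>The cancellation that determines the coefficients of the field.\<close>
  have "- 2 * (t\<^sup>2 - B\<^sup>2) * hLs e p + 4 * B * (t * hLt e p) = 2 * r + G * (2 * B * r)"
    unfolding Ls Lt t2 using r by (simp add: field_simps) (simp add: eval_nat_numeral algebra_simps)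
  also have "\<dots> \<ge> 2 * r" using G B0 r by simp
  finally have "s * (2 * r) \<le> s * (- 2 * (t\<^sup>2 - B\<^sup>2) * hLs e p + 4 * B * (t * hLt e p))"
    using s by (rule mult_left_mono)
  with 1 have "4 * a * r + 2 * s * r \<le> 2 * a * r\<^sup>2 * hLa e p - 2 * s * (t\<^sup>2 - B\<^sup>2) * hLs e p + 4 * s * t * B * hLt e p"
    by (simp add: algebra_simps)
  moreover have "2 * r * B \<le> 4 * a * r + 2 * s * r" using a r by (simp add: B algebra_simps)
  ultimately show ?thesis
    unfolding hdL_def hY_deriv_sum P d[symmetric] by simp
qed

text \<open>The middle factor of the norm splits: \<open>A B + t\<^sup>2 + A r = (r + B) (r + a)\<close>, because \<open>A = B + a\<close> and
  \<open>r\<^sup>2 = B\<^sup>2 + t\<^sup>2\<close>.\<close>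

lemma heis_norm_eq:
  fixes e :: "'n::finite"
  assumes "p \<noteq> 0"
  shows "heis_norm e p = exp (hL e p / (4 * real CARD('n)))"
proof -
  have P: "0 < hP e p" using assms by (simp add: hP_pos_iff)
  have r: "hr e p > 0" "hr e p + hB e p > 0" "hr e p + ha e p > 0"
    using P by (auto intro!: add_pos_nonneg)
  define n where "n = real CARD('n)"
  have n: "n > 0" by (simp add: n_def)
  have sq: "hB e p * hB e p + snd p * snd p = hr e p * hr e p"
    using hr_squared[of e p] by (simp add: hP_def power2_eq_square)
  have sr: "(hB e p)\<^sup>2 + (snd p)\<^sup>2 = hP e p" by (simp add: hP_def)
  have f: "(hB e p + ha e p) * hB e p + (snd p)\<^sup>2 + (hB e p + ha e p) * hr e p
      = (hr e p + hB e p) * (hr e p + ha e p)"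
    using sq by (simp add: power2_eq_square algebra_simps)
  have "heis_norm e p = (hP e p) powr (1 / (4 * n)) * ((hr e p + hB e p) * (hr e p + ha e p)) powr (1/2 - 1/(4*n))
      / (hB e p + hr e p) powr (1/2)"
    using assms
    unfolding heis_norm_def split_beta B_fun_eq A_fun_eq Let_def n_def[symmetric] sr hr_def[symmetric] f
    by (simp add: prod_eq_iff)
  also have "\<dots> = exp (ln (hP e p) / (4 * n) + (1/2 - 1/(4*n)) * (ln (hr e p + hB e p) + ln (hr e p + ha e p))
      - (1/2) * ln (hr e p + hB e p))"
    using r P assms by (simp add: powr_def exp_add exp_diff ln_mult add.commute less_imp_neq[symmetric])
  also have "ln (hP e p) = 2 * ln (hr e p)"
    using r by (metis hr_squared ln_realpow of_nat_numeral)
  also have "2 * ln (hr e p) / (4 * n) + (1/2 - 1/(4*n)) * (ln (hr e p + hB e p) + ln (hr e p + ha e p))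
      - (1/2) * ln (hr e p + hB e p) = hL e p / (4 * n)"
    using n by (simp add: hL_def n_def[symmetric] field_simps)
  finally show ?thesis by (simp add: n_def)
qed

section \<open>Cutoffs and the Gibbs weight\<close>

lemma DERIV_max_powr:
  fixes q :: real
  assumes q: "q > 1"
  shows "((\<lambda>z. max 0 z powr q) has_real_derivative q * max 0 z powr (q - 1)) (at z)"
proof -
  consider "z > 0" | "z < 0" | "z = 0" by linarith
  then show ?thesis
  proof cases
    case 1
    have "((\<lambda>z. z powr q) has_real_derivative q * z powr (q - 1)) (at z)"
      using 1 by (rule has_real_derivative_powr)
    then have "((\<lambda>z. max 0 z powr q) has_real_derivative q * z powr (q - 1)) (at z)"
      by (rule has_field_derivative_transform_within_open[where S = "{0<..}"]) (use 1 in auto)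
    then show ?thesis using 1 by simp
  next
    case 2
    have "((\<lambda>z. 0 :: real) has_real_derivative 0) (at z)" by simp
    then have "((\<lambda>z. max 0 z powr q) has_real_derivative 0) (at z)"
      by (rule has_field_derivative_transform_within_open[where S = "{..<0}"]) (use 2 q in auto)
    then show ?thesis using 2 q by simp
  next
    case 3
    have "(\<lambda>h. max 0 h powr q / h) \<midarrow>0\<rightarrow> (0::real)"
    proof (rule Lim_null_comparison)
      show "\<forall>\<^sub>F h in at 0. norm (max 0 h powr q / h) \<le> max 0 h powr (q - 1)"
        by (rule always_eventually) (auto simp: max_def powr_diff)
      have "isCont (\<lambda>h. max 0 h powr (q - 1)) (0::real)"
        using q by (auto intro!: continuous_intros)
      then show "(\<lambda>h. max 0 h powr (q - 1)) \<midarrow>0\<rightarrow> (0::real)"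
        using q by (simp add: isCont_def)
    qed
    then show ?thesis using 3 q by (simp add: DERIV_def)
  qed
qed

text \<open>\<open>\<bar>z\<bar>\<^sup>q\<close> and its derivative, split into positive and negative part: in this form the derivative is
  visibly continuous.\<close>

definition abs_powr :: "real \<Rightarrow> real \<Rightarrow> real" where
  "abs_powr q z = max 0 z powr q + max 0 (- z) powr q"

definition abs_powr' :: "real \<Rightarrow> real \<Rightarrow> real" where
  "abs_powr' q z = q * (max 0 z powr (q - 1) - max 0 (- z) powr (q - 1))"

lemma abs_powr_eq: "q > 0 \<Longrightarrow> \<bar>z\<bar> powr q = abs_powr q z"
  by (auto simp: abs_powr_def max_def)

lemma abs_abs_powr': "q > 1 \<Longrightarrow> \<bar>abs_powr' q z\<bar> = q * \<bar>z\<bar> powr (q - 1)"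
  by (auto simp: abs_powr'_def max_def abs_mult)

lemma DERIV_abs_powr:
  assumes "q > 1"
  shows "(abs_powr q has_real_derivative abs_powr' q z) (at z)"
proof -
  have "((\<lambda>z. max 0 (- z) powr q) has_real_derivative q * max 0 (- z) powr (q - 1) * (- 1)) (at z)"
    by (rule DERIV_chain2[OF DERIV_max_powr[OF assms]]) (auto intro!: derivative_eq_intros)
  from DERIV_add[OF DERIV_max_powr[OF assms] this]
  show ?thesis unfolding abs_powr_def[abs_def] abs_powr'_def by (simp add: algebra_simps)
qed

lemma continuous_on_max_powr:
  fixes f :: "'a::topological_space \<Rightarrow> real"
  assumes "q > 0" "continuous_on S f"
  shows "continuous_on S (\<lambda>x. max 0 (f x) powr q)"
  using assms by (intro continuous_on_powr' continuous_intros) auto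

lemma continuous_on_abs_powr: "q > 0 \<Longrightarrow> continuous_on S f \<Longrightarrow> continuous_on S (\<lambda>x. abs_powr q (f x))"
  unfolding abs_powr_def by (intro continuous_intros continuous_on_max_powr)

lemma continuous_on_abs_powr': "q > 1 \<Longrightarrow> continuous_on S f \<Longrightarrow> continuous_on S (\<lambda>x. abs_powr' q (f x))"
  unfolding abs_powr'_def by (intro continuous_intros continuous_on_max_powr) auto

lemma has_hderiv_abs_powr:
  assumes "q > 1" "has_hderiv e i u d"
  shows "has_hderiv e i (\<lambda>p. abs_powr q (u p)) (\<lambda>p. abs_powr' q (u p) * d p)"
  unfolding has_hderiv_def
proof
  fix p
  have "((\<lambda>s. u (heis_mult e p (hstep i s))) has_real_derivative d p) (at 0)"
    using assms(2) unfolding has_hderiv_def by blast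
  from DERIV_chain2[OF DERIV_abs_powr[OF assms(1)] this]
  show "((\<lambda>s. abs_powr q (u (heis_mult e p (hstep i s)))) has_real_derivative abs_powr' q (u p) * d p) (at 0)"
    by simp
qed

text \<open>A \<open>C\<^sup>1\<close> step from \<open>0\<close> on \<open>x \<le> 1\<close> to \<open>1\<close> on \<open>x \<ge> 2\<close>. As a function of \<open>P\<close> it removes a neighbourhood of
  the origin, where \<open>N\<close> is not differentiable.\<close>

definition inner_cut :: "real \<Rightarrow> real" where
  "inner_cut x = max 0 (x - 1) powr 2 / (max 0 (x - 1) powr 2 + max 0 (2 - x) powr 2)"

definition inner_cut' :: "real \<Rightarrow> real" where
  "inner_cut' x = (2 * max 0 (x - 1) * (max 0 (x - 1) powr 2 + max 0 (2 - x) powr 2)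
     - max 0 (x - 1) powr 2 * (2 * max 0 (x - 1) - 2 * max 0 (2 - x)))
     / (max 0 (x - 1) powr 2 + max 0 (2 - x) powr 2)\<^sup>2"

lemma inner_cut_denominator_pos: "0 < max 0 (x - 1) powr 2 + max 0 (2 - x) powr 2" for x :: real
  by (cases "x > 1") (auto intro: add_pos_nonneg add_nonneg_pos)

lemma DERIV_inner_cut: "(inner_cut has_real_derivative inner_cut' x) (at x)"
proof -
  have 1: "((\<lambda>x. max 0 (x - 1) powr 2) has_real_derivative 2 * max 0 (x - 1)) (at x)"
  proof -
    have "((\<lambda>x. max 0 (x - 1) powr 2) has_real_derivative 2 * max 0 (x - 1) powr (2 - 1) * 1) (at x)"
      by (rule DERIV_chain2[OF DERIV_max_powr]) (auto intro!: derivative_eq_intros)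
    then show ?thesis by simp
  qed
  have 2: "((\<lambda>x. max 0 (2 - x) powr 2) has_real_derivative - 2 * max 0 (2 - x)) (at x)"
  proof -
    have "((\<lambda>x. max 0 (2 - x) powr 2) has_real_derivative 2 * max 0 (2 - x) powr (2 - 1) * (- 1)) (at x)"
      by (rule DERIV_chain2[OF DERIV_max_powr]) (auto intro!: derivative_eq_intros)
    then show ?thesis by simp
  qed
  have nz: "max 0 (x - 1) powr 2 + max 0 (2 - x) powr 2 \<noteq> 0"
    using inner_cut_denominator_pos[of x] by linarith
  show ?thesis
    unfolding inner_cut_def[abs_def] inner_cut'_def
    by (rule DERIV_cong[OF DERIV_divide[OF 1 DERIV_add[OF 1 2] nz]]) (simp add: power2_eq_square)
qed

lemma continuous_on_inner_cut': "continuous_on S inner_cut'"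
proof -
  have nz: "(max 0 (x - 1) powr 2 + max 0 (2 - x) powr 2)\<^sup>2 \<noteq> 0" for x :: real
    using inner_cut_denominator_pos[of x] by (metis less_irrefl zero_eq_power2)
  show ?thesis
    unfolding inner_cut'_def[abs_def]
    by (intro continuous_intros continuous_on_max_powr ballI nz) simp_all
qed

lemma continuous_on_inner_cut: "continuous_on S inner_cut"
  by (rule continuous_at_imp_continuous_on) (use DERIV_inner_cut DERIV_isCont in blast)

lemma inner_cut_bounds: "0 \<le> inner_cut x" "inner_cut x \<le> 1"
  using inner_cut_denominator_pos[of x] by (auto simp: inner_cut_def)

lemma inner_cut_low: "x \<le> 1 \<Longrightarrow> inner_cut x = 0" "x \<le> 1 \<Longrightarrow> inner_cut' x = 0"
  by (auto simp: inner_cut_def inner_cut'_def)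

lemma inner_cut_high: "x \<ge> 2 \<Longrightarrow> inner_cut x = 1" "x \<ge> 2 \<Longrightarrow> inner_cut' x = 0"
  by (auto simp: inner_cut_def inner_cut'_def)

lemma inner_cut'_bounded: "\<exists>K\<ge>0. \<forall>x. inner_cut' x \<le> K"
proof -
  have "bounded (inner_cut' ` {1..2})"
    by (intro compact_imp_bounded compact_continuous_image continuous_on_inner_cut') simp
  then obtain K where K: "\<forall>x\<in>{1..2}. \<bar>inner_cut' x\<bar> \<le> K" by (auto simp: bounded_iff)
  have "inner_cut' x \<le> \<bar>K\<bar>" for x
  proof (cases "x \<in> {1..2}")
    case True
    then have "\<bar>inner_cut' x\<bar> \<le> K" using K by blast
    then show ?thesis by linarith
  next
    case False
    then have "x \<le> 1 \<or> 2 \<le> x" by auto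
    then show ?thesis using inner_cut_low(2)[of x] inner_cut_high(2)[of x] by auto
  qed
  then show ?thesis by (intro exI[of _ "\<bar>K\<bar>"]) auto
qed

text \<open>The square makes the cutoff \<open>C\<^sup>1\<close>. That it decreases in \<open>P\<close> is what renders its derivative harmless.\<close>

definition outer_cut :: "real \<Rightarrow> real \<Rightarrow> real" where
  "outer_cut R x = max 0 (1 - x / R) powr 2"

definition outer_cut' :: "real \<Rightarrow> real \<Rightarrow> real" where
  "outer_cut' R x = - 2 * max 0 (1 - x / R) / R"

lemma DERIV_outer_cut: "R > 0 \<Longrightarrow> (outer_cut R has_real_derivative outer_cut' R x) (at x)"
proof -
  assume R: "R > 0"
  have "((\<lambda>x. max 0 (1 - x / R) powr 2) has_real_derivative 2 * max 0 (1 - x / R) powr (2 - 1) * (- 1 / R)) (at x)"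
    by (rule DERIV_chain2[OF DERIV_max_powr]) (use R in \<open>auto intro!: derivative_eq_intros\<close>)
  then show ?thesis unfolding outer_cut_def[abs_def] outer_cut'_def by simp
qed

lemma continuous_on_outer_cut': "R > 0 \<Longrightarrow> continuous_on S (outer_cut' R)"
  unfolding outer_cut'_def[abs_def] by (intro continuous_intros) auto

lemma continuous_on_outer_cut: "R > 0 \<Longrightarrow> continuous_on S (outer_cut R)"
  by (rule continuous_at_imp_continuous_on) (use DERIV_outer_cut DERIV_isCont in blast)

lemma outer_cut_nonneg [simp]: "0 \<le> outer_cut R x"
  by (simp add: outer_cut_def)

lemma outer_cut_le_1: "R > 0 \<Longrightarrow> x \<ge> 0 \<Longrightarrow> outer_cut R x \<le> 1"
  by (simp add: outer_cut_def power_le_one)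

lemma outer_cut_eq_0: "R > 0 \<Longrightarrow> x \<ge> R \<Longrightarrow> outer_cut R x = 0" "R > 0 \<Longrightarrow> x \<ge> R \<Longrightarrow> outer_cut' R x = 0"
  by (auto simp: outer_cut_def outer_cut'_def max_def)

lemma outer_cut'_nonpos: "R > 0 \<Longrightarrow> outer_cut' R x \<le> 0"
  by (simp add: outer_cut'_def divide_nonpos_pos)

definition gibbs :: "'n::finite \<Rightarrow> real \<Rightarrow> 'n heis \<Rightarrow> real" where
  "gibbs e k p = exp (- cosh (heis_norm e p powr k))"

text \<open>Equal to \<open>N\<^sup>k\<close> off the origin (\<open>gibbs_eq\<close>); the value at the origin is arbitrary.\<close>

definition hE :: "'n::finite \<Rightarrow> real \<Rightarrow> 'n heis \<Rightarrow> real" where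
  "hE e k p = exp (k / (4 * real CARD('n)) * hL e p)"

lemma gibbs_pos [simp]: "0 < gibbs e k p" and gibbs_nonneg [simp]: "0 \<le> gibbs e k p"
  and gibbs_le_1: "gibbs e k p \<le> 1"
  by (auto simp: gibbs_def intro: order.trans[OF _ cosh_real_ge_1])

lemma gibbs_eq: "p \<noteq> 0 \<Longrightarrow> gibbs e k p = exp (- cosh (hE e k p))"
  by (simp add: gibbs_def heis_norm_eq hE_def exp_powr_real mult.commute)

lemma continuous_on_hL: "continuous_on {p. 0 < hP e p} (hL e)"
proof -
  have "0 < hr e p + hB e p" "0 < hr e p + ha e p" "0 < hr e p" if "0 < hP e p" for p
    using that by (auto intro!: add_pos_nonneg)
  then have "hr e p + hB e p \<noteq> 0" "hr e p + ha e p \<noteq> 0" "hr e p \<noteq> 0" if "0 < hP e p" for p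
    using that by (metis less_irrefl)+
  then show ?thesis unfolding hL_def[abs_def]
    by (intro continuous_intros) auto
qed

lemma continuous_on_hE: "continuous_on {p. 0 < hP e p} (hE e k)"
  unfolding hE_def[abs_def] by (intro continuous_intros continuous_on_hL)

lemma continuous_on_gibbs: "continuous_on {p. 0 < hP e p} (gibbs e k)"
proof -
  have "continuous_on {p. 0 < hP e p} (\<lambda>p. exp (- cosh (hE e k p)))"
    by (intro continuous_intros continuous_on_hE)
  then show ?thesis
    by (rule continuous_on_eq) (auto simp: gibbs_eq hP_pos_iff)
qed

lemma borel_gibbs [measurable]: "gibbs e k \<in> borel_measurable borel"
proof -
  have "(\<lambda>p. if p \<in> {p. 0 < hP e p} then gibbs e k p else gibbs e k 0) \<in> borel_measurable borel"
  proof (rule borel_measurable_continuous_on_if)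
    show "continuous_on {p. 0 < hP e p} (gibbs e k)" by (rule continuous_on_gibbs)
  qed (auto intro!: continuous_intros)
  also have "(\<lambda>p. if p \<in> {p. 0 < hP e p} then gibbs e k p else gibbs e k 0) = gibbs e k"
    by (auto simp: hP_pos_iff)
  finally show ?thesis .
qed

lemma open_hP_pos: "open {p. 0 < hP e p}" and open_hP_less: "open {p. hP e p < c}"
  by (intro open_Collect_less continuous_intros)+

text \<open>Flow lines are continuous, so a formula valid on an open set may be differentiated along them.\<close>

lemma eventually_hP:
  assumes "open S" "p \<in> S"
  shows "eventually (\<lambda>s. heis_mult e p (hstep i s) \<in> S) (nhds 0)"
proof -
  have "continuous_on UNIV (\<lambda>s. heis_mult e p (hstep i s))"
    by (intro continuous_intros)
  then have "open ((\<lambda>s. heis_mult e p (hstep i s)) -` S)"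
    by (rule open_vimage[OF assms(1)])
  then show ?thesis
    unfolding eventually_nhds using assms(2) by (intro exI conjI) auto
qed

lemma hderiv_gibbs:
  fixes e :: "'n::finite"
  assumes "0 < hP e p"
  shows "((\<lambda>s. gibbs e k (heis_mult e p (hstep i s))) has_real_derivative
    - gibbs e k p * (sinh (hE e k p) * (hE e k p * (k / (4 * real CARD('n)) * hdL e p i)))) (at 0)"
proof -
  let ?c = "\<lambda>s. heis_mult e p (hstep i s)"
  have "((\<lambda>s. hE e k (?c s)) has_real_derivative hE e k p * (k / (4 * real CARD('n)) * hdL e p i)) (at 0)"
    unfolding hE_def by (auto intro!: derivative_eq_intros hderiv_L[OF assms])
  then have "((\<lambda>s. exp (- cosh (hE e k (?c s)))) has_real_derivative
     - gibbs e k p * (sinh (hE e k p) * (hE e k p * (k / (4 * real CARD('n)) * hdL e p i)))) (at 0)"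
    using assms by (auto intro!: derivative_eq_intros simp: gibbs_eq hP_pos_iff)
  moreover have "eventually (\<lambda>s. gibbs e k (?c s) = exp (- cosh (hE e k (?c s)))) (nhds 0)"
    using eventually_hP[OF open_hP_pos, of p e e i] assms
    by (auto elim!: eventually_mono simp: gibbs_eq hP_pos_iff)
  ultimately show ?thesis
    by (subst DERIV_cong_ev[OF refl _ refl])
qed

definition hW :: "'n::finite \<Rightarrow> real \<Rightarrow> real \<Rightarrow> 'n heis \<Rightarrow> real" where
  "hW e k R p = inner_cut (hP e p) * outer_cut R (hP e p) * gibbs e k p"

definition hdW :: "'n::finite \<Rightarrow> real \<Rightarrow> real \<Rightarrow> 'n + 'n \<Rightarrow> 'n heis \<Rightarrow> real" where
  "hdW e k R i p =
     (inner_cut' (hP e p) * outer_cut R (hP e p) + inner_cut (hP e p) * outer_cut' R (hP e p)) * hdP e p i * gibbs e k p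
     + inner_cut (hP e p) * outer_cut R (hP e p) * (- gibbs e k p * (sinh (hE e k p) * (hE e k p * (k / (4 * real CARD('n)) * hdL e p i))))"

lemma has_hderiv_W:
  assumes R: "R > 0"
  shows "has_hderiv e i (hW e k R) (hdW e k R i)"
  unfolding has_hderiv_def
proof
  fix p
  let ?c = "\<lambda>s. heis_mult e p (hstep i s)"
  show "((\<lambda>s. hW e k R (?c s)) has_real_derivative hdW e k R i p) (at 0)"
  proof (cases "0 < hP e p")
    case True
    have 1: "((\<lambda>s. inner_cut (hP e (?c s))) has_real_derivative inner_cut' (hP e p) * hdP e p i) (at 0)"
      using DERIV_chain2[where f = inner_cut, OF DERIV_inner_cut hderiv_P] by simp
    have 2: "((\<lambda>s. outer_cut R (hP e (?c s))) has_real_derivative outer_cut' R (hP e p) * hdP e p i) (at 0)"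
      using DERIV_chain2[where f = "outer_cut R", OF DERIV_outer_cut[OF R] hderiv_P] by simp
    show ?thesis
      unfolding hW_def hdW_def
      by (rule DERIV_cong[OF DERIV_mult[OF DERIV_mult[OF 1 2] hderiv_gibbs[OF True]]])
         (simp add: algebra_simps)
  next
    case False
    then have "hP e p = 0" using hP_nonneg[of e p] by linarith
    then have "eventually (\<lambda>s. ?c s \<in> {p. hP e p < 1}) (nhds 0)"
      by (intro eventually_hP open_hP_less) (simp only: mem_Collect_eq)
    then have "eventually (\<lambda>s. hW e k R (?c s) = 0) (nhds 0)"
      by (rule eventually_mono) (simp add: hW_def inner_cut_low)
    then have "((\<lambda>s. hW e k R (?c s)) has_real_derivative 0) (at 0)"
      by (subst DERIV_cong_ev[OF refl _ refl, where g = "\<lambda>_. 0"]) auto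
    moreover have "hdW e k R i p = 0"
      using inner_cut_low[of "hP e p"] \<open>hP e p = 0\<close> by (simp add: hdW_def del: hP_eq_0_iff)
    ultimately show ?thesis by simp
  qed
qed

text \<open>Pieces that are only known to be continuous off the origin are continuous everywhere once they
  vanish near it.\<close>

lemma continuous_on_near_far:
  fixes f :: "'n::finite heis \<Rightarrow> real"
  assumes "continuous_on {p. 0 < hP e p} f" "\<And>p. hP e p < 1 \<Longrightarrow> f p = 0"
  shows "continuous_on UNIV f"
proof -
  have "continuous_on {p. hP e p < 1} f"
    using assms(2) by (intro continuous_on_eq[OF continuous_on_const[of _ 0]]) auto
  then have "continuous_on ({p. 0 < hP e p} \<union> {p. hP e p < 1}) f"
    using assms(1) open_hP_pos open_hP_less by (intro continuous_on_open_Un) auto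
  moreover have "{p. 0 < hP e p} \<union> {p. hP e p < 1} = UNIV" by auto
  ultimately show ?thesis by simp
qed

lemma continuous_hW:
  assumes R: "R > 0"
  shows "continuous_on UNIV (hW e k R)"
proof (rule continuous_on_near_far[of e])
  show "continuous_on {p. 0 < hP e p} (hW e k R)"
    unfolding hW_def[abs_def]
    by (intro continuous_intros continuous_on_gibbs
        continuous_on_compose2[OF continuous_on_inner_cut[of UNIV]]
        continuous_on_compose2[OF continuous_on_outer_cut[OF R, of UNIV]]) auto
qed (simp add: hW_def inner_cut_low)

lemma continuous_on_hdL: "continuous_on {p. 0 < hP e p} (\<lambda>p. hdL e p i)"
proof -
  have "0 < hr e p + hB e p" "0 < hr e p + ha e p" "0 < hr e p" if "0 < hP e p" for p
    using that by (auto intro!: add_pos_nonneg)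
  then have "hr e p + hB e p \<noteq> 0" "hr e p + ha e p \<noteq> 0" "hr e p \<noteq> 0" if "0 < hP e p" for p
    using that by (metis less_irrefl)+
  then show ?thesis unfolding hdL_def hLa_def hLs_def hLt_def
    by (intro continuous_intros) auto
qed

lemma continuous_hdW:
  assumes R: "R > 0"
  shows "continuous_on UNIV (hdW e k R i)"
proof (rule continuous_on_near_far[of e])
  show "continuous_on {p. 0 < hP e p} (hdW e k R i)"
    unfolding hdW_def[abs_def] hdP_def
    by (intro continuous_intros continuous_on_gibbs continuous_on_hE continuous_on_hdL
        continuous_on_compose2[OF continuous_on_inner_cut[of UNIV]]
        continuous_on_compose2[OF continuous_on_inner_cut'[of UNIV]]
        continuous_on_compose2[OF continuous_on_outer_cut[OF R, of UNIV]]
        continuous_on_compose2[OF continuous_on_outer_cut'[OF R, of UNIV]]) auto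
qed (simp add: hdW_def inner_cut_low)

text \<open>\<open>L \<ge> 2 n log r - log 2\<close> gives \<open>E = N\<^sup>k \<ge> sqrt r / 2\<close>, and \<open>sinh E \<ge> (E / 8)\<^sup>8 / 2\<close> is then at least a multiple
  of \<open>r\<^sup>4\<close>, which beats any multiple of \<open>r\<^sup>3\<close>.\<close>

lemma drift_gain_growth:
  fixes e :: "'n::finite"
  assumes k: "k \<ge> 1" and q: "q \<ge> 2"
  shows "\<exists>P1\<ge>max 2 q. \<forall>p. hP e p \<ge> P1 \<longrightarrow>
     8 * (q - 1) * (hr e p)^3 + 2 * real CARD('n) + 9
       \<le> 2 * (sinh (hE e k p) * (hE e k p * (k / (4 * real CARD('n)))))"
proof -
  define n where "n = real CARD('n)"
  have n1: "n \<ge> 1" by (simp add: n_def Suc_leI)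
  \<comment> \<open>Chosen so that \<open>r \<ge> c\<close> makes the fourth power win with the constants of the estimate.\<close>
  define c where "c = 4 * n * 16^8 * (8 * q + 2 * n + 9)"
  have c1: "c \<ge> 1 * (8 * q + 2 * n + 9)"
    unfolding c_def using n1 q by (intro mult_right_mono) auto
  have c_ge: "c \<ge> 4" "c \<ge> q" using c1 n1 q by auto
  have cc: "c\<^sup>2 \<ge> c" using c_ge by (simp add: power2_eq_square)
  show ?thesis
  proof (intro exI[of _ "c\<^sup>2"] conjI allI impI)
    show "max 2 q \<le> c\<^sup>2" using cc c_ge by auto
    fix p assume P: "c\<^sup>2 \<le> hP e p"
    define r where "r = hr e p"
    define E where "E = hE e k p"
    have r: "r \<ge> c" unfolding r_def hr_def using P c_ge by (intro real_le_rsqrt) auto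
    have r4: "r \<ge> 4" using r c_ge by simp
    have L: "hL e p \<ge> 2 * n * ln r - ln 2"
    proof -
      have "ln (r + hB e p) \<le> ln (2 * r)"
        using hB_le_hr[of e p] r4 hB_nonneg[of e p]
        by (intro iffD2[OF ln_le_cancel_iff]) (auto simp: r_def[symmetric] intro: add_pos_nonneg)
      also have "\<dots> = ln 2 + ln r" using r4 by (simp add: ln_mult)
      finally have 1: "ln (r + hB e p) \<le> ln 2 + ln r" .
      have "ln r \<le> ln (r + ha e p)"
        using r4 ha_nonneg[of e p] by (intro iffD2[OF ln_le_cancel_iff]) (auto intro: add_pos_nonneg)
      then have "(2 * n - 1) * ln r \<le> (2 * n - 1) * ln (r + ha e p)"
        using n1 by (intro mult_left_mono) auto
      with 1 show ?thesis unfolding hL_def r_def[symmetric] n_def[symmetric]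
        by (simp add: algebra_simps)
    qed
    have lnr: "ln r \<ge> ln 2" using r4 by simp
    have "ln 2 \<le> 2 * n * ln r" using n1 lnr mult_mono[of 1 "2 * n" "ln 2" "ln r"] by simp
    then have L0: "hL e p \<ge> 0" using L by simp
    have "ln r / 2 - ln 2 \<le> (2 * n * ln r - ln 2) / (4 * n)"
    proof -
      have "ln 2 / (4 * n) \<le> ln 2 / 1" using n1 by (intro divide_left_mono) auto
      then show ?thesis using n1 by (simp add: diff_divide_distrib)
    qed
    also have "\<dots> \<le> hL e p / (4 * n)" using L n1 by (intro divide_right_mono) auto
    also have "\<dots> \<le> k / (4 * n) * hL e p"
      using k n1 L0 mult_right_mono[of 1 k "hL e p"] by (simp add: divide_right_mono)
    finally have "exp (ln r / 2 - ln 2) \<le> E" by (simp add: E_def hE_def n_def)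
    moreover have "exp (ln r / 2 - ln 2) = sqrt r / 2"
      using r4 by (simp add: exp_diff ln_sqrt[symmetric])
    ultimately have E: "E \<ge> sqrt r / 2" by simp
    have "sqrt r \<ge> 2" using r4 by (simp add: real_le_rsqrt)
    then have E1: "E \<ge> 1" using E by simp
    have "(E / 8) ^ 8 / 2 \<le> sinh E"
    proof -
      have "1 + (E / 8) ^ 8 \<le> (1 + E / 8) ^ 8"
      proof -
        have aux: "1 + x ^ m \<le> (1 + x) ^ m" if "x \<ge> 0" "m \<ge> 1" for x :: real and m
          using that(2)
        proof (induction m rule: dec_induct)
          case (step m)
          have "1 + x ^ Suc m \<le> (1 + x) * (1 + x ^ m)" using that(1) by (simp add: algebra_simps)
          also have "\<dots> \<le> (1 + x) * (1 + x) ^ m" using step.IH that(1) by (intro mult_left_mono) auto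
          finally show ?case by simp
        qed simp
        show ?thesis by (rule aux) (use E1 in auto)
      qed
      also have "(1 + E / 8) ^ 8 \<le> exp E"
        using exp_ge_one_plus_x_over_n_power_n[of 8 E] E1 by simp
      finally have "1 + (E / 8) ^ 8 \<le> exp E" .
      moreover have "y / 2 \<le> sinh E" if "1 + y \<le> exp E" for y
      proof -
        have "exp (- E) \<le> 1" using E1 by simp
        moreover have "sinh E = (exp E - exp (- E)) / 2" by (simp add: sinh_def)
        ultimately show ?thesis using that by argo
      qed
      ultimately show ?thesis by blast
    qed
    moreover have "(sqrt r / 16) ^ 8 \<le> (E / 8) ^ 8"
      using E r4 by (intro power_mono) auto
    moreover have "(sqrt r / 16) ^ 8 = r ^ 4 / 16 ^ 8"
    proof -
      have "sqrt r ^ 8 = ((sqrt r)\<^sup>2) ^ 4" by (simp flip: power_mult)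
      then show ?thesis using r4 by (simp add: power_divide)
    qed
    ultimately have "r ^ 4 / 16 ^ 8 / 2 \<le> sinh E"
      by (metis divide_right_mono order.trans zero_le_numeral)
    then have "r ^ 4 / 16 ^ 8 / 2 * 1 \<le> sinh E * E"
      using E1 by (intro mult_mono) auto
    then have "r ^ 4 / 16 ^ 8 / 2 * (1 / (4 * n)) \<le> sinh E * E * (k / (4 * n))"
      using k n1 E1 by (intro mult_mono divide_right_mono) auto
    then have 1: "r ^ 4 / (4 * n * 16 ^ 8) \<le> 2 * (sinh E * (E * (k / (4 * n))))"
      by (simp add: field_simps)
    have "8 * (q - 1) * r ^ 3 + 2 * n + 9 \<le> (8 * q + 2 * n + 9) * r ^ 3"
    proof -
      define y where "y = r ^ 3"
      have y: "1 \<le> y" using r4 by (simp add: y_def)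
      have "(2 * n + 9) * 1 \<le> (2 * n + 9) * y" using y n1 by (intro mult_left_mono) auto
      then show ?thesis unfolding y_def[symmetric] using y by (simp add: algebra_simps)
    qed
    also have "\<dots> = c * r ^ 3 / (4 * n * 16 ^ 8)" using n1 by (simp add: c_def)
    also have "\<dots> \<le> r * r ^ 3 / (4 * n * 16 ^ 8)"
      using r r4 n1 by (intro divide_right_mono mult_right_mono) auto
    also have "r * r ^ 3 = r ^ 4" by (simp add: eval_nat_numeral)
    finally show "8 * (q - 1) * (hr e p)^3 + 2 * real CARD('n) + 9
       \<le> 2 * (sinh (hE e k p) * (hE e k p * (k / (4 * real CARD('n)))))"
      using 1 unfolding r_def[symmetric] E_def[symmetric] n_def[symmetric] by linarith
  qed
qed

section \<open>The U-bound\<close>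

abbreviation cut_gibbs :: "'n::finite \<Rightarrow> real \<Rightarrow> real \<Rightarrow> 'n heis \<Rightarrow> real" where
  "cut_gibbs e k R p \<equiv> outer_cut R (hP e p) * gibbs e k p"

text \<open>The Gibbs weight is not normalised here; the constant \<open>Z\<close> enters only at the very end.\<close>

abbreviation cut_energy where
  "cut_energy e k R q g \<equiv> \<integral>\<^sup>+p. ennreal (cut_gibbs e k R p * norm (g p) powr q) \<partial>lborel"

abbreviation cut_osc where
  "cut_osc e k R \<rho> q u \<equiv> \<integral>\<^sup>+p'. (\<integral>\<^sup>+p. ennreal (cut_gibbs e k R p * \<bar>u p - u p'\<bar> powr q)
     * indicator (cball 0 \<rho>) p' \<partial>lborel) \<partial>lborel"

abbreviation gibbs_energy where
  "gibbs_energy e k q G \<equiv> \<integral>\<^sup>+p. ennreal (norm (G p) powr q) * ennreal (gibbs e k p) \<partial>lborel"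

abbreviation gibbs_osc where
  "gibbs_osc e k \<rho> q f \<equiv> \<integral>\<^sup>+p'. (\<integral>\<^sup>+p. ennreal (gibbs e k p * \<bar>f p - f p'\<bar> powr q)
     * indicator (cball 0 \<rho>) p' \<partial>lborel) \<partial>lborel"

definition drift_div :: "'n::finite \<Rightarrow> 'n heis \<Rightarrow> real" where
  "drift_div e p = (2 * real CARD('n) - 4) * (snd p)\<^sup>2 - (2 * real CARD('n) + 4) * (hB e p)\<^sup>2 - 4 * hs e p * hB e p"

text \<open>\<open>- Y V\<close> is at least \<open>drift_gain\<close> times \<open>r B\<close>, because \<open>V = cosh E\<close> with \<open>E = exp (k L / 4 n)\<close>.\<close>

definition drift_gain :: "'n::finite \<Rightarrow> real \<Rightarrow> 'n heis \<Rightarrow> real" where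
  "drift_gain e k p = 2 * (sinh (hE e k p) * (hE e k p * (k / (4 * real CARD('n)))))"

lemma drift_gain_nonneg: "k \<ge> 0 \<Longrightarrow> 0 \<le> drift_gain e k p"
  by (simp add: drift_gain_def hE_def)

text \<open>The divergence of the cut off weight times \<open>Y\<close>. Of the four terms of the product rule, the one with
  the derivative of the outer cutoff is nonnegative and is dropped.\<close>

lemma weighted_div_lower:
  fixes e :: "'n::finite"
  assumes R: "R > 0" and k: "k \<ge> 0" and n: "CARD('n) \<ge> 2"
  shows "cut_gibbs e k R p *
      (inner_cut (hP e p) * (drift_div e p + drift_gain e k p * (hr e p * hB e p)) - 4 * (hB e p)\<^sup>2 * hP e p * inner_cut' (hP e p))
    \<le> (\<Sum>i\<in>UNIV. hdY e p i * hW e k R p + hY e p i * hdW e k R i p)"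
proof (cases "0 < hP e p")
  case False
  then have "hP e p = 0" using hP_nonneg[of e p] by linarith
  then show ?thesis
    using inner_cut_low[of "hP e p"] by (simp add: hW_def hdW_def del: hP_eq_0_iff)
next
  case True
  define P h h' g g' w where "P = hP e p" "h = inner_cut P" "h' = inner_cut' P" "g = outer_cut R P" "g' = outer_cut' R P" "w = gibbs e k p"
  note d = this
  define c where "c = h * g * w * (sinh (hE e k p) * (hE e k p * (k / (4 * real CARD('n)))))"
  have c: "c \<ge> 0" unfolding c_def d using k by (auto simp: inner_cut_bounds hE_def)
  have "(\<Sum>i\<in>UNIV. hdY e p i * hW e k R p + hY e p i * hdW e k R i p)
     = (\<Sum>i\<in>UNIV. (h * g * w) * hdY e p i + ((h' * g + h * g') * w) * (hY e p i * hdP e p i) - c * (hY e p i * hdL e p i))"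
    unfolding c_def by (intro sum.cong refl) (simp add: hW_def hdW_def d[symmetric] algebra_simps)
  also have "\<dots> = (h * g * w) * (\<Sum>i\<in>UNIV. hdY e p i) + ((h' * g + h * g') * w) * (\<Sum>i\<in>UNIV. hY e p i * hdP e p i)
      - c * (\<Sum>i\<in>UNIV. hY e p i * hdL e p i)"
    by (simp only: sum.distrib sum_subtractf sum_distrib_left)
  also have "\<dots> = (h * g * w) * drift_div e p + ((h' * g + h * g') * w) * (- 4 * (hB e p)\<^sup>2 * P)
      - c * (\<Sum>i\<in>UNIV. hY e p i * hdL e p i)"
    unfolding hY_div hY_P d(1)[symmetric] drift_div_def ..
  finally have eq: "(\<Sum>i\<in>UNIV. hdY e p i * hW e k R p + hY e p i * hdW e k R i p)
    = (h * g * w) * drift_div e p + h' * g * w * (- 4 * (hB e p)\<^sup>2 * P) + (h * w * (4 * (hB e p)\<^sup>2 * P)) * (- g')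
      - c * (\<Sum>i\<in>UNIV. hY e p i * hdL e p i)"
    by (simp add: algebra_simps)
  \<comment> \<open>Here \<open>Y P \<le> 0\<close> meets \<open>outer_cut' \<le> 0\<close>.\<close>
  have "0 \<le> (h * w * (4 * (hB e p)\<^sup>2 * P)) * (- g')"
    using outer_cut'_nonpos[OF R, of P] by (intro mult_nonneg_nonneg) (auto simp: d inner_cut_bounds)
  moreover have "c * (\<Sum>i\<in>UNIV. hY e p i * hdL e p i) \<le> c * (- 2 * hr e p * hB e p)"
    by (intro mult_left_mono hY_L True n c)
  ultimately have "(h * g * w) * drift_div e p + h' * g * w * (- 4 * (hB e p)\<^sup>2 * P) - c * (- 2 * hr e p * hB e p)
    \<le> (\<Sum>i\<in>UNIV. hdY e p i * hW e k R p + hY e p i * hdW e k R i p)"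
    unfolding eq by linarith
  then show ?thesis
    unfolding d[symmetric] by (simp add: c_def drift_gain_def algebra_simps)
qed

lemma scale_lower:
  fixes h M D :: real
  assumes h: "0 \<le> h" "h \<le> 1" and M: "0 \<le> M" and D: "- M \<le> D"
  shows "- M \<le> h * D"
proof -
  have "h * M \<le> 1 * M" using h M by (intro mult_right_mono)
  moreover have "h * (- M) \<le> h * D" using h D by (intro mult_left_mono)
  ultimately show ?thesis by simp
qed

text \<open>The quantity \<open>(q - 1) (1 + 8 P\<^sup>2 B)\<close> is what Young's inequality will cost, since \<open>8 P\<^sup>2 B\<close> bounds \<open>\<bar>Y\<bar>\<^sup>2\<close>.
  Far out, the drift term absorbs \<open>8 (q - 1) P\<^sup>2 B\<close> and the negative multiple of \<open>B\<^sup>2\<close> in the divergence, and the rest of the divergence leaves at least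
  \<open>2 t\<^sup>2 + B\<^sup>2 - (q - 1) \<ge> 1\<close>. On the remaining compact set a constant is enough.\<close>

lemma div_drift_bounds:
  fixes e :: "'n::finite"
  assumes k: "k \<ge> 1" and q: "q \<ge> 2" and n: "CARD('n) \<ge> 3"
  shows "\<exists>C\<ge>0. \<exists>P1. \<forall>p.
     1 - (if hP e p \<le> P1 then C else 0) \<le>
       inner_cut (hP e p) * (drift_div e p + drift_gain e k p * (hr e p * hB e p) - (q - 1) * (1 + 8 * (hP e p)\<^sup>2 * hB e p))
       - 4 * (hB e p)\<^sup>2 * hP e p * inner_cut' (hP e p)"
proof -
  obtain P1 where P1': "P1 \<ge> max 2 q \<and> (\<forall>p. hP e p \<ge> P1 \<longrightarrow>
     8 * (q - 1) * (hr e p)^3 + 2 * real CARD('n) + 9 \<le> drift_gain e k p)"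
    using drift_gain_growth[OF k q, of e] unfolding drift_gain_def by (rule exE)
  have P1: "P1 \<ge> max 2 q" by (rule conjunct1[OF P1'])
  have gr: "\<And>p. hP e p \<ge> P1 \<Longrightarrow>
     8 * (q - 1) * (hr e p)^3 + 2 * real CARD('n) + 9 \<le> drift_gain e k p"
    using conjunct2[OF P1'] by (elim allE impE)
  obtain K where K: "K \<ge> 0" "\<And>x. inner_cut' x \<le> K" using inner_cut'_bounded by blast
  define n where "n = real CARD('n)"
  have n3: "n \<ge> 3" using n by (simp add: n_def)
  define C where "C = 1 + ((2 * n + 8) * P1 + (q - 1) * (1 + 8 * P1\<^sup>2 * P1) + 4 * P1\<^sup>2 * K)"
  have C: "C \<ge> 0" unfolding C_def using P1 q n3 K by (intro add_nonneg_nonneg mult_nonneg_nonneg) auto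
  have "1 - (if hP e p \<le> P1 then C else 0) \<le>
       inner_cut (hP e p) * (drift_div e p + drift_gain e k p * (hr e p * hB e p) - (q - 1) * (1 + 8 * (hP e p)\<^sup>2 * hB e p))
       - 4 * (hB e p)\<^sup>2 * hP e p * inner_cut' (hP e p)" for p
  proof -
    define P B r s t where "P = hP e p" "B = hB e p" "r = hr e p" "s = hs e p" "t = snd p"
    note d = this
    have B: "0 \<le> B" "B \<le> r" "s \<le> B" "0 \<le> s" "0 \<le> r"
      using hB_le_hr[of e p] by (auto simp: d hB_def)
    have PP: "P = B\<^sup>2 + t\<^sup>2" "r\<^sup>2 = P" by (auto simp: d hP_def hr_def)
    have P0: "0 \<le> P" by (simp add: d)
    have "4 * s * B \<le> 4 * B\<^sup>2" using B by (simp add: power2_eq_square mult_right_mono)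
    then have div: "drift_div e p \<ge> 2 * t\<^sup>2 - (2 * n + 8) * B\<^sup>2"
      using n3 mult_right_mono[of 2 "2 * n - 4" "t\<^sup>2"] unfolding drift_div_def d[symmetric] n_def[symmetric]
      by (simp add: algebra_simps)
    show ?thesis
    proof (cases "P \<le> P1")
      case True
      have BP: "B\<^sup>2 \<le> P1" using True PP by (smt (verit) zero_le_power2)
      have "P1 * 1 \<le> P1 * P1" by (rule mult_left_mono) (use P1 in simp_all)
      then have "B\<^sup>2 \<le> P1\<^sup>2" using BP by (simp add: power2_eq_square)
      then have BP1: "B \<le> P1" by (rule power2_le_imp_le) (use P1 in simp)
      have PB: "P\<^sup>2 * B \<le> P1\<^sup>2 * P1" using True BP1 B(1) P0 by (intro mult_mono power_mono) simp_all
      have "0 \<le> drift_gain e k p * (r * B)" using drift_gain_nonneg[of k e p] k B by simp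
      moreover have "(2 * n + 8) * B\<^sup>2 \<le> (2 * n + 8) * P1" using BP n3 by (intro mult_left_mono) auto
      moreover have "0 \<le> t\<^sup>2" by simp
      moreover have "(q - 1) * (1 + 8 * P\<^sup>2 * B) \<le> (q - 1) * (1 + 8 * P1\<^sup>2 * P1)"
        using PB q by (intro mult_left_mono) auto
      ultimately have low: "drift_div e p + drift_gain e k p * (r * B) - (q - 1) * (1 + 8 * P\<^sup>2 * B)
          \<ge> - ((2 * n + 8) * P1 + (q - 1) * (1 + 8 * P1\<^sup>2 * P1))" (is "?D \<ge> - ?M")
        using div by linarith
      have M: "?M \<ge> 0" using P1 q n3 by (intro add_nonneg_nonneg mult_nonneg_nonneg) auto
      have 1: "inner_cut P * ?D \<ge> - ?M" by (rule scale_lower[OF inner_cut_bounds M low])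
      have "4 * B\<^sup>2 * P * inner_cut' P \<le> 4 * B\<^sup>2 * P * K"
        using K(2)[of P] P0 by (intro mult_left_mono) simp_all
      also have "\<dots> \<le> 4 * P1 * P1 * K" using BP True K(1) P0 P1
        by (intro mult_right_mono mult_mono) simp_all
      finally have "4 * B\<^sup>2 * P * inner_cut' P \<le> 4 * P1\<^sup>2 * K" by (simp add: power2_eq_square)
      with 1 show ?thesis using True unfolding d[symmetric] C_def by simp
    next
      case False
      then have P: "P \<ge> P1" "P \<ge> 2" using P1 by auto
      have "(8 * (q - 1) * r ^ 3 + 2 * n + 9) * (r * B) \<le> drift_gain e k p * (r * B)"
        using gr[of p] P B unfolding d[symmetric] n_def[symmetric] by (intro mult_right_mono) auto
      moreover have "(8 * (q - 1) * r ^ 3 + 2 * n + 9) * (r * B) = (q - 1) * (8 * P\<^sup>2 * B) + (2 * n + 9) * (r * B)"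
        unfolding PP(2)[symmetric] by (simp add: eval_nat_numeral algebra_simps)
      moreover have "(2 * n + 9) * B\<^sup>2 \<le> (2 * n + 9) * (r * B)"
        using B n3 by (intro mult_left_mono) (auto simp: power2_eq_square mult_right_mono)
      ultimately have "drift_div e p + drift_gain e k p * (r * B) - (q - 1) * (1 + 8 * P\<^sup>2 * B) \<ge> 2 * t\<^sup>2 + B\<^sup>2 - (q - 1)"
        using div by (simp add: algebra_simps)
      moreover have "2 * t\<^sup>2 + B\<^sup>2 - (q - 1) \<ge> 1"
        using P P1 PP by (smt (verit) zero_le_power2)
      ultimately show ?thesis
        using False inner_cut_high[OF P(2)] unfolding d[symmetric] by simp
    qed
  qed
  then show ?thesis using C by blast
qed

text \<open>Young's inequality with exponents \<open>q' = q / (q - 1)\<close> and \<open>q\<close>. As \<open>q \<ge> 2\<close> means \<open>1 \<le> q' \<le> 2\<close>, the power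
  \<open>y\<^sup>q'\<close> is at most \<open>1 + y\<^sup>2\<close>.\<close>

lemma young_field:
  fixes q z y g :: real
  assumes q: "q \<ge> 2" and y: "y \<ge> 0" "y\<^sup>2 \<le> M" and g: "g \<ge> 0"
  shows "q * \<bar>z\<bar> powr (q - 1) * y * g \<le> (q - 1) * \<bar>z\<bar> powr q * (1 + M) + g powr q"
proof -
  define q' where "q' = q / (q - 1)"
  have q': "q' > 1" "q' \<le> 2" "1 / q' + 1 / q = 1"
    using q by (auto simp: q'_def field_simps)
  have yq: "y powr q' \<le> 1 + M"
  proof (cases "y \<le> 1")
    case True
    then have "y powr q' \<le> 1" using y q' by (intro powr_le1) auto
    moreover have "0 \<le> M" using y(2) zero_le_power2 order.trans by blast
    ultimately show ?thesis by simp
  next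
    case False
    then have "y powr q' \<le> y powr 2" using q' by (intro powr_mono) auto
    then show ?thesis using y False by simp
  qed
  have "\<bar>z\<bar> powr (q - 1) * y * g \<le> (\<bar>z\<bar> powr (q - 1) * y) powr q' / q' + g powr q / q"
    using q q' y g by (intro Youngs_inequality) auto
  also have "(\<bar>z\<bar> powr (q - 1) * y) powr q' = \<bar>z\<bar> powr q * y powr q'"
    using q y by (simp add: powr_mult powr_powr q'_def)
  also have "\<bar>z\<bar> powr q * y powr q' / q' = (q - 1) / q * (\<bar>z\<bar> powr q * y powr q')"
    by (simp add: q'_def)
  finally have "q * (\<bar>z\<bar> powr (q - 1) * y * g) \<le> q * ((q - 1) / q * (\<bar>z\<bar> powr q * y powr q') + g powr q / q)"
    using q by (intro mult_left_mono) auto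
  also have "\<dots> = (q - 1) * (\<bar>z\<bar> powr q * y powr q') + g powr q"
    using q by (simp add: field_simps)
  also have "\<dots> \<le> (q - 1) * (\<bar>z\<bar> powr q * (1 + M)) + g powr q"
    using q yq by (intro add_right_mono mult_left_mono) auto
  finally show ?thesis by (simp add: mult.assoc)
qed

lemma integrable_bounded_mult:
  fixes f w :: "'a::euclidean_space \<Rightarrow> real"
  assumes "integrable lborel f" "w \<in> borel_measurable borel" "\<And>x. \<bar>w x\<bar> \<le> 1"
  shows "integrable lborel (\<lambda>x. f x * w x)"
proof (rule Bochner_Integration.integrable_bound[OF assms(1)])
  show "(\<lambda>x. f x * w x) \<in> borel_measurable lborel"
    using assms(1,2) by simp
  show "AE x in lborel. norm (f x * w x) \<le> norm (f x)"
    using assms(3) by (auto simp: abs_mult intro!: mult_right_le_one_le)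
qed

text \<open>The integral of the divergence of \<open>\<bar>u\<bar>\<^sup>q\<close> times the cut off weight times \<open>Y\<close> vanishes. Adding this zero
  turns a pointwise inequality between the integrands into the claim. The constants do not depend
  on \<open>R\<close>.\<close>

lemma weighted_U_bound:
  fixes e :: "'n::finite"
  assumes k: "k \<ge> 1" and q: "q \<ge> 2" and n: "CARD('n) \<ge> 3"
  shows "\<exists>C\<ge>0. \<exists>\<rho>\<ge>0. \<forall>R>0. \<forall>u g. horiz_C1 e u g \<longrightarrow>
    (\<integral>\<^sup>+p. ennreal (cut_gibbs e k R p * \<bar>u p\<bar> powr q) \<partial>lborel)
     \<le> ennreal C * (\<integral>\<^sup>+p. ennreal (\<bar>u p\<bar> powr q) * indicator (cball 0 \<rho>) p \<partial>lborel)
      + (cut_energy e k R q g)"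
proof -
  obtain C P1 where C: "C \<ge> 0" and low: "\<And>p.
     1 - (if hP e p \<le> P1 then C else 0) \<le>
       inner_cut (hP e p) * (drift_div e p + drift_gain e k p * (hr e p * hB e p) - (q - 1) * (1 + 8 * (hP e p)\<^sup>2 * hB e p))
       - 4 * (hB e p)\<^sup>2 * hP e p * inner_cut' (hP e p)"
    using div_drift_bounds[OF k q n, of e] by blast
  define \<rho> where "\<rho> = max 0 (2 * P1 + 2)"
  have ball: "p \<in> cball 0 \<rho>" if "hP e p \<le> P1" for p
    using norm_le_of_hP[OF that] by (simp add: \<rho>_def)
  have "(\<integral>\<^sup>+p. ennreal (cut_gibbs e k R p * \<bar>u p\<bar> powr q) \<partial>lborel)
     \<le> ennreal C * (\<integral>\<^sup>+p. ennreal (\<bar>u p\<bar> powr q) * indicator (cball 0 \<rho>) p \<partial>lborel)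
      + (cut_energy e k R q g)"
    if R: "R > 0" and u: "horiz_C1 e u g" for R u g
  proof -
    note [measurable] = horiz_C1_measurable[OF u]
    have cu: "continuous_on UNIV u" and cg: "continuous_on UNIV g"
      and du: "\<And>i. has_hderiv e i u (\<lambda>p. g p $ i)"
      using u by (auto simp: horiz_C1_def)
    let ?F = "\<lambda>p. abs_powr q (u p)" and ?dF = "\<lambda>i p. abs_powr' q (u p) * g p $ i"
    let ?Z = "\<lambda>i p. hY e p i * hW e k R p"
    let ?dZ = "\<lambda>i p. hdY e p i * hW e k R p + hY e p i * hdW e k R i p"
    let ?v = "\<lambda>p. cut_gibbs e k R p"
    have F: "?F p = \<bar>u p\<bar> powr q" for p using q by (simp add: abs_powr_eq)
    have out: "outer_cut R (hP e p) = 0" "hW e k R p = 0" "hdW e k R i p = 0" if "norm p > 2 * R + 2" for p i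
    proof -
      have "R \<le> hP e p" using norm_le_of_hP[of e p R] that by (meson linorder_not_less nle_le)
      then show "outer_cut R (hP e p) = 0" "hW e k R p = 0" "hdW e k R i p = 0"
        using outer_cut_eq_0[OF R] by (simp_all add: hW_def hdW_def)
    qed
    have cF: "continuous_on UNIV ?F" using q cu by (intro continuous_on_abs_powr) auto
    have cdF: "continuous_on UNIV (?dF i)" for i
      using q cu cg by (intro continuous_intros continuous_on_abs_powr') auto
    have cZ: "continuous_on UNIV (?Z i)" for i
      by (intro continuous_intros continuous_hW R)
    have cdZ: "continuous_on UNIV (?dZ i)" for i
      by (intro continuous_intros continuous_hW continuous_hdW R)
    have dZ: "has_hderiv e i (?Z i) (?dZ i)" for i
      by (rule has_hderiv_mult[OF hderiv_Y has_hderiv_W[OF R]])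
    let ?X = "\<lambda>i p. ?dF i p * ?Z i p + ?F p * ?dZ i p"
    have dX: "has_hderiv e i (\<lambda>p. ?F p * ?Z i p) (?X i)" for i
      using q by (intro has_hderiv_mult has_hderiv_abs_powr du dZ) auto
    have cX: "continuous_on UNIV (?X i)" for i
      by (intro continuous_on_add continuous_on_mult cF cdF cZ cdZ)
    have X0: "(\<integral>p. ?X i p \<partial>lborel) = 0" for i
      by (rule integral_hderiv_eq_0[OF dX _ cX, where \<rho> = "2 * R + 2"])
         (auto intro!: continuous_on_mult cF cZ simp: out)
    have iX: "integrable lborel (?X i)" for i
      by (rule integrable_continuous_bounded_support[OF cX, where \<rho> = "2 * R + 2"]) (simp add: out)
    have sX0: "(\<integral>p. (\<Sum>i\<in>UNIV. ?X i p) \<partial>lborel) = 0"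
      using iX X0 by (subst Bochner_Integration.integral_sum) auto
    have isX: "integrable lborel (\<lambda>p. \<Sum>i\<in>UNIV. ?X i p)"
      using iX by (intro Bochner_Integration.integrable_sum) auto
    have v: "0 \<le> ?v p" "?v p \<le> 1" for p
      using outer_cut_le_1[OF R hP_nonneg, of e p] gibbs_le_1[of e k p] by (auto intro: mult_le_one)
    have icut: "integrable lborel (\<lambda>p. outer_cut R (hP e p) * f p * gibbs e k p)"
      if "continuous_on UNIV f" for f :: "'n heis \<Rightarrow> real"
    proof (rule integrable_bounded_mult)
      show "integrable lborel (\<lambda>p. outer_cut R (hP e p) * f p)"
        by (rule integrable_continuous_bounded_support[where \<rho> = "2 * R + 2"])
           (auto intro!: continuous_intros continuous_on_compose2[OF continuous_on_outer_cut[OF R, of UNIV]] that simp: out)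
    qed (auto simp: gibbs_le_1)
    have ivF: "integrable lborel (\<lambda>p. ?v p * ?F p)"
      using icut[OF cF] by (simp add: mult_ac)
    have ivg: "integrable lborel (\<lambda>p. ?v p * norm (g p) powr q)"
    proof -
      have "continuous_on UNIV (\<lambda>p. norm (g p) powr q)"
        using q cg by (intro continuous_on_powr' continuous_intros) auto
      from icut[OF this] show ?thesis by (simp add: mult_ac)
    qed
    have iC: "integrable lborel (\<lambda>p. C * (?F p * indicator (cball 0 \<rho>) p))"
      using borel_integrable_compact[OF compact_cball continuous_on_subset[OF cF subset_UNIV]]
      by (intro integrable_mult_right) (simp add: mult.commute)
    \<comment> \<open>The pointwise inequality: lower bound for the divergence against Young's inequality for \<open>Y \<cdot> g\<close>.\<close>
    have pw: "?v p * ?F p - C * (?F p * indicator (cball 0 \<rho>) p) \<le> (\<Sum>i\<in>UNIV. ?X i p) + ?v p * norm (g p) powr q" for p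
    proof -
      define Y :: "real ^ ('n + 'n)" where "Y = (\<chi> i. hY e p i)"
      have nY: "(norm Y)\<^sup>2 \<le> 8 * (hP e p)\<^sup>2 * hB e p"
        using hY_norm[of e p] by (simp add: Y_def norm_vec_def L2_set_def sum_nonneg)
      have "\<bar>abs_powr' q (u p) * (Y \<bullet> g p)\<bar> \<le> q * \<bar>u p\<bar> powr (q - 1) * norm Y * norm (g p)"
        using q abs_abs_powr'[of q "u p"] mult_left_mono[OF Cauchy_Schwarz_ineq2[of Y "g p"], of "q * \<bar>u p\<bar> powr (q - 1)"]
        by (simp add: abs_mult mult.assoc)
      also have "\<dots> \<le> (q - 1) * \<bar>u p\<bar> powr q * (1 + 8 * (hP e p)\<^sup>2 * hB e p) + norm (g p) powr q"
        by (rule young_field[OF q _ nY]) auto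
      finally have Yg: "- (abs_powr' q (u p) * (Y \<bullet> g p)) \<le> (q - 1) * ?F p * (1 + 8 * (hP e p)\<^sup>2 * hB e p) + norm (g p) powr q"
        unfolding F by linarith
      have W: "0 \<le> hW e k R p" "hW e k R p \<le> ?v p"
        using inner_cut_bounds[of "hP e p"] v[of p] by (auto simp: hW_def mult.assoc intro: mult_left_le_one_le)
      have sum: "(\<Sum>i\<in>UNIV. ?X i p) = hW e k R p * (abs_powr' q (u p) * (Y \<bullet> g p)) + ?F p * (\<Sum>i\<in>UNIV. ?dZ i p)"
      proof -
        have 1: "(\<Sum>i\<in>UNIV. ?dF i p * ?Z i p) = hW e k R p * (abs_powr' q (u p) * (Y \<bullet> g p))"
          by (simp add: Y_def inner_vec_def sum_distrib_left mult_ac)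
        have 2: "?F p * (\<Sum>i\<in>UNIV. ?dZ i p) = (\<Sum>i\<in>UNIV. ?F p * ?dZ i p)"
          by (rule sum_distrib_left)
        show ?thesis unfolding 1[symmetric] 2 by (rule sum.distrib)
      qed
      have F0: "?F p \<ge> 0" unfolding F by simp
      let ?Q = "(q - 1) * (1 + 8 * (hP e p)\<^sup>2 * hB e p)"
      have "hW e k R p * - (abs_powr' q (u p) * (Y \<bullet> g p)) \<le> hW e k R p * (?F p * ?Q + norm (g p) powr q)"
        using Yg W(1) by (intro mult_left_mono) (auto simp: algebra_simps)
      moreover have "hW e k R p * norm (g p) powr q \<le> ?v p * norm (g p) powr q"
        by (rule mult_right_mono[OF W(2)]) simp
      moreover have "?v p * (1 - (if hP e p \<le> P1 then C else 0))
        \<le> ?v p * (inner_cut (hP e p) * (drift_div e p + drift_gain e k p * (hr e p * hB e p) - ?Q)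
            - 4 * (hB e p)\<^sup>2 * hP e p * inner_cut' (hP e p))"
        by (rule mult_left_mono[OF low v(1)])
      then have "?v p * (1 - (if hP e p \<le> P1 then C else 0)) + hW e k R p * ?Q
        \<le> ?v p * (inner_cut (hP e p) * (drift_div e p + drift_gain e k p * (hr e p * hB e p))
            - 4 * (hB e p)\<^sup>2 * hP e p * inner_cut' (hP e p))"
        by (simp add: hW_def algebra_simps)
      then have "?v p * (1 - (if hP e p \<le> P1 then C else 0)) + hW e k R p * ?Q \<le> (\<Sum>i\<in>UNIV. ?dZ i p)"
        using weighted_div_lower[OF R, of k e p] k n by simp
      then have "?F p * (?v p * (1 - (if hP e p \<le> P1 then C else 0)) + hW e k R p * ?Q) \<le> ?F p * (\<Sum>i\<in>UNIV. ?dZ i p)"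
        by (rule mult_left_mono[OF _ F0])
      ultimately have main: "?F p * (?v p * (1 - (if hP e p \<le> P1 then C else 0))) \<le> (\<Sum>i\<in>UNIV. ?X i p) + ?v p * norm (g p) powr q"
        unfolding sum by (simp add: algebra_simps)
      have "?v p * (if hP e p \<le> P1 then C else 0) \<le> 1 * (C * indicator (cball 0 \<rho>) p)"
        using v[of p] C ball[of p] by (intro mult_mono) (auto simp: indicator_def)
      then have "?F p * (?v p * (if hP e p \<le> P1 then C else 0)) \<le> ?F p * (C * indicator (cball 0 \<rho>) p)"
        by (intro mult_left_mono[OF _ F0]) simp
      with main show ?thesis by (simp add: algebra_simps)
    qed
    have "(\<integral>p. ?v p * ?F p \<partial>lborel) - (\<integral>p. C * (?F p * indicator (cball 0 \<rho>) p) \<partial>lborel)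
      = (\<integral>p. ?v p * ?F p - C * (?F p * indicator (cball 0 \<rho>) p) \<partial>lborel)"
      by (rule Bochner_Integration.integral_diff[symmetric, OF ivF iC])
    also have "\<dots> \<le> (\<integral>p. (\<Sum>i\<in>UNIV. ?X i p) + ?v p * norm (g p) powr q \<partial>lborel)"
      by (intro integral_mono Bochner_Integration.integrable_diff Bochner_Integration.integrable_add ivF iC isX ivg pw)
    also have "\<dots> = (\<integral>p. ?v p * norm (g p) powr q \<partial>lborel)"
      using sX0 by (subst Bochner_Integration.integral_add[OF isX ivg]) simp
    finally have main: "(\<integral>p. ?v p * ?F p \<partial>lborel)
      \<le> (\<integral>p. C * (?F p * indicator (cball 0 \<rho>) p) \<partial>lborel) + (\<integral>p. ?v p * norm (g p) powr q \<partial>lborel)"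
      by simp
    have nn: "0 \<le> (\<integral>p. C * (?F p * indicator (cball 0 \<rho>) p) \<partial>lborel)"
      "0 \<le> (\<integral>p. ?v p * norm (g p) powr q \<partial>lborel)"
      by (intro Bochner_Integration.integral_nonneg; simp add: F C)+
    have "(\<integral>\<^sup>+p. ennreal (?v p * ?F p) \<partial>lborel) = ennreal (\<integral>p. ?v p * ?F p \<partial>lborel)"
      by (rule nn_integral_eq_integral[OF ivF]) (simp add: F)
    also have "\<dots> \<le> ennreal (\<integral>p. C * (?F p * indicator (cball 0 \<rho>) p) \<partial>lborel)
        + ennreal (\<integral>p. ?v p * norm (g p) powr q \<partial>lborel)"
      unfolding ennreal_plus[OF nn, symmetric] by (rule ennreal_leI[OF main])
    also have "ennreal (\<integral>p. C * (?F p * indicator (cball 0 \<rho>) p) \<partial>lborel)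
        = (\<integral>\<^sup>+p. ennreal (C * (?F p * indicator (cball 0 \<rho>) p)) \<partial>lborel)"
      using C by (intro nn_integral_eq_integral[symmetric] iC) (simp add: F)
    also have "\<dots> = (\<integral>\<^sup>+p. ennreal C * (ennreal (\<bar>u p\<bar> powr q) * indicator (cball 0 \<rho>) p) \<partial>lborel)"
      using C by (intro nn_integral_cong) (simp add: F ennreal_mult ennreal_indicator)
    also have "\<dots> = ennreal C * (\<integral>\<^sup>+p. ennreal (\<bar>u p\<bar> powr q) * indicator (cball 0 \<rho>) p \<partial>lborel)"
      by (rule nn_integral_cmult) measurable
    also have "ennreal (\<integral>p. ?v p * norm (g p) powr q \<partial>lborel) = (\<integral>\<^sup>+p. ennreal (?v p * norm (g p) powr q) \<partial>lborel)"
      by (rule nn_integral_eq_integral[symmetric, OF ivg]) simp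
    finally show ?thesis unfolding F .
  qed
  then show ?thesis using C by (intro exI[of _ C] conjI exI[of _ \<rho>]) (auto simp: \<rho>_def)
qed

section \<open>Smooth approximate units\<close>

lemma Cm_SucI:
  assumes "\<And>p. (\<phi> has_derivative D p) (at p)" "\<And>v. Cm m (\<lambda>p. D p v)"
  shows "Cm (Suc m) \<phi>"
proof -
  have "frechet_derivative \<phi> (at p) = D p" for p
    using frechet_derivative_at[OF assms(1)] by simp
  then show ?thesis
    using assms by (auto simp: differentiable_on_def differentiable_def intro: has_derivative_at_withinI)
qed

lemma Cm_SucD:
  assumes "Cm (Suc m) \<phi>"
  shows "(\<phi> has_derivative frechet_derivative \<phi> (at p)) (at p)"
    and "Cm m (\<lambda>p. frechet_derivative \<phi> (at p) v)"
  using assms by (auto simp: differentiable_on_def frechet_derivative_works[symmetric])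

lemma Cm_down: "Cm (Suc m) \<phi> \<Longrightarrow> Cm m \<phi>"
proof (induction m arbitrary: \<phi>)
  case 0
  then show ?case by (simp add: differentiable_imp_continuous_on)
next
  case (Suc m)
  show ?case
    by (rule Cm_SucI[OF Cm_SucD(1)[OF Suc.prems]]) (rule Suc.IH[OF Cm_SucD(2)[OF Suc.prems]])
qed

lemma Cm_const: "Cm m (\<lambda>_. c)"
proof (induction m arbitrary: c)
  case (Suc m)
  show ?case by (rule Cm_SucI[OF has_derivative_const Suc])
qed simp

lemma Cm_add: "Cm m f \<Longrightarrow> Cm m g \<Longrightarrow> Cm m (\<lambda>p. f p + g p)"
proof (induction m arbitrary: f g)
  case 0
  then show ?case by (simp add: continuous_on_add)
next
  case (Suc m)
  show ?case
    by (rule Cm_SucI[OF has_derivative_add[OF Cm_SucD(1)[OF Suc.prems(1)] Cm_SucD(1)[OF Suc.prems(2)]]])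
       (intro Suc.IH Cm_SucD(2) Suc.prems)
qed

lemma Cm_mult: "Cm m f \<Longrightarrow> Cm m g \<Longrightarrow> Cm m (\<lambda>p. f p * g p)"
proof (induction m arbitrary: f g)
  case 0
  then show ?case by (simp add: continuous_on_mult)
next
  case (Suc m)
  show ?case
    by (rule Cm_SucI[OF has_derivative_mult[OF Cm_SucD(1)[OF Suc.prems(1)] Cm_SucD(1)[OF Suc.prems(2)]]])
       (intro Cm_add Suc.IH Cm_SucD(2) Suc.prems Cm_down[OF Suc.prems(1)] Cm_down[OF Suc.prems(2)])
qed

lemma Cm_bounded_linear: "bounded_linear f \<Longrightarrow> Cm m f"
proof (cases m)
  case (Suc k)
  assume "bounded_linear f"
  then show ?thesis unfolding Suc
    by (intro Cm_SucI[OF bounded_linear_imp_has_derivative] Cm_const)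
qed (simp add: linear_continuous_on)

lemma Cm_inner_self: "Cm m (\<lambda>p :: 'a::euclidean_space. p \<bullet> p)"
proof (cases m)
  case (Suc k)
  have "((\<lambda>p. p \<bullet> p) has_derivative (\<lambda>v. p \<bullet> v + v \<bullet> p)) (at p)" for p :: 'a
    by (intro derivative_intros has_derivative_ident)
  then show ?thesis unfolding Suc
    by (rule Cm_SucI) (intro Cm_add Cm_bounded_linear bounded_linear_inner_left bounded_linear_inner_right)
qed (simp add: continuous_intros)

text \<open>Needed because \<open>h \<mapsto> p \<circ> h\<^sup>-\<^sup>1\<close> is affine for fixed \<open>p\<close>: a translated and reflected test function is again a
  test function.\<close>

lemma Cm_affine:
  assumes "bounded_linear T"
  shows "Cm m \<phi> \<Longrightarrow> Cm m (\<lambda>h. \<phi> (c + T h))"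
proof (induction m arbitrary: \<phi>)
  case 0
  have "continuous_on UNIV (\<lambda>h. c + T h)"
    by (intro continuous_intros linear_continuous_on assms)
  then show ?case using 0 by (auto intro: continuous_on_compose2)
next
  case (Suc m)
  have "((\<lambda>h. c + T h) has_derivative T) (at h)" for h
    using has_derivative_add[OF has_derivative_const bounded_linear_imp_has_derivative[OF assms]] by simp
  then have "((\<lambda>h. \<phi> (c + T h)) has_derivative (\<lambda>v. frechet_derivative \<phi> (at (c + T h)) (T v))) (at h)" for h
    by (rule has_derivative_compose[OF _ Cm_SucD(1)[OF Suc.prems]])
  then show ?case
    by (rule Cm_SucI) (rule Suc.IH[OF Cm_SucD(2)[OF Suc.prems]])
qed

text \<open>The family is closed under differentiation up to linear combinations, so all of its members can
  be shown to be smooth in one induction.\<close>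

definition flat :: "nat \<Rightarrow> real \<Rightarrow> real" where
  "flat j x = (if x > 0 then exp (- 1 / x) / x ^ j else 0)"

text \<open>The estimate \<open>(1 + y / m)\<^sup>m \<le> exp y\<close> with \<open>y = 1 / h\<close> and \<open>m = j + 1\<close>.\<close>

lemma flat_bound:
  assumes "h > 0"
  shows "flat j h \<le> real (Suc j) ^ Suc j * h"
proof -
  let ?n = "real (Suc j)"
  have "1 / h / ?n = 1 / (?n * h)" by (simp add: mult.commute)
  moreover have "0 \<le> 1 / (?n * h)" using assms by simp
  ultimately have "1 / (?n * h) \<le> 1 + (1 / h) / ?n" by linarith
  then have "(1 / (?n * h)) ^ Suc j \<le> (1 + (1 / h) / ?n) ^ Suc j"
    using assms by (intro power_mono) auto
  also have "\<dots> \<le> exp (1 / h)"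
    by (rule exp_ge_one_plus_x_over_n_power_n) (use assms in \<open>auto intro: order.trans[of _ 0]\<close>)
  finally have "inverse (exp (1 / h)) \<le> inverse ((1 / (?n * h)) ^ Suc j)"
    by (rule le_imp_inverse_le) (use assms in \<open>simp del: of_nat_Suc\<close>)
  then have "exp (- (1 / h)) \<le> (?n * h) ^ Suc j"
    by (simp add: exp_minus power_one_over del: of_nat_Suc power_Suc)
  then have "exp (- 1 / h) / h ^ j \<le> (?n * h) ^ Suc j / h ^ j"
    using assms by (intro divide_right_mono) auto
  also have "\<dots> = ?n ^ Suc j * h"
    using assms by (simp add: power_mult_distrib)
  finally show ?thesis using assms by (simp add: flat_def)
qed

lemma flat_nonneg: "0 \<le> flat j x"
  by (simp add: flat_def)

lemma DERIV_flat: "(flat j has_real_derivative - real j * flat (Suc j) x + flat (Suc (Suc j)) x) (at x)"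
proof -
  consider "x > 0" | "x < 0" | "x = 0" by linarith
  then show ?thesis
  proof cases
    case 1
    have "((\<lambda>x. exp (- 1 / x) / x ^ j) has_real_derivative
        (exp (- 1 / x) * (1 / x\<^sup>2) * x ^ j - exp (- 1 / x) * (real j * x ^ (j - 1))) / (x ^ j * x ^ j)) (at x)"
      using 1 by (auto intro!: derivative_eq_intros simp: power2_eq_square)
    also have "(exp (- 1 / x) * (1 / x\<^sup>2) * x ^ j - exp (- 1 / x) * (real j * x ^ (j - 1))) / (x ^ j * x ^ j)
       = - real j * flat (Suc j) x + flat (Suc (Suc j)) x"
      using 1 by (cases j) (auto simp: flat_def field_simps power2_eq_square)
    finally have "((\<lambda>x. exp (- 1 / x) / x ^ j) has_real_derivative - real j * flat (Suc j) x + flat (Suc (Suc j)) x) (at x)" .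
    then show ?thesis
      by (rule has_field_derivative_transform_within_open[where S = "{0<..}"]) (use 1 in \<open>auto simp: flat_def\<close>)
  next
    case 2
    have "((\<lambda>x. 0) has_real_derivative 0) (at x)" by simp
    then have "(flat j has_real_derivative 0) (at x)"
      by (rule has_field_derivative_transform_within_open[where S = "{..<0}"]) (use 2 in \<open>auto simp: flat_def\<close>)
    then show ?thesis using 2 by (simp add: flat_def)
  next
    case 3
    have "(\<lambda>h. flat j h / h) \<midarrow>0\<rightarrow> 0"
    proof (rule Lim_null_comparison)
      show "\<forall>\<^sub>F h in at 0. norm (flat j h / h) \<le> real (Suc (Suc j)) ^ Suc (Suc j) * \<bar>h\<bar>"
      proof (rule always_eventually, intro allI)
        fix h :: real
        show "norm (flat j h / h) \<le> real (Suc (Suc j)) ^ Suc (Suc j) * \<bar>h\<bar>"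
        proof (cases "h > 0")
          case True
          then have "norm (flat j h / h) = flat (Suc j) h" by (simp add: flat_def mult.commute)
          then show ?thesis using flat_bound[OF True, of "Suc j"] True by simp
        next
          case False
          then have "norm (flat j h / h) = 0" by (simp add: flat_def)
          moreover have "0 \<le> real (Suc (Suc j)) ^ Suc (Suc j) * \<bar>h\<bar>" by (intro mult_nonneg_nonneg) auto
          ultimately show ?thesis by linarith
        qed
      qed
      show "(\<lambda>h. real (Suc (Suc j)) ^ Suc (Suc j) * \<bar>h\<bar>) \<midarrow>0\<rightarrow> 0"
        by (auto intro!: tendsto_eq_intros)
    qed
    then show ?thesis using 3 by (simp add: DERIV_def flat_def[of _ 0] flat_def[of "Suc _" 0])
  qed
qed

text \<open>The derivative of \<open>flat j (\<phi> p)\<close> involves only \<open>flat (j + 1)\<close>, \<open>flat (j + 2)\<close> and derivatives of \<open>\<phi>\<close>; hence the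
  induction on \<open>m\<close> for all \<open>j\<close> together.\<close>

lemma Cm_flat:
  assumes "\<And>m. Cm m \<phi>"
  shows "Cm m (\<lambda>p. flat j (\<phi> p))"
proof (induction m arbitrary: j)
  case 0
  have "continuous_on UNIV (flat j)"
    by (rule continuous_at_imp_continuous_on) (use DERIV_flat DERIV_isCont in blast)
  then show ?case
    using assms[of 0] by (auto intro: continuous_on_compose2)
next
  case (Suc m)
  have "((\<lambda>p. flat j (\<phi> p)) has_derivative
     (\<lambda>v. (- real j * flat (Suc j) (\<phi> p) + flat (Suc (Suc j)) (\<phi> p)) * frechet_derivative \<phi> (at p) v)) (at p)" for p
    using has_derivative_compose[OF Cm_SucD(1)[OF assms[of "Suc 0"]], of "flat j"] DERIV_flat
    unfolding has_field_derivative_def by blast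
  then show ?case
    by (rule Cm_SucI) (intro Cm_mult Cm_add Cm_const Suc.IH Cm_SucD(2) assms)
qed

lemma compact_support_of_bounded:
  fixes \<phi> :: "'a::euclidean_space \<Rightarrow> real"
  assumes "\<And>p. norm p > r \<Longrightarrow> \<phi> p = 0"
  shows "compact (closure {p. \<phi> p \<noteq> 0})"
proof -
  have "{p. \<phi> p \<noteq> 0} \<subseteq> cball 0 r" using assms by (auto simp: not_less[symmetric])
  then show ?thesis by (meson bounded_cball bounded_subset compact_closure)
qed

definition approx_unit :: "real \<Rightarrow> ('a::euclidean_space \<Rightarrow> real) \<Rightarrow> bool" where
  "approx_unit \<epsilon> \<phi> \<longleftrightarrow> (\<forall>m. Cm m \<phi>) \<and> (\<forall>p. 0 \<le> \<phi> p) \<and> (\<forall>p. norm p > \<epsilon> \<longrightarrow> \<phi> p = 0) \<and>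
     (\<integral>p. \<phi> p \<partial>lborel) = 1"

text \<open>The classical bump \<open>exp (- 1 / (1 - \<bar>p\<bar>\<^sup>2 / \<epsilon>\<^sup>2))\<close>, normalised.\<close>

lemma approx_unit_exists:
  assumes \<epsilon>: "\<epsilon> > 0"
  shows "\<exists>\<phi> :: 'a::euclidean_space \<Rightarrow> real. approx_unit \<epsilon> \<phi>"
proof -
  define b :: "'a \<Rightarrow> real" where "b p = flat 0 (1 + (- 1 / \<epsilon>\<^sup>2) * (p \<bullet> p))" for p
  have Cb: "Cm m b" for m
    unfolding b_def by (intro Cm_flat Cm_add Cm_mult Cm_const Cm_inner_self)
  have b0: "b p \<ge> 0" for p by (simp add: b_def flat_nonneg)
  have bz: "b p = 0" if "norm p > \<epsilon>" for p
  proof -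
    have "\<epsilon>\<^sup>2 \<le> p \<bullet> p" using that \<epsilon> by (simp add: power2_norm_eq_inner[symmetric] power_mono)
    then show ?thesis using \<epsilon> by (simp add: b_def flat_def field_simps)
  qed
  have cb: "continuous_on UNIV b" using Cb[of 0] by simp
  have ib: "integrable lborel b"
    by (rule integrable_continuous_bounded_support[OF cb bz])
  have "(\<integral>p. b p \<partial>lborel) \<noteq> 0"
  proof
    assume "(\<integral>p. b p \<partial>lborel) = 0"
    then have "AE p in lborel. b p = 0"
      using integral_nonneg_eq_0_iff_AE[OF ib] b0 by simp
    moreover have "b p \<noteq> 0" if "p \<in> ball 0 \<epsilon>" for p
    proof -
      have "p \<bullet> p < \<epsilon>\<^sup>2" using that \<epsilon> by (simp add: power2_norm_eq_inner[symmetric] power_strict_mono)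
      then show ?thesis using \<epsilon> by (simp add: b_def flat_def field_simps)
    qed
    ultimately have "AE p in lborel. p \<notin> ball (0::'a) \<epsilon>"
      by (auto elim: eventually_mono)
    then have "ball (0::'a) \<epsilon> \<in> null_sets lborel"
      using AE_iff_null_sets[of "ball (0::'a) \<epsilon>" lborel] by simp
    then show False
      using \<epsilon> content_ball_pos[of \<epsilon> "0::'a"] by (simp add: null_sets_def measure_def)
  qed
  then have pos: "(\<integral>p. b p \<partial>lborel) > 0"
    using Bochner_Integration.integral_nonneg[of lborel b] b0 by (simp add: order.order_iff_strict)
  define \<phi> where "\<phi> p = (1 / (\<integral>p. b p \<partial>lborel)) * b p" for p
  have "Cm m \<phi>" for m
    unfolding \<phi>_def by (intro Cm_mult Cm_const Cb)
  moreover have nn: "0 \<le> \<phi> p" "norm p > \<epsilon> \<Longrightarrow> \<phi> p = 0" for p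
    using pos b0 bz by (simp_all add: \<phi>_def)
  moreover have "(\<integral>p. \<phi> p \<partial>lborel) = 1"
    unfolding \<phi>_def using pos by simp
  ultimately have "approx_unit \<epsilon> \<phi>"
    unfolding approx_unit_def using nn by auto
  then show ?thesis by blast
qed

text \<open>Gives the dominating function for differentiation under the integral sign.\<close>

lemma Cm1_compact_support_lipschitz:
  fixes \<phi> :: "'a::euclidean_space \<Rightarrow> real"
  assumes C: "Cm (Suc 0) \<phi>" and z: "\<And>p. norm p > r \<Longrightarrow> \<phi> p = 0"
  shows "\<exists>L\<ge>0. \<forall>x y. \<bar>\<phi> x - \<phi> y\<bar> \<le> L * norm (x - y)"
proof -
  let ?D = "\<lambda>p. frechet_derivative \<phi> (at p)"
  have D: "(\<phi> has_derivative ?D p) (at p)" for p by (rule Cm_SucD(1)[OF C])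
  have cont: "continuous_on UNIV (\<lambda>p. ?D p v)" for v using Cm_SucD(2)[OF C] by simp
  have out: "?D p v = 0" if "norm p > r" for p v
  proof -
    have "(\<phi> has_derivative (\<lambda>_. 0)) (at p)"
      by (rule has_derivative_transform_within_open[OF has_derivative_const[of 0]
            open_Compl[OF closed_cball[of 0 r]]]) (use that z in auto)
    then show ?thesis using frechet_derivative_at by metis
  qed
  have "\<exists>K. \<forall>p. \<bar>?D p v\<bar> \<le> K" for v
  proof -
    have "bounded ((\<lambda>p. ?D p v) ` cball 0 r)"
      by (intro compact_imp_bounded compact_continuous_image continuous_on_subset[OF cont]) auto
    then obtain K where K: "\<forall>p\<in>cball 0 r. \<bar>?D p v\<bar> \<le> K" by (auto simp: bounded_iff)
    have "\<bar>?D p v\<bar> \<le> max 0 K" for p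
      using K out[of p v] by (cases "norm p > r") (auto simp: le_max_iff_disj)
    then show ?thesis by blast
  qed
  then obtain K where K: "\<And>v p. \<bar>?D p v\<bar> \<le> K v" by metis
  define L where "L = (\<Sum>b\<in>Basis. \<bar>K b\<bar>)"
  have on: "onorm (?D p) \<le> L" for p
  proof (rule onorm_le)
    fix v
    interpret bl: bounded_linear "?D p" using D has_derivative_bounded_linear by blast
    have "norm (?D p v) = norm (\<Sum>b\<in>Basis. (v \<bullet> b) * ?D p b)"
      by (subst euclidean_representation[of v, symmetric]) (simp add: bl.sum bl.scaleR)
    also have "\<dots> \<le> (\<Sum>b\<in>Basis. norm v * \<bar>K b\<bar>)"
    proof (rule sum_norm_le)
      fix b :: 'a assume "b \<in> Basis"
      then show "norm ((v \<bullet> b) * ?D p b) \<le> norm v * \<bar>K b\<bar>"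
        using K[of p b] by (auto simp: abs_mult intro!: mult_mono Basis_le_norm)
    qed
    also have "\<dots> = L * norm v" by (simp add: L_def sum_distrib_left[symmetric] mult.commute)
    finally show "norm (?D p v) \<le> L * norm v" .
  qed
  have "\<bar>\<phi> x - \<phi> y\<bar> \<le> L * norm (x - y)" for x y
    using differentiable_bound[of UNIV \<phi> ?D L x y] D on by auto
  moreover have "L \<ge> 0" by (simp add: L_def sum_nonneg)
  ultimately show ?thesis by blast
qed

lemma Xfield_eq:
  "Xfield e i \<phi> p = frechet_derivative \<phi> (at p) (axis i 1, 0) + hdt e p i * frechet_derivative \<phi> (at p) (0, 1)"
  by (cases p; cases i) (auto simp: ddx_def ddt_def hdt_def hJ_def)

lemma continuous_Xfield:
  assumes "Cm (Suc 0) \<phi>"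
  shows "continuous_on UNIV (Xfield e i \<phi>)"
proof -
  have "continuous_on UNIV (\<lambda>p. frechet_derivative \<phi> (at p) v)" for v
    using Cm_SucD(2)[OF assms] by simp
  then show ?thesis
    unfolding Xfield_eq[abs_def] by (intro continuous_intros)
qed

section \<open>Convolution on the group\<close>

lemma approx_unitD:
  assumes "approx_unit \<epsilon> \<phi>"
  shows "Cm m \<phi>" "0 \<le> \<phi> p" "norm p > \<epsilon> \<Longrightarrow> \<phi> p = 0" "(\<integral>p. \<phi> p \<partial>lborel) = 1"
  using assms by (auto simp: approx_unit_def)

lemma approx_unit_continuous: "approx_unit \<epsilon> \<phi> \<Longrightarrow> continuous_on UNIV \<phi>"
  using approx_unitD(1)[of \<epsilon> \<phi> 0] by simp

lemma approx_unit_measurable [measurable_dest]: "approx_unit \<epsilon> \<phi> \<Longrightarrow> \<phi> \<in> borel_measurable borel"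
  by (intro borel_measurable_continuous_onI approx_unit_continuous)

lemma approx_unit_integrable: "approx_unit \<epsilon> \<phi> \<Longrightarrow> integrable lborel \<phi>"
  by (rule integrable_continuous_bounded_support[OF approx_unit_continuous approx_unitD(3)])

lemma approx_unit_bounded:
  assumes "approx_unit \<epsilon> \<phi>"
  shows "\<exists>M\<ge>0. \<forall>p. \<phi> p \<le> M"
proof -
  have "bounded (\<phi> ` cball 0 \<epsilon>)"
    by (intro compact_imp_bounded compact_continuous_image
        continuous_on_subset[OF approx_unit_continuous[OF assms]]) auto
  then obtain M where M: "\<forall>p\<in>cball 0 \<epsilon>. \<bar>\<phi> p\<bar> \<le> M" by (auto simp: bounded_iff)
  have "\<phi> p \<le> \<bar>M\<bar>" for p
  proof (cases "norm p \<le> \<epsilon>")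
    case True
    then have "\<bar>\<phi> p\<bar> \<le> M" using M by simp
    then show ?thesis by linarith
  qed (use approx_unitD(3)[OF assms, of p] in auto)
  then show ?thesis by (intro exI[of _ "\<bar>M\<bar>"]) auto
qed

lemma approx_unit_prob: "approx_unit \<epsilon> \<phi> \<Longrightarrow> prob_space (density lborel (\<lambda>p. ennreal (\<phi> p)))"
proof (rule prob_spaceI)
  assume a: "approx_unit \<epsilon> \<phi>"
  note [measurable] = approx_unit_measurable[OF a]
  have "emeasure (density lborel (\<lambda>p. ennreal (\<phi> p))) (space (density lborel (\<lambda>p. ennreal (\<phi> p))))
      = (\<integral>\<^sup>+p. ennreal (\<phi> p) \<partial>lborel)"
    by (subst emeasure_density) auto
  also have "\<dots> = ennreal 1"
    unfolding approx_unitD(4)[OF a, symmetric]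
    by (rule nn_integral_eq_integral[OF approx_unit_integrable[OF a]]) (simp add: approx_unitD(2)[OF a])
  finally show "emeasure (density lborel (\<lambda>p. ennreal (\<phi> p))) (space (density lborel (\<lambda>p. ennreal (\<phi> p)))) = 1"
    by simp
qed

text \<open>For \<open>p\<close> in a ball the function \<open>h \<mapsto> \<phi> (p \<circ> h\<^sup>-\<^sup>1)\<close> is supported in a fixed ball, because
  \<open>h = g\<^sup>-\<^sup>1 \<circ> p\<close> with \<open>g = p \<circ> h\<^sup>-\<^sup>1\<close> small.\<close>

lemma approx_unit_translate_support:
  assumes "approx_unit \<epsilon> \<phi>"
  shows "\<exists>\<rho>'. \<forall>p h. norm p \<le> \<rho> \<longrightarrow> norm h > \<rho>' \<longrightarrow> \<phi> (heis_mult e p (- h)) = 0"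
proof -
  obtain \<rho>' where \<rho>': "\<And>g p. norm g \<le> \<epsilon> \<Longrightarrow> norm p \<le> \<rho> \<Longrightarrow> norm (heis_mult e g p) \<le> \<rho>'"
    using heis_mult_bounded[of \<epsilon> \<rho> e] by blast
  have "\<phi> (heis_mult e p (- h)) = 0" if "norm p \<le> \<rho>" "norm h > \<rho>'" for p h
  proof (rule approx_unitD(3)[OF assms], rule ccontr)
    assume "\<not> norm (heis_mult e p (- h)) > \<epsilon>"
    then have "norm (heis_mult e (- heis_mult e p (- h)) p) \<le> \<rho>'"
      using that by (intro \<rho>') auto
    then show False using that by (simp add: heis_minus_mult)
  qed
  then show ?thesis by blast
qed

definition loc_int :: "('n::finite heis \<Rightarrow> 'b::{banach, second_countable_topology}) \<Rightarrow> bool" where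
  "loc_int f \<longleftrightarrow> f \<in> borel_measurable borel \<and>
     (\<forall>\<rho>. integrable lborel (\<lambda>h. indicator (cball 0 \<rho>) h *\<^sub>R f h))"

lemma loc_int_measurable [measurable_dest]: "loc_int f \<Longrightarrow> f \<in> borel_measurable borel"
  by (simp add: loc_int_def)

text \<open>The group convolution of \<open>\<phi>\<close> and \<open>f\<close>, an average of left translates of \<open>f\<close> (\<open>mollify_shift\<close>). Left
  translations are the ones that commute with the fields \<open>X\<^sub>i\<close>.\<close>

definition mollify :: "'n::finite \<Rightarrow> ('n heis \<Rightarrow> real) \<Rightarrow> ('n heis \<Rightarrow> 'b::{banach, second_countable_topology}) \<Rightarrow> 'n heis \<Rightarrow> 'b" where
  "mollify e \<phi> f p = (\<integral>h. \<phi> (heis_mult e p (- h)) *\<^sub>R f h \<partial>lborel)"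

lemma loc_int_bound_integrable:
  fixes f :: "'n::finite heis \<Rightarrow> 'b::{banach, second_countable_topology}"
  assumes f: "loc_int f" and [measurable]: "K \<in> borel_measurable borel"
    and K: "\<And>h. \<bar>K h\<bar> \<le> M * indicator (cball 0 \<rho>) h"
  shows "integrable lborel (\<lambda>h. K h *\<^sub>R f h)"
proof (rule Bochner_Integration.integrable_bound)
  show "integrable lborel (\<lambda>h. M *\<^sub>R (indicator (cball 0 \<rho>) h *\<^sub>R f h))"
    using f by (intro integrable_scaleR_right) (simp add: loc_int_def)
  note [measurable] = loc_int_measurable[OF f]
  show "(\<lambda>h. K h *\<^sub>R f h) \<in> borel_measurable lborel" by measurable
  show "AE h in lborel. norm (K h *\<^sub>R f h) \<le> norm (M *\<^sub>R (indicator (cball 0 \<rho>) h *\<^sub>R f h))"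
  proof (rule AE_I2)
    fix h
    have "\<bar>K h\<bar> * norm (f h) \<le> \<bar>M * indicator (cball 0 \<rho>) h\<bar> * norm (f h)"
      using K[of h] by (intro mult_right_mono) auto
    then show "norm (K h *\<^sub>R f h) \<le> norm (M *\<^sub>R (indicator (cball 0 \<rho>) h *\<^sub>R f h))"
      by (simp add: abs_mult)
  qed
qed

text \<open>Kernels that are uniformly bounded with common bounded support may be exchanged with limits
  against a locally integrable function. This serves both for continuity and for differentiability
  of the mollification.\<close>

lemma loc_int_dominated:
  fixes f :: "'n::finite heis \<Rightarrow> 'b::{banach, second_countable_topology}"
  assumes f: "loc_int f" and K: "\<And>n. K n \<in> borel_measurable borel" and k: "k \<in> borel_measurable borel"
    and dom: "\<And>n h. \<bar>K n h\<bar> \<le> M * indicator (cball 0 \<rho>) h"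
    and lim: "\<And>h. (\<lambda>n. K n h) \<longlonglongrightarrow> k h"
  shows "(\<lambda>n. \<integral>h. K n h *\<^sub>R f h \<partial>lborel) \<longlonglongrightarrow> (\<integral>h. k h *\<^sub>R f h \<partial>lborel)"
proof (rule integral_dominated_convergence)
  note [measurable] = loc_int_measurable[OF f] K k
  show "(\<lambda>h. k h *\<^sub>R f h) \<in> borel_measurable lborel" "(\<lambda>h. K n h *\<^sub>R f h) \<in> borel_measurable lborel" for n
    by measurable
  show "integrable lborel (\<lambda>h. \<bar>M\<bar> * norm (indicator (cball 0 \<rho>) h *\<^sub>R f h))"
    using f by (intro integrable_mult_right integrable_norm) (simp add: loc_int_def)
  show "AE h in lborel. (\<lambda>n. K n h *\<^sub>R f h) \<longlonglongrightarrow> k h *\<^sub>R f h"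
    using lim by (intro AE_I2 tendsto_intros)
  fix n
  show "AE h in lborel. norm (K n h *\<^sub>R f h) \<le> \<bar>M\<bar> * norm (indicator (cball 0 \<rho>) h *\<^sub>R f h)"
  proof (rule AE_I2)
    fix h
    have "\<bar>K n h\<bar> * norm (f h) \<le> (\<bar>M\<bar> * indicator (cball 0 \<rho>) h) * norm (f h)"
      using order.trans[OF dom[of n h], of "\<bar>M\<bar> * indicator (cball 0 \<rho>) h"]
      by (intro mult_right_mono) (auto simp: indicator_def split: if_splits)
    then show "norm (K n h *\<^sub>R f h) \<le> \<bar>M\<bar> * norm (indicator (cball 0 \<rho>) h *\<^sub>R f h)"
      by simp
  qed
qed

lemma mollify_integrable:
  assumes a: "approx_unit \<epsilon> \<phi>" and f: "loc_int f"
  shows "integrable lborel (\<lambda>h. \<phi> (heis_mult e p (- h)) *\<^sub>R f h)"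
proof -
  note [measurable] = approx_unit_measurable[OF a]
  obtain M where M: "M \<ge> 0" "\<And>p. \<phi> p \<le> M" using approx_unit_bounded[OF a] by blast
  obtain \<rho>' where \<rho>': "\<And>h. norm h > \<rho>' \<Longrightarrow> \<phi> (heis_mult e p (- h)) = 0"
    using approx_unit_translate_support[OF a, of "norm p" e] by blast
  show ?thesis
    by (rule loc_int_bound_integrable[OF f, where M = M and \<rho> = \<rho>'])
       (use M \<rho>' approx_unitD(2)[OF a] in \<open>auto simp: indicator_def not_le\<close>)
qed

lemma mollify_continuous:
  assumes a: "approx_unit \<epsilon> \<phi>" and f: "loc_int f"
  shows "continuous_on UNIV (mollify e \<phi> f)"
proof (rule continuous_on_sequentiallyI)
  note [measurable] = approx_unit_measurable[OF a]
  fix x :: "nat \<Rightarrow> 'a heis" and p assume lim: "x \<longlonglongrightarrow> p"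
  obtain M where M: "M \<ge> 0" "\<And>p. \<phi> p \<le> M" using approx_unit_bounded[OF a] by blast
  obtain b where b: "\<And>n. norm (x n) \<le> b"
    using convergent_imp_Bseq[OF convergentI[OF lim]] by (auto simp: Bseq_def)
  obtain \<rho>' where \<rho>': "\<And>p h. norm p \<le> b \<Longrightarrow> norm h > \<rho>' \<Longrightarrow> \<phi> (heis_mult e p (- h)) = 0"
    using approx_unit_translate_support[OF a, of b e] by blast
  have c: "continuous_on UNIV (\<lambda>q. \<phi> (heis_mult e q (- h)))" for h
    by (rule continuous_on_compose2[OF approx_unit_continuous[OF a]]) (auto intro!: continuous_intros)
  show "(\<lambda>n. mollify e \<phi> f (x n)) \<longlonglongrightarrow> mollify e \<phi> f p"
    unfolding mollify_def
  proof (rule loc_int_dominated[OF f, where M = M and \<rho> = \<rho>'])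
    show "\<bar>\<phi> (heis_mult e (x n) (- h))\<bar> \<le> M * indicator (cball 0 \<rho>') h" for n h
      using M \<rho>'[OF b, of h n] approx_unitD(2)[OF a] by (auto simp: indicator_def not_le)
    show "(\<lambda>n. \<phi> (heis_mult e (x n) (- h))) \<longlonglongrightarrow> \<phi> (heis_mult e p (- h))" for h
      by (rule continuous_on_tendsto_compose[OF c lim]) simp_all
  qed measurable
qed

lemma integral_heis_left_minus:
  fixes F :: "'n::finite heis \<Rightarrow> 'b::{banach, second_countable_topology}"
  assumes [measurable]: "F \<in> borel_measurable borel"
  shows "(\<integral>h. F (heis_mult e p (- h)) \<partial>lborel) = (\<integral>g. F g \<partial>lborel)"
    and "integrable lborel (\<lambda>h. F (heis_mult e p (- h))) \<longleftrightarrow> integrable lborel F"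
proof -
  show "(\<integral>h. F (heis_mult e p (- h)) \<partial>lborel) = (\<integral>g. F g \<partial>lborel)"
    by (subst (2) distr_heis_left_minus[of e p, symmetric]) (simp add: integral_distr)
  show "integrable lborel (\<lambda>h. F (heis_mult e p (- h))) \<longleftrightarrow> integrable lborel F"
    by (subst (2) distr_heis_left_minus[of e p, symmetric]) (simp add: integrable_distr_eq)
qed

lemma mollify_shift:
  assumes a: "approx_unit \<epsilon> \<phi>" and f: "loc_int f"
  shows "mollify e \<phi> f p = (\<integral>g. \<phi> g *\<^sub>R f (heis_mult e (- g) p) \<partial>lborel)"
    and "integrable lborel (\<lambda>g. \<phi> g *\<^sub>R f (heis_mult e (- g) p))"
proof -
  note [measurable] = approx_unit_measurable[OF a] loc_int_measurable[OF f]
  have m: "(\<lambda>g. \<phi> g *\<^sub>R f (heis_mult e (- g) p)) \<in> borel_measurable borel" by measurable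
  show "mollify e \<phi> f p = (\<integral>g. \<phi> g *\<^sub>R f (heis_mult e (- g) p) \<partial>lborel)"
    using integral_heis_left_minus(1)[OF m, of e p] by (simp add: mollify_def heis_minus_mult)
  show "integrable lborel (\<lambda>g. \<phi> g *\<^sub>R f (heis_mult e (- g) p))"
    using integral_heis_left_minus(2)[OF m, of e p] mollify_integrable[OF a f, of e p]
    by (simp add: heis_minus_mult)
qed

lemma mollify_jensen:
  assumes a: "approx_unit \<epsilon> \<phi>" and f: "loc_int f" and q: "q \<ge> 1"
  shows "ennreal (norm (mollify e \<phi> f p) powr q)
    \<le> (\<integral>\<^sup>+g. ennreal (\<phi> g) * ennreal (norm (f (heis_mult e (- g) p)) powr q) \<partial>lborel)"
proof -
  note [measurable] = approx_unit_measurable[OF a] loc_int_measurable[OF f]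
  interpret prob_space "density lborel (\<lambda>p. ennreal (\<phi> p))" by (rule approx_unit_prob[OF a])
  have m: "(\<lambda>g. f (heis_mult e (- g) p)) \<in> borel_measurable borel" by measurable
  have "integrable (density lborel (\<lambda>p. ennreal (\<phi> p))) (\<lambda>g. f (heis_mult e (- g) p))"
    using mollify_shift(2)[OF a f] approx_unitD(2)[OF a] m by (subst integrable_density) auto
  from jensen_powr[OF this q] show ?thesis
    using approx_unitD(2)[OF a] m
    by (simp add: integral_density nn_integral_density mollify_shift(1)[OF a f, symmetric])
qed

lemma mollify_component:
  assumes a: "approx_unit \<epsilon> \<phi>" and G: "loc_int G"
  shows "mollify e \<phi> G p $ i = mollify e \<phi> (\<lambda>h. G h $ i) p"
  unfolding mollify_def
  by (subst integral_bounded_linear[OF bounded_linear_vec_nth mollify_integrable[OF a G], symmetric]) simp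

text \<open>Moving \<open>p\<close> along \<open>X\<^sub>i\<close> in \<open>\<phi> (p \<circ> h\<^sup>-\<^sup>1)\<close> is the same as moving \<open>h\<close> backwards along \<open>X\<^sub>i\<close>, since
  \<open>p \<circ> hstep i s \<circ> h\<^sup>-\<^sup>1 = p \<circ> (h \<circ> hstep i (- s))\<^sup>-\<^sup>1\<close>. So the derivative of the mollification is minus the
  integral of \<open>f\<close> against \<open>X\<^sub>i \<psi>\<close> with the test function \<open>\<psi> h = \<phi> (p \<circ> h\<^sup>-\<^sup>1)\<close>, and the weak derivative
  applies directly.\<close>

lemma mollify_has_hderiv:
  fixes f g :: "'n::finite heis \<Rightarrow> real"
  assumes a: "approx_unit \<epsilon> \<phi>" and f: "loc_int f"
    and weak: "\<And>\<psi>. test_function \<psi> \<Longrightarrow>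
      (\<integral>h. f h * Xfield e i \<psi> h \<partial>lborel) = - (\<integral>h. g h * \<psi> h \<partial>lborel)"
  shows "has_hderiv e i (mollify e \<phi> f) (mollify e \<phi> g)"
  unfolding has_hderiv_def DERIV_def LIMSEQ_SEQ_conv[symmetric]
proof (intro allI impI, elim conjE)
  note [measurable] = approx_unit_measurable[OF a]
  fix p and s :: "nat \<Rightarrow> real" assume s: "\<forall>n. s n \<noteq> 0" "s \<longlonglongrightarrow> 0"
  define \<psi> where "\<psi> h = \<phi> (heis_mult e p (- h))" for h
  define T where "T h = (- fst h, - snd h - heis_form e (fst p) (fst h))" for h :: "'n heis"
  have T: "bounded_linear T"
    unfolding T_def
    by (intro bounded_linear_Pair bounded_linear_minus bounded_linear_sub bounded_linear_fst bounded_linear_snd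
        bounded_linear_compose[OF heis_form.bounded_linear_right bounded_linear_fst])
  have \<psi>T: "\<psi> = (\<lambda>h. \<phi> (p + T h))"
    by (rule ext) (simp add: \<psi>_def T_def heis_mult_eq heis_form_simps plus_prod_def algebra_simps)
  have C\<psi>: "Cm m \<psi>" for m
    unfolding \<psi>T by (rule Cm_affine[OF T approx_unitD(1)[OF a]])
  obtain \<rho>0 where "\<And>h. norm h > \<rho>0 \<Longrightarrow> \<psi> h = 0"
    unfolding \<psi>_def using approx_unit_translate_support[OF a, of "norm p" e] by blast
  then have test: "test_function \<psi>"
    unfolding test_function_def using C\<psi> compact_support_of_bounded by blast
  have X[measurable]: "Xfield e i \<psi> \<in> borel_measurable borel"
    by (intro borel_measurable_continuous_onI continuous_Xfield C\<psi>)
  obtain L where L: "L \<ge> 0" "\<And>x y. \<bar>\<phi> x - \<phi> y\<bar> \<le> L * norm (x - y)"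
    using Cm1_compact_support_lipschitz[OF approx_unitD(1)[OF a] approx_unitD(3)[OF a]] by blast
  obtain b where b: "\<And>n. \<bar>s n\<bar> \<le> b"
    using convergent_imp_Bseq[OF convergentI[OF s(2)]] by (auto simp: Bseq_def)
  obtain \<rho>1 where \<rho>1: "\<And>r. norm r \<le> b \<Longrightarrow> norm (heis_mult e p r) \<le> \<rho>1"
    using heis_mult_bounded[of "norm p" b e] by blast
  obtain \<rho>' where \<rho>': "\<And>q h. norm q \<le> max \<rho>1 (norm p) \<Longrightarrow> norm h > \<rho>' \<Longrightarrow> \<phi> (heis_mult e q (- h)) = 0"
    using approx_unit_translate_support[OF a, of "max \<rho>1 (norm p)" e] by blast
  define v where "v h = (axis i 1 :: real ^ ('n + 'n), hdt e p i - heis_form e (axis i 1) (fst h))" for h :: "'n heis"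
  have "continuous_on UNIV v"
    unfolding v_def[abs_def]
    by (intro continuous_on_Pair continuous_on_const continuous_on_diff heis_form.continuous_on
        continuous_on_fst continuous_on_id)
  then have "bounded (v ` cball 0 \<rho>')"
    by (rule compact_imp_bounded[OF compact_continuous_image[OF
          continuous_on_subset[OF _ subset_UNIV] compact_cball]])
  then obtain V where V: "\<forall>h\<in>cball 0 \<rho>'. norm (v h) \<le> V" by (auto simp: bounded_iff)
  let ?K = "\<lambda>n h. (\<phi> (heis_mult e (heis_mult e p (hstep i (s n))) (- h)) - \<phi> (heis_mult e p (- h))) / s n"
  \<comment> \<open>The moving point has constant velocity \<open>v h\<close>, which is bounded for \<open>h\<close> in a ball.\<close>
  have diff: "heis_mult e (heis_mult e p (hstep i t)) (- h) - heis_mult e p (- h) = t *\<^sub>R v h" for t h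
    by (simp add: heis_mult_hstep_eq[of e p] heis_mult_eq[of e _ "- h"] v_def heis_form_simps
        minus_prod_def algebra_simps)
  have "(\<lambda>n. \<integral>h. ?K n h *\<^sub>R f h \<partial>lborel) \<longlonglongrightarrow> (\<integral>h. (- Xfield e i \<psi> h) *\<^sub>R f h \<partial>lborel)"
  proof (rule loc_int_dominated[OF f, where M = "L * \<bar>V\<bar>" and \<rho> = \<rho>'])
    fix n h
    show "\<bar>?K n h\<bar> \<le> L * \<bar>V\<bar> * indicator (cball 0 \<rho>') h"
    proof (cases "norm h \<le> \<rho>'")
      case True
      have "\<bar>?K n h\<bar> \<le> (L * norm (s n *\<^sub>R v h)) / \<bar>s n\<bar>"
        unfolding abs_divide
        using L(2)[of "heis_mult e (heis_mult e p (hstep i (s n))) (- h)" "heis_mult e p (- h)", unfolded diff]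
        by (rule divide_right_mono) simp
      also have "\<dots> = L * norm (v h)" using s(1) by simp
      also have "\<dots> \<le> L * \<bar>V\<bar>"
        using V True L(1) by (intro mult_left_mono order.trans[OF _ abs_ge_self]) auto
      finally show ?thesis using True by simp
    next
      case False
      have "norm (heis_mult e p (hstep i (s n))) \<le> max \<rho>1 (norm p)"
        using \<rho>1[of "hstep i (s n)"] b[of n] by (simp add: le_max_iff_disj)
      then have "?K n h = 0" using \<rho>'[of _ h] False by simp
      then show ?thesis using False by simp
    qed
  next
    fix h
    have "(\<psi> has_derivative frechet_derivative \<psi> (at h)) (at h)"
      by (rule Cm_SucD(1)[OF C\<psi>])
    then have "\<psi> differentiable (at h)" by (auto simp: differentiable_def)
    from Xfield_left_invariant[OF this, of e i]
    have "((\<lambda>t. \<psi> (heis_mult e h (hstep i t))) has_real_derivative Xfield e i \<psi> h) (at (- 0))"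
      by (simp add: hstep_def)
    then have "((\<lambda>t. \<psi> (heis_mult e h (hstep i (- t)))) has_real_derivative Xfield e i \<psi> h * (- 1)) (at 0)"
      by (rule DERIV_chain2) (auto intro!: derivative_eq_intros)
    then have "(\<lambda>t. (\<psi> (heis_mult e h (hstep i (- t))) - \<psi> h) / t) \<midarrow>0\<rightarrow> - Xfield e i \<psi> h"
      by (simp add: DERIV_def)
    then have "(\<lambda>n. (\<psi> (heis_mult e h (hstep i (- s n))) - \<psi> h) / s n) \<longlonglongrightarrow> - Xfield e i \<psi> h"
      unfolding LIMSEQ_SEQ_conv[symmetric] using s by blast
    moreover have "\<psi> (heis_mult e h (hstep i (- t))) = \<phi> (heis_mult e (heis_mult e p (hstep i t)) (- h))" for t
    proof -
      have "- hstep i (- t) = (hstep i t :: 'n heis)" by (simp add: hstep_def)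
      then show ?thesis by (simp add: \<psi>_def heis_minus_mult heis_mult_assoc)
    qed
    ultimately show "(\<lambda>n. ?K n h) \<longlonglongrightarrow> - Xfield e i \<psi> h"
      by (simp add: \<psi>_def)
  qed measurable
  moreover have "(\<integral>h. (- Xfield e i \<psi> h) *\<^sub>R f h \<partial>lborel) = mollify e \<phi> g p"
    using weak[OF test] by (simp add: mollify_def \<psi>_def mult.commute)
  moreover have "(\<integral>h. ?K n h *\<^sub>R f h \<partial>lborel)
     = (mollify e \<phi> f (heis_mult e p (hstep i (0 + s n))) - mollify e \<phi> f (heis_mult e p (hstep i 0))) / s n" for n
  proof -
    have "(\<integral>h. ?K n h *\<^sub>R f h \<partial>lborel) = (\<integral>h. (\<phi> (heis_mult e (heis_mult e p (hstep i (s n))) (- h)) *\<^sub>R f h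
        - \<phi> (heis_mult e p (- h)) *\<^sub>R f h) / s n \<partial>lborel)"
      by (intro Bochner_Integration.integral_cong refl) (simp add: left_diff_distrib diff_divide_distrib)
    also have "\<dots> = (mollify e \<phi> f (heis_mult e p (hstep i (s n))) - mollify e \<phi> f p) / s n"
      unfolding mollify_def
      using Bochner_Integration.integral_diff[OF mollify_integrable[OF a f] mollify_integrable[OF a f]]
      by simp
    finally show ?thesis by simp
  qed
  ultimately show "(\<lambda>n. (mollify e \<phi> f (heis_mult e p (hstep i (0 + s n))) - mollify e \<phi> f (heis_mult e p (hstep i 0))) / s n)
     \<longlonglongrightarrow> mollify e \<phi> g p"
    by (simp only:)
qed

lemma approx_identity:
  fixes \<psi> :: "'a::euclidean_space \<Rightarrow> real"
  assumes a: "\<And>m. approx_unit (1 / real (Suc m)) (\<phi> m)" and [measurable]: "\<psi> \<in> borel_measurable borel"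
    and M: "\<And>g. \<bar>\<psi> g\<bar> \<le> M" and c: "isCont \<psi> 0"
  shows "(\<lambda>m. \<integral>g. \<phi> m g * \<psi> g \<partial>lborel) \<longlonglongrightarrow> \<psi> 0"
proof (rule LIMSEQ_I)
  fix r :: real assume r: "0 < r"
  obtain d where d: "d > 0" "\<And>g. norm g < d \<Longrightarrow> \<bar>\<psi> g - \<psi> 0\<bar> < r / 2"
    using c r unfolding continuous_at_eps_delta by (metis dist_norm diff_zero half_gt_zero real_norm_def)
  obtain m0 where m0: "1 / real (Suc m0) < d" using d(1) nat_approx_posE by blast
  show "\<exists>no. \<forall>m\<ge>no. norm ((\<integral>g. \<phi> m g * \<psi> g \<partial>lborel) - \<psi> 0) < r"
  proof (intro exI allI impI)
    fix m assume "m0 \<le> m"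
    then have "1 / real (Suc m) \<le> 1 / real (Suc m0)" by (intro divide_left_mono) auto
    then have md: "1 / real (Suc m) < d" using m0 by linarith
    note am = a[of m]
    note [measurable] = approx_unit_measurable[OF am]
    have i: "integrable lborel (\<lambda>g. \<phi> m g * \<psi> g)"
    proof (rule Bochner_Integration.integrable_bound)
      show "integrable lborel (\<lambda>g. \<phi> m g * M)" using approx_unit_integrable[OF am] by simp
      show "AE g in lborel. norm (\<phi> m g * \<psi> g) \<le> norm (\<phi> m g * M)"
        using M by (intro AE_I2) (auto simp: abs_mult intro!: mult_left_mono order.trans[OF M abs_ge_self])
    qed measurable
    have i0: "integrable lborel (\<lambda>g. \<phi> m g * \<psi> 0)" using approx_unit_integrable[OF am] by simp
    have ir: "integrable lborel (\<lambda>g. \<phi> m g * (r / 2))" using approx_unit_integrable[OF am] by simp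
    have "(\<integral>g. \<phi> m g * \<psi> g \<partial>lborel) - \<psi> 0 = (\<integral>g. \<phi> m g * \<psi> g \<partial>lborel) - (\<integral>g. \<phi> m g * \<psi> 0 \<partial>lborel)"
      using approx_unitD(4)[OF am] by simp
    also have "\<dots> = (\<integral>g. \<phi> m g * \<psi> g - \<phi> m g * \<psi> 0 \<partial>lborel)"
      by (rule Bochner_Integration.integral_diff[symmetric, OF i i0])
    also have "norm \<dots> \<le> (\<integral>g. \<phi> m g * (r / 2) \<partial>lborel)"
    proof (rule order.trans[OF integral_norm_bound],
        rule integral_mono[OF integrable_norm[OF Bochner_Integration.integrable_diff[OF i i0]] ir])
      fix g
      show "norm (\<phi> m g * \<psi> g - \<phi> m g * \<psi> 0) \<le> \<phi> m g * (r / 2)"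
      proof (cases "norm g < d")
        case True
        have "norm (\<phi> m g * \<psi> g - \<phi> m g * \<psi> 0) = \<phi> m g * \<bar>\<psi> g - \<psi> 0\<bar>"
          using approx_unitD(2)[OF am, of g] by (simp add: abs_mult flip: right_diff_distrib)
        also have "\<dots> \<le> \<phi> m g * (r / 2)"
          using d(2)[OF True] approx_unitD(2)[OF am, of g] by (intro mult_left_mono) auto
        finally show ?thesis .
      next
        case False
        then have "\<phi> m g = 0" using md by (intro approx_unitD(3)[OF am]) auto
        then show ?thesis by simp
      qed
    qed
    also have "\<dots> = r / 2" using approx_unitD(4)[OF am] by simp
    finally show "norm ((\<integral>g. \<phi> m g * \<psi> g \<partial>lborel) - \<psi> 0) < r" using r by simp
  qed
qed

text \<open>Mollification may be moved from the function to the weight: the substitution \<open>p = g \<circ> h\<close> preserves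
  Lebesgue measure.\<close>

lemma mollified_weight:
  fixes F :: "'n::finite heis \<Rightarrow> ennreal" and w :: "'n heis \<Rightarrow> ennreal"
  assumes a: "approx_unit \<epsilon> \<phi>" and [measurable]: "F \<in> borel_measurable borel" "w \<in> borel_measurable borel"
  shows "(\<integral>\<^sup>+p. w p * (\<integral>\<^sup>+g. ennreal (\<phi> g) * F (heis_mult e (- g) p) \<partial>lborel) \<partial>lborel)
    = (\<integral>\<^sup>+h. F h * (\<integral>\<^sup>+g. ennreal (\<phi> g) * w (heis_mult e g h) \<partial>lborel) \<partial>lborel)"
proof -
  note [measurable] = approx_unit_measurable[OF a]
  have "(\<integral>\<^sup>+p. w p * (\<integral>\<^sup>+g. ennreal (\<phi> g) * F (heis_mult e (- g) p) \<partial>lborel) \<partial>lborel)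
    = (\<integral>\<^sup>+p. (\<integral>\<^sup>+g. w p * (ennreal (\<phi> g) * F (heis_mult e (- g) p)) \<partial>lborel) \<partial>lborel)"
    by (intro nn_integral_cong nn_integral_cmult[symmetric]) measurable
  also have "\<dots> = (\<integral>\<^sup>+g. (\<integral>\<^sup>+p. w p * (ennreal (\<phi> g) * F (heis_mult e (- g) p)) \<partial>lborel) \<partial>lborel)"
    by (rule lborel_pair.Fubini') measurable
  also have "\<dots> = (\<integral>\<^sup>+g. (\<integral>\<^sup>+h. w (heis_mult e g h) * (ennreal (\<phi> g) * F h) \<partial>lborel) \<partial>lborel)"
  proof (rule nn_integral_cong)
    fix g
    have "(\<lambda>p. w p * (ennreal (\<phi> g) * F (heis_mult e (- g) p))) \<in> borel_measurable borel" by measurable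
    from nn_integral_heis_left[OF this, of e g]
    show "(\<integral>\<^sup>+p. w p * (ennreal (\<phi> g) * F (heis_mult e (- g) p)) \<partial>lborel)
      = (\<integral>\<^sup>+h. w (heis_mult e g h) * (ennreal (\<phi> g) * F h) \<partial>lborel)" by simp
  qed
  also have "\<dots> = (\<integral>\<^sup>+h. (\<integral>\<^sup>+g. w (heis_mult e g h) * (ennreal (\<phi> g) * F h) \<partial>lborel) \<partial>lborel)"
    by (rule lborel_pair.Fubini') measurable
  also have "\<dots> = (\<integral>\<^sup>+h. (\<integral>\<^sup>+g. F h * (ennreal (\<phi> g) * w (heis_mult e g h)) \<partial>lborel) \<partial>lborel)"
    by (simp add: mult_ac)
  also have "\<dots> = (\<integral>\<^sup>+h. F h * (\<integral>\<^sup>+g. ennreal (\<phi> g) * w (heis_mult e g h) \<partial>lborel) \<partial>lborel)"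
    by (intro nn_integral_cong nn_integral_cmult) measurable
  finally show ?thesis .
qed

section \<open>Convergence of mollifications\<close>

lemma negligible_imp_AE_lborel: "negligible N \<Longrightarrow> AE x in lborel. x \<notin> N"
  using AE_not_in[of N lebesgue] by (simp add: negligible_iff_null_sets AE_completion_iff)

lemma nn_integral_const_cball_finite:
  fixes \<rho> :: real
  shows "(\<integral>\<^sup>+x. ennreal (c * indicator (cball (0 :: 'a::euclidean_space) \<rho>) x) \<partial>lborel) < \<infinity>"
proof -
  have "(\<integral>\<^sup>+x. ennreal (c * indicator (cball (0 :: 'a) \<rho>) x) \<partial>lborel)
      = (\<integral>\<^sup>+x. ennreal c * indicator (cball (0 :: 'a) \<rho>) x \<partial>lborel)"
    by (intro nn_integral_cong) (auto simp: indicator_def)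
  also have "\<dots> = ennreal c * emeasure lborel (cball (0 :: 'a) \<rho>)"
    by (rule nn_integral_cmult_indicator) simp
  also have "\<dots> < \<infinity>"
    using emeasure_compact_finite[OF compact_cball, of "0::'a" \<rho>] by (simp add: ennreal_mult_less_top)
  finally show ?thesis .
qed

text \<open>Truncate \<open>f\<close>, then approximate it almost everywhere by continuous functions truncated at the same
  level; dominated convergence applies both times.\<close>

lemma approx_by_bounded_continuous:
  fixes f :: "'n::finite heis \<Rightarrow> real"
  assumes f: "loc_int f" and \<delta>: "\<delta> > 0"
  shows "\<exists>k B. continuous_on UNIV k \<and> (\<forall>x. \<bar>k x\<bar> \<le> B) \<and>
     (\<integral>\<^sup>+x. ennreal \<bar>f x - k x\<bar> * indicator (cball 0 \<rho>) x \<partial>lborel) < ennreal \<delta>"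
proof -
  note [measurable] = loc_int_measurable[OF f]
  let ?I = "indicator (cball 0 \<rho>) :: 'n heis \<Rightarrow> real"
  define cl where "cl n y = max (- real n) (min (real n) y)" for n and y :: real
  have cl_bd: "\<bar>cl n y\<bar> \<le> real n" for n y by (auto simp: cl_def)
  have cl_le: "\<bar>cl n y\<bar> \<le> \<bar>y\<bar>" for n y by (auto simp: cl_def)
  have cl_cont: "continuous_on UNIV (cl n)" for n unfolding cl_def by (intro continuous_intros)
  have [measurable]: "cl n \<in> borel_measurable borel" for n
    using cl_cont by (rule borel_measurable_continuous_onI)
  have "(\<lambda>n. \<integral>\<^sup>+x. norm (?I x * f x - ?I x * cl n (f x)) \<partial>lborel) \<longlonglongrightarrow> 0"
  proof (rule nn_integral_dominated_convergence_norm[where w = "\<lambda>x. norm (?I x *\<^sub>R f x)"])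
    show "AE x in lborel. norm (?I x * cl n (f x)) \<le> norm (?I x *\<^sub>R f x)" for n
      using cl_le by (intro AE_I2) (auto simp: abs_mult intro!: mult_left_mono)
    have "integrable lborel (\<lambda>x. ?I x *\<^sub>R f x)" using f by (simp add: loc_int_def)
    then show "(\<integral>\<^sup>+x. ennreal (norm (?I x *\<^sub>R f x)) \<partial>lborel) < \<infinity>"
      by (simp add: integrable_iff_bounded)
    show "AE x in lborel. (\<lambda>n. ?I x * cl n (f x)) \<longlonglongrightarrow> ?I x * f x"
    proof (intro AE_I2 tendsto_mult_left tendsto_eventually)
      fix x
      have "eventually (\<lambda>n. real n \<ge> \<bar>f x\<bar>) sequentially" by real_asymp
      then show "\<forall>\<^sub>F n in sequentially. cl n (f x) = f x"
        by (rule eventually_mono) (auto simp: cl_def)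
    qed
  qed measurable
  then have "\<forall>\<^sub>F n in sequentially. (\<integral>\<^sup>+x. norm (?I x * f x - ?I x * cl n (f x)) \<partial>lborel) < ennreal (\<delta> / 2)"
    using \<delta> by (intro order_tendstoD(2)) auto
  then obtain n where n: "(\<integral>\<^sup>+x. norm (?I x * f x - ?I x * cl n (f x)) \<partial>lborel) < ennreal (\<delta> / 2)"
    using eventually_happens'[OF sequentially_bot] by blast
  have "f measurable_on UNIV"
    by (rule lebesgue_measurable_imp_measurable_on) (auto intro: measurable_completion)
  then obtain N F where N: "negligible N" and F: "\<And>m. continuous_on UNIV (F m)"
    and lim: "\<And>x. x \<notin> N \<Longrightarrow> (\<lambda>m. F m x) \<longlonglongrightarrow> f x"
    by (auto simp: measurable_on_def)
  have cF: "continuous_on UNIV (\<lambda>x. cl n (F m x))" for m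
    by (rule continuous_on_compose2[OF cl_cont F]) simp
  have [measurable]: "(\<lambda>x. cl n (F m x)) \<in> borel_measurable borel" for m
    using cF by (rule borel_measurable_continuous_onI)
  have "(\<lambda>m. \<integral>\<^sup>+x. norm (?I x * cl n (f x) - ?I x * cl n (F m x)) \<partial>lborel) \<longlonglongrightarrow> 0"
  proof (rule nn_integral_dominated_convergence_norm[where w = "\<lambda>x. real n * ?I x"])
    show "AE x in lborel. norm (?I x * cl n (F m x)) \<le> real n * ?I x" for m
      using cl_bd by (intro AE_I2) (auto simp: abs_mult indicator_def)
    show "(\<integral>\<^sup>+x. ennreal (real n * ?I x) \<partial>lborel) < \<infinity>"
      by (rule nn_integral_const_cball_finite)
    show "AE x in lborel. (\<lambda>m. ?I x * cl n (F m x)) \<longlonglongrightarrow> ?I x * cl n (f x)"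
      using negligible_imp_AE_lborel[OF N]
    proof eventually_elim
      case (elim x)
      show ?case
        by (intro tendsto_mult_left continuous_on_tendsto_compose[OF cl_cont lim[OF elim]]) auto
    qed
  qed measurable
  then have "\<forall>\<^sub>F m in sequentially. (\<integral>\<^sup>+x. norm (?I x * cl n (f x) - ?I x * cl n (F m x)) \<partial>lborel) < ennreal (\<delta> / 2)"
    using \<delta> by (intro order_tendstoD(2)) auto
  then obtain m where m: "(\<integral>\<^sup>+x. norm (?I x * cl n (f x) - ?I x * cl n (F m x)) \<partial>lborel) < ennreal (\<delta> / 2)"
    using eventually_happens'[OF sequentially_bot] by blast
  have "(\<integral>\<^sup>+x. ennreal \<bar>f x - cl n (F m x)\<bar> * indicator (cball 0 \<rho>) x \<partial>lborel)
     \<le> (\<integral>\<^sup>+x. ennreal (norm (?I x * f x - ?I x * cl n (f x))) + ennreal (norm (?I x * cl n (f x) - ?I x * cl n (F m x))) \<partial>lborel)"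
    by (intro nn_integral_mono) (auto simp: indicator_def ennreal_leI simp flip: ennreal_plus)
  also have "\<dots> = (\<integral>\<^sup>+x. ennreal (norm (?I x * f x - ?I x * cl n (f x))) \<partial>lborel)
      + (\<integral>\<^sup>+x. ennreal (norm (?I x * cl n (f x) - ?I x * cl n (F m x))) \<partial>lborel)"
    by (rule nn_integral_add) measurable
  also have "\<dots> < ennreal (\<delta> / 2) + ennreal (\<delta> / 2)"
    by (rule add_strict_mono[OF n m])
  also have "\<dots> = ennreal \<delta>" using \<delta> by (simp flip: ennreal_plus)
  finally show ?thesis
    using cF cl_bd by (intro exI[of _ "\<lambda>x. cl n (F m x)"] exI[of _ "real n"]) auto
qed

lemma loc_int_continuous:
  fixes k :: "'n::finite heis \<Rightarrow> 'b::{banach, second_countable_topology}"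
  assumes "continuous_on UNIV k"
  shows "loc_int k"
  unfolding loc_int_def
  using assms by (auto intro!: borel_measurable_continuous_onI borel_integrable_compact
      intro: continuous_on_subset)

lemma loc_int_diff: "loc_int f \<Longrightarrow> loc_int g \<Longrightarrow> loc_int (\<lambda>x. f x - g x)"
  unfolding loc_int_def by (auto simp: scaleR_diff_right)

lemma mollify_diff:
  assumes a: "approx_unit \<epsilon> \<phi>" and f: "loc_int f" and g: "loc_int g"
  shows "mollify e \<phi> (\<lambda>x. f x - g x) p = mollify e \<phi> f p - mollify e \<phi> g p"
  unfolding mollify_def scaleR_diff_right
  by (rule Bochner_Integration.integral_diff[OF mollify_integrable[OF a f] mollify_integrable[OF a g]])

lemma approx_unit_nn_integral:
  assumes a: "approx_unit \<epsilon> \<phi>"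
  shows "(\<integral>\<^sup>+g. ennreal (\<phi> g) \<partial>lborel) = 1"
  using nn_integral_eq_integral[OF approx_unit_integrable[OF a]] approx_unitD(2,4)[OF a] by simp

text \<open>A mollified weight is still supported in a fixed ball and bounded by one, whatever the approximate
  unit. This is the dominating function in later limits.\<close>

lemma mollified_weight_le_indicator:
  fixes w :: "'n::finite heis \<Rightarrow> ennreal"
  assumes a: "approx_unit \<epsilon> \<phi>" and \<epsilon>: "\<epsilon> \<le> 1" and w: "\<And>p. w p \<le> indicator (cball 0 \<rho>) p"
    and \<rho>': "\<And>g p. norm g \<le> 1 \<Longrightarrow> norm p \<le> \<rho> \<Longrightarrow> norm (heis_mult e g p) \<le> \<rho>'"
  shows "(\<integral>\<^sup>+g. ennreal (\<phi> g) * w (heis_mult e g h) \<partial>lborel) \<le> indicator (cball 0 \<rho>') h"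
proof -
  note [measurable] = approx_unit_measurable[OF a]
  have "(\<integral>\<^sup>+g. ennreal (\<phi> g) * w (heis_mult e g h) \<partial>lborel) \<le> (\<integral>\<^sup>+g. ennreal (\<phi> g) * indicator (cball 0 \<rho>') h \<partial>lborel)"
  proof (rule nn_integral_mono)
    fix g
    show "ennreal (\<phi> g) * w (heis_mult e g h) \<le> ennreal (\<phi> g) * indicator (cball 0 \<rho>') h"
    proof (cases "norm g \<le> 1")
      case True
      have "norm h \<le> \<rho>'" if "norm (heis_mult e g h) \<le> \<rho>"
        using \<rho>'[of "- g" "heis_mult e g h"] that True by simp
      then have "indicator (cball 0 \<rho>) (heis_mult e g h) \<le> (indicator (cball 0 \<rho>') h :: ennreal)"
        by (auto simp: indicator_def)
      then show ?thesis using w[of "heis_mult e g h"] by (intro mult_left_mono) (auto intro: order.trans)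
    next
      case False
      then have "\<phi> g = 0" using \<epsilon> by (intro approx_unitD(3)[OF a]) auto
      then show ?thesis by simp
    qed
  qed
  also have "\<dots> = indicator (cball 0 \<rho>') h"
    by (simp add: nn_integral_multc approx_unit_nn_integral[OF a])
  finally show ?thesis .
qed

text \<open>Split \<open>f\<close> into a bounded continuous function \<open>k\<close> and a remainder that is small in \<open>L\<^sup>1\<close> of a slightly larger
  ball. The mollified remainder stays small (\<open>T1\<close>), and for \<open>k\<close> the convergence is pointwise and bounded.\<close>

lemma mollify_tendsto_L1:
  fixes f :: "'n::finite heis \<Rightarrow> real"
  assumes a: "\<And>m. approx_unit (1 / real (Suc m)) (\<phi> m)" and f: "loc_int f"
  shows "(\<lambda>m. \<integral>\<^sup>+p. ennreal \<bar>mollify e (\<phi> m) f p - f p\<bar> * indicator (cball 0 \<rho>) p \<partial>lborel) \<longlonglongrightarrow> 0"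
proof (rule order_tendstoI)
  fix c :: ennreal assume "0 < c"
  then obtain c' where c': "0 < c'" "c' < c" using dense by blast
  then obtain d where d: "c' = ennreal d" "0 < d"
    by (cases c') (auto simp: top_unique)
  define \<delta> where "\<delta> = d / 3"
  have \<delta>: "\<delta> > 0" using d by (simp add: \<delta>_def)
  note [measurable] = loc_int_measurable[OF f] 
  have mm[measurable]: "mollify e (\<phi> m) h \<in> borel_measurable borel" if "loc_int h" for m and h :: "'n heis \<Rightarrow> real"
    by (rule borel_measurable_continuous_onI[OF mollify_continuous[OF a that]])
  obtain \<rho>0 where \<rho>0: "\<And>g p. norm g \<le> 1 \<Longrightarrow> norm p \<le> \<rho> \<Longrightarrow> norm (heis_mult e g p) \<le> \<rho>0"
    using heis_mult_bounded[of 1 \<rho> e] by blast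
  define \<rho>' where "\<rho>' = max \<rho> \<rho>0"
  obtain k B where k: "continuous_on UNIV k" and B: "\<And>x. \<bar>k x\<bar> \<le> B"
    and fk: "(\<integral>\<^sup>+x. ennreal \<bar>f x - k x\<bar> * indicator (cball 0 \<rho>') x \<partial>lborel) < ennreal \<delta>"
    using approx_by_bounded_continuous[OF f \<delta>] by blast
  have lk: "loc_int k" by (rule loc_int_continuous[OF k])
  have lfk: "loc_int (\<lambda>x. f x - k x)" by (rule loc_int_diff[OF f lk])
  note [measurable] = loc_int_measurable[OF lk] mm[OF lk] mm[OF f] mm[OF lfk]
  have B0: "0 \<le> B" using B[of 0] by linarith
  let ?J = "\<lambda>p. indicator (cball 0 \<rho>) p :: ennreal"
  have T1: "(\<integral>\<^sup>+p. ennreal \<bar>mollify e (\<phi> m) (\<lambda>x. f x - k x) p\<bar> * ?J p \<partial>lborel) \<le> ennreal \<delta>" for m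
  proof -
    have "(\<integral>\<^sup>+p. ennreal \<bar>mollify e (\<phi> m) (\<lambda>x. f x - k x) p\<bar> * ?J p \<partial>lborel)
      \<le> (\<integral>\<^sup>+p. ?J p * (\<integral>\<^sup>+g. ennreal (\<phi> m g) * ennreal \<bar>f (heis_mult e (- g) p) - k (heis_mult e (- g) p)\<bar> \<partial>lborel) \<partial>lborel)"
      using mollify_jensen[OF a lfk, of 1 e m] by (intro nn_integral_mono) (auto simp: indicator_def)
    also have "\<dots> = (\<integral>\<^sup>+h. ennreal \<bar>f h - k h\<bar> * (\<integral>\<^sup>+g. ennreal (\<phi> m g) * ?J (heis_mult e g h) \<partial>lborel) \<partial>lborel)"
      by (rule mollified_weight[OF a, of "\<lambda>h. ennreal \<bar>f h - k h\<bar>" ?J]) measurable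
    also have "\<dots> \<le> (\<integral>\<^sup>+h. ennreal \<bar>f h - k h\<bar> * indicator (cball 0 \<rho>') h \<partial>lborel)"
      by (intro nn_integral_mono mult_left_mono mollified_weight_le_indicator[OF a _ order.refl])
         (use \<rho>0 in \<open>auto simp: \<rho>'_def le_max_iff_disj\<close>)
    finally show ?thesis using fk by simp
  qed
  have T3: "(\<integral>\<^sup>+p. ennreal \<bar>f p - k p\<bar> * ?J p \<partial>lborel) \<le> ennreal \<delta>"
  proof -
    have "(\<integral>\<^sup>+p. ennreal \<bar>f p - k p\<bar> * ?J p \<partial>lborel) \<le> (\<integral>\<^sup>+x. ennreal \<bar>f x - k x\<bar> * indicator (cball 0 \<rho>') x \<partial>lborel)"
      by (intro nn_integral_mono mult_left_mono) (auto simp: indicator_def \<rho>'_def)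
    then show ?thesis using fk by simp
  qed
  let ?I = "indicator (cball 0 \<rho>) :: 'n heis \<Rightarrow> real"
  have "(\<lambda>m. \<integral>\<^sup>+p. norm (?I p * k p - ?I p * mollify e (\<phi> m) k p) \<partial>lborel) \<longlonglongrightarrow> 0"
  proof (rule nn_integral_dominated_convergence_norm[where w = "\<lambda>p. B * ?I p"])
    have mb: "\<bar>mollify e (\<phi> m) k p\<bar> \<le> B" for m p
    proof -
      have "ennreal \<bar>mollify e (\<phi> m) k p\<bar> \<le> (\<integral>\<^sup>+g. ennreal (\<phi> m g) * ennreal \<bar>k (heis_mult e (- g) p)\<bar> \<partial>lborel)"
        using mollify_jensen[OF a lk, of 1 e m p] by simp
      also have "\<dots> \<le> (\<integral>\<^sup>+g. ennreal (\<phi> m g) * ennreal B \<partial>lborel)"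
        using B by (intro nn_integral_mono mult_left_mono ennreal_leI) auto
      also have "\<dots> = ennreal B"
        using approx_unit_measurable[OF a[of m]] by (simp add: nn_integral_multc approx_unit_nn_integral[OF a])
      finally show ?thesis using B0 by simp
    qed
    show "AE p in lborel. norm (?I p * mollify e (\<phi> m) k p) \<le> B * ?I p" for m
      using mb by (intro AE_I2) (auto simp: indicator_def)
    show "(\<integral>\<^sup>+x. ennreal (B * ?I x) \<partial>lborel) < \<infinity>"
      by (rule nn_integral_const_cball_finite)
    show "AE p in lborel. (\<lambda>m. ?I p * mollify e (\<phi> m) k p) \<longlonglongrightarrow> ?I p * k p"
    proof (intro AE_I2 tendsto_mult_left)
      fix p
      have c: "continuous_on UNIV (\<lambda>g. k (heis_mult e (- g) p))"
        by (rule continuous_on_compose2[OF k]) (auto intro!: continuous_intros)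
      have "(\<lambda>m. \<integral>g. \<phi> m g * k (heis_mult e (- g) p) \<partial>lborel) \<longlonglongrightarrow> k (heis_mult e (- 0) p)"
      proof (rule approx_identity[OF a borel_measurable_continuous_onI[OF c] B])
        show "isCont (\<lambda>g. k (heis_mult e (- g) p)) 0"
          using c unfolding continuous_on_eq_continuous_at[OF open_UNIV] by blast
      qed
      then show "(\<lambda>m. mollify e (\<phi> m) k p) \<longlonglongrightarrow> k p"
        by (simp add: mollify_shift(1)[OF a lk])
    qed
  qed measurable
  then have "\<forall>\<^sub>F m in sequentially. (\<integral>\<^sup>+p. norm (?I p * k p - ?I p * mollify e (\<phi> m) k p) \<partial>lborel) < ennreal \<delta>"
    using \<delta> by (intro order_tendstoD(2)) auto
  then show "\<forall>\<^sub>F m in sequentially. (\<integral>\<^sup>+p. ennreal \<bar>mollify e (\<phi> m) f p - f p\<bar> * ?J p \<partial>lborel) < c"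
  proof eventually_elim
    case (elim m)
    have "(\<integral>\<^sup>+p. ennreal \<bar>mollify e (\<phi> m) f p - f p\<bar> * ?J p \<partial>lborel)
      \<le> (\<integral>\<^sup>+p. ennreal \<bar>mollify e (\<phi> m) (\<lambda>x. f x - k x) p\<bar> * ?J p +
          (ennreal (norm (?I p * k p - ?I p * mollify e (\<phi> m) k p)) + ennreal \<bar>f p - k p\<bar> * ?J p) \<partial>lborel)"
    proof (rule nn_integral_mono)
      fix p
      have "\<bar>mollify e (\<phi> m) f p - f p\<bar> \<le> \<bar>mollify e (\<phi> m) (\<lambda>x. f x - k x) p\<bar> + (\<bar>k p - mollify e (\<phi> m) k p\<bar> + \<bar>f p - k p\<bar>)"
        unfolding mollify_diff[OF a f lk] by linarith
      from ennreal_leI[OF this]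
      show "ennreal \<bar>mollify e (\<phi> m) f p - f p\<bar> * ?J p \<le> ennreal \<bar>mollify e (\<phi> m) (\<lambda>x. f x - k x) p\<bar> * ?J p +
          (ennreal (norm (?I p * k p - ?I p * mollify e (\<phi> m) k p)) + ennreal \<bar>f p - k p\<bar> * ?J p)"
        by (auto simp: indicator_def)
    qed
    also have "\<dots> = (\<integral>\<^sup>+p. ennreal \<bar>mollify e (\<phi> m) (\<lambda>x. f x - k x) p\<bar> * ?J p \<partial>lborel)
      + ((\<integral>\<^sup>+p. norm (?I p * k p - ?I p * mollify e (\<phi> m) k p) \<partial>lborel) + (\<integral>\<^sup>+p. ennreal \<bar>f p - k p\<bar> * ?J p \<partial>lborel))"
    proof -
      have "(\<lambda>p. ennreal \<bar>mollify e (\<phi> m) (\<lambda>x. f x - k x) p\<bar> * ?J p) \<in> borel_measurable lborel"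
        "(\<lambda>p. ennreal (norm (?I p * k p - ?I p * mollify e (\<phi> m) k p))) \<in> borel_measurable lborel"
        "(\<lambda>p. ennreal \<bar>f p - k p\<bar> * ?J p) \<in> borel_measurable lborel"
        by measurable
      then show ?thesis by (simp only: nn_integral_add borel_measurable_add)
    qed
    also have "\<dots> \<le> ennreal \<delta> + (ennreal \<delta> + ennreal \<delta>)"
      using elim by (intro add_mono T1 T3) auto
    also have "\<dots> = ennreal (\<delta> + (\<delta> + \<delta>))"
      using \<delta> by (simp only: ennreal_plus less_imp_le add_nonneg_nonneg)
    also have "\<dots> = c'" by (simp add: d \<delta>_def)
    finally show ?case using c'(2) by simp
  qed
qed simp

lemma mollify_AE_subseq:
  fixes f :: "'n::finite heis \<Rightarrow> real"
  assumes a: "\<And>m. approx_unit (1 / real (Suc m)) (\<phi> m)" and f: "loc_int f"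
  shows "\<exists>r. strict_mono r \<and> (AE p in lborel. norm p \<le> \<rho> \<longrightarrow> (\<lambda>m. mollify e (\<phi> (r m)) f p) \<longlonglongrightarrow> f p)"
proof -
  let ?I = "indicator (cball 0 \<rho>) :: 'n heis \<Rightarrow> real"
  let ?u = "\<lambda>m p. ?I p *\<^sub>R (mollify e (\<phi> m) f p - f p)"
  have i: "integrable lborel (?u m)" for m
    using loc_int_diff[OF loc_int_continuous[OF mollify_continuous[OF a f]] f] by (simp add: loc_int_def)
  have "ennreal (\<integral>p. norm (?u m p) \<partial>lborel)
      = (\<integral>\<^sup>+p. ennreal \<bar>mollify e (\<phi> m) f p - f p\<bar> * indicator (cball 0 \<rho>) p \<partial>lborel)" for m
  proof -
    have "ennreal (\<integral>p. norm (?u m p) \<partial>lborel) = (\<integral>\<^sup>+p. ennreal (norm (?u m p)) \<partial>lborel)"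
      by (rule nn_integral_eq_integral[OF integrable_norm[OF i], symmetric]) simp
    also have "\<dots> = (\<integral>\<^sup>+p. ennreal \<bar>mollify e (\<phi> m) f p - f p\<bar> * indicator (cball 0 \<rho>) p \<partial>lborel)"
      by (intro nn_integral_cong) (auto simp: indicator_def)
    finally show ?thesis .
  qed
  then have "(\<lambda>m. ennreal (\<integral>p. norm (?u m p) \<partial>lborel)) \<longlonglongrightarrow> 0"
    using mollify_tendsto_L1[OF a f, of e \<rho>] by simp
  then have "(\<lambda>m. \<integral>p. norm (?u m p) \<partial>lborel) \<longlonglongrightarrow> 0"
    by (subst (asm) ennreal_tendsto_0_iff) auto
  from tendsto_L1_AE_subseq[OF i this]
  obtain r where r: "strict_mono r" "AE p in lborel. (\<lambda>n. ?u (r n) p) \<longlonglongrightarrow> 0" by blast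
  from r(2) have "AE p in lborel. norm p \<le> \<rho> \<longrightarrow> (\<lambda>m. mollify e (\<phi> (r m)) f p) \<longlonglongrightarrow> f p"
    by eventually_elim (auto simp: LIM_zero_iff)
  with r(1) show ?thesis by blast
qed

text \<open>Convergence is only asked for almost everywhere in each variable in turn, which is what an almost
  everywhere convergent sequence \<open>u\<^sub>m\<close> gives for \<open>u\<^sub>m p - u\<^sub>m p'\<close>.\<close>

lemma double_fatou:
  fixes H :: "'a::euclidean_space \<Rightarrow> 'a \<Rightarrow> ennreal"
  assumes [measurable]: "\<And>m. (\<lambda>z. K m (fst z) (snd z)) \<in> borel_measurable borel"
    and lim: "AE x in lborel. AE y in lborel. (\<lambda>m. K m x y) \<longlonglongrightarrow> H x y"
    and le: "\<And>m. (\<integral>\<^sup>+x. (\<integral>\<^sup>+y. K m x y \<partial>lborel) \<partial>lborel) \<le> J m" and J: "J \<longlonglongrightarrow> j"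
  shows "(\<integral>\<^sup>+x. (\<integral>\<^sup>+y. H x y \<partial>lborel) \<partial>lborel) \<le> j"
proof -
  have [measurable]: "(\<lambda>z. K m (fst z) (snd z)) \<in> borel_measurable (lborel \<Otimes>\<^sub>M lborel)" for m
    by (simp add: lborel_prod)
  have [measurable]: "(\<lambda>y. K m x y) \<in> borel_measurable lborel" for m x
  proof -
    have "(\<lambda>y. K m (fst (x, y)) (snd (x, y))) \<in> borel_measurable lborel" by measurable
    then show ?thesis by simp
  qed
  have [measurable]: "(\<lambda>x. \<integral>\<^sup>+y. K m x y \<partial>lborel) \<in> borel_measurable lborel" for m
    using lborel.borel_measurable_nn_integral_fst[of "\<lambda>z. K m (fst z) (snd z)" lborel] by simp
  have "(\<integral>\<^sup>+x. (\<integral>\<^sup>+y. H x y \<partial>lborel) \<partial>lborel) \<le> (\<integral>\<^sup>+x. liminf (\<lambda>m. \<integral>\<^sup>+y. K m x y \<partial>lborel) \<partial>lborel)"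
  proof (rule nn_integral_mono_AE)
    show "AE x in lborel. (\<integral>\<^sup>+y. H x y \<partial>lborel) \<le> liminf (\<lambda>m. \<integral>\<^sup>+y. K m x y \<partial>lborel)"
      using lim
    proof eventually_elim
      case (elim x)
      have "(\<integral>\<^sup>+y. H x y \<partial>lborel) = (\<integral>\<^sup>+y. liminf (\<lambda>m. K m x y) \<partial>lborel)"
        by (rule nn_integral_cong_AE) (use elim in \<open>eventually_elim, simp add: lim_imp_Liminf\<close>)
      also have "\<dots> \<le> liminf (\<lambda>m. \<integral>\<^sup>+y. K m x y \<partial>lborel)"
        by (rule nn_integral_liminf) measurable
      finally show ?case .
    qed
  qed
  also have "\<dots> \<le> liminf (\<lambda>m. \<integral>\<^sup>+x. (\<integral>\<^sup>+y. K m x y \<partial>lborel) \<partial>lborel)"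
    by (rule nn_integral_liminf) measurable
  also have "\<dots> \<le> liminf J"
    using le by (intro Liminf_mono always_eventually) auto
  also have "\<dots> = j" using J by (intro lim_imp_Liminf) auto
  finally show ?thesis .
qed

section \<open>The inequality for horizontally smooth functions\<close>

lemma hP_bounded_on_cball:
  fixes e :: "'n::finite"
  shows "\<exists>c\<ge>0. \<forall>p\<in>cball 0 \<rho>. hP e p \<le> c"
proof -
  have "continuous_on (cball 0 \<rho>) (hP e)" by (intro continuous_intros)
  then have "bounded (hP e ` cball 0 \<rho>)"
    by (rule compact_imp_bounded[OF compact_continuous_image[OF _ compact_cball]])
  then obtain c where c: "\<forall>p\<in>cball 0 \<rho>. \<bar>hP e p\<bar> \<le> c" by (auto simp: bounded_iff)
  have "\<forall>p\<in>cball 0 \<rho>. hP e p \<le> \<bar>c\<bar>"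
  proof
    fix p :: "'n heis" assume "p \<in> cball 0 \<rho>"
    then have "\<bar>hP e p\<bar> \<le> c" using c by blast
    then show "hP e p \<le> \<bar>c\<bar>" by linarith
  qed
  then show ?thesis by (intro exI[of _ "\<bar>c\<bar>"]) auto
qed

text \<open>From \<open>r + a \<le> 2 r\<close> one gets an upper bound for \<open>L\<close>, hence for \<open>N\<close>, on bounded sets.\<close>

lemma gibbs_lower:
  fixes e :: "'n::finite"
  assumes k: "k \<ge> 0"
  shows "\<exists>\<delta>>0. \<forall>p\<in>cball 0 \<rho>. \<delta> \<le> gibbs e k p"
proof -
  define n where "n = real CARD('n)"
  have n: "n \<ge> 1" by (simp add: n_def Suc_leI)
  obtain c where c: "c \<ge> 0" "\<And>p. p \<in> cball 0 \<rho> \<Longrightarrow> hP e p \<le> c"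
    using hP_bounded_on_cball[of \<rho> e] by blast
  define m where "m = 2 * sqrt c + 1"
  define E where "E = exp (k / (4 * n) * (2 * n * ln m))"
  have m: "m \<ge> 1" using c by (simp add: m_def)
  have E: "E \<ge> 0" by (simp add: E_def)
  have "exp (- cosh E) \<le> gibbs e k p" if p: "p \<in> cball 0 \<rho>" for p
  proof (cases "p = 0")
    case True
    then have "gibbs e k p = exp (- 1)" by (simp add: gibbs_def heis_norm_def zero_prod_def)
    then show ?thesis using cosh_real_ge_1[of E] by simp
  next
    case False
    then have P: "0 < hP e p" by (simp add: hP_pos_iff)
    have r: "0 < hr e p" using P by simp
    have "hr e p \<le> sqrt c" using c(2)[OF p] by (simp add: hr_def)
    then have rm: "2 * hr e p \<le> m" by (simp add: m_def)
    have "ln (hr e p) \<le> ln (hr e p + hB e p)"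
      using r by (intro iffD2[OF ln_le_cancel_iff]) (auto simp del: hr_pos_iff intro: add_pos_nonneg)
    moreover have "ln (hr e p) \<le> ln m"
      using r rm m by (intro iffD2[OF ln_le_cancel_iff]) linarith+
    moreover have "hr e p + ha e p \<le> m"
      using rm hB_le_hr[of e p] hs_nonneg[of e p] unfolding hB_def by linarith
    then have "ln (hr e p + ha e p) \<le> ln m"
      using r m ha_nonneg[of e p] by (intro iffD2[OF ln_le_cancel_iff]) linarith+
    then have "(2 * n - 1) * ln (hr e p + ha e p) \<le> (2 * n - 1) * ln m"
      using n by (intro mult_left_mono) auto
    ultimately have "hL e p \<le> ln m + (2 * n - 1) * ln m"
      unfolding hL_def n_def[symmetric] by linarith
    also have "\<dots> = 2 * n * ln m" by (simp add: algebra_simps)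
    finally have "k / (4 * n) * hL e p \<le> k / (4 * n) * (2 * n * ln m)"
      using k n by (intro mult_left_mono) auto
    then have "hE e k p \<le> E" by (simp add: hE_def E_def n_def)
    then have "cosh (hE e k p) \<le> cosh E"
      using E by (subst cosh_real_nonneg_le_iff) (auto simp: hE_def)
    then show ?thesis using False by (simp add: gibbs_eq)
  qed
  then show ?thesis by (intro exI[of _ "exp (- cosh E)"]) auto
qed

lemma borel_cut_gibbs [measurable]: "R > 0 \<Longrightarrow> cut_gibbs e k R \<in> borel_measurable borel"
  using borel_measurable_continuous_onI[OF continuous_on_outer_cut[of R UNIV]] by measurable

lemma cut_gibbs_bounds: "R > 0 \<Longrightarrow> 0 \<le> cut_gibbs e k R p" "R > 0 \<Longrightarrow> cut_gibbs e k R p \<le> 1"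
  using outer_cut_le_1[of R "hP e p"] gibbs_le_1[of e k p] by (auto intro: mult_le_one)

lemma cut_gibbs_support: "R > 0 \<Longrightarrow> norm p > 2 * R + 2 \<Longrightarrow> cut_gibbs e k R p = 0"
proof -
  assume R: "R > 0" and p: "norm p > 2 * R + 2"
  have "R \<le> hP e p" using norm_le_of_hP[of e p R] p by (meson linorder_not_less nle_le)
  then show ?thesis using outer_cut_eq_0[OF R] by simp
qed

lemma cut_gibbs_lower:
  assumes k: "k \<ge> 0"
  shows "\<exists>\<delta>>0. \<exists>R0>0. \<forall>R\<ge>R0. \<forall>p\<in>cball 0 \<rho>. \<delta> \<le> cut_gibbs e k R p"
proof -
  obtain c where c: "c \<ge> 0" "\<And>p. p \<in> cball 0 \<rho> \<Longrightarrow> hP e p \<le> c"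
    using hP_bounded_on_cball[of \<rho> e] by blast
  obtain \<delta> where \<delta>: "\<delta> > 0" "\<And>p. p \<in> cball 0 \<rho> \<Longrightarrow> \<delta> \<le> gibbs e k p"
    using gibbs_lower[OF k, of \<rho> e] by blast
  have "\<delta> / 4 \<le> cut_gibbs e k R p" if R: "R \<ge> 2 * c + 1" and p: "p \<in> cball 0 \<rho>" for R p
  proof -
    have "hP e p / R \<le> 1 / 2" using c(1) c(2)[OF p] R by (simp add: field_simps)
    then have half: "1 / 2 \<le> max 0 (1 - hP e p / R)" by linarith
    have "(1 / 2) powr 2 \<le> outer_cut R (hP e p)"
      unfolding outer_cut_def by (rule powr_mono2[OF _ _ half]) simp_all
    then have "1 / 4 \<le> outer_cut R (hP e p)" by (simp add: power2_eq_square)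
    then have "1 / 4 * \<delta> \<le> cut_gibbs e k R p" using \<delta>(1) \<delta>(2)[OF p] by (intro mult_mono) auto
    then show ?thesis by simp
  qed
  then show ?thesis using \<delta>(1) c(1) by (intro exI[of _ "\<delta> / 4"] conjI exI[of _ "2 * c + 1"]) auto
qed

text \<open>Apply the U-bound to \<open>u - u p'\<close> and integrate over \<open>p'\<close> in the ball; the ball term is then exactly the
  left-hand side of the local inequality. Using the double integral instead of a mean value makes
  the statement stable under almost everywhere convergence. For \<open>R\<close> large the cut off weight is
  bounded below on the ball, so the local energy is part of the weighted energy.\<close>

lemma smooth_poincare:
  fixes e :: "'n::finite"
  assumes k: "k \<ge> 1" and q: "q \<ge> 2" and n: "CARD('n) \<ge> 3"
  shows "\<exists>C\<ge>0. \<exists>\<rho>>0. \<exists>R0>0. \<forall>R\<ge>R0. \<forall>u g. horiz_C1 e u g \<longrightarrow>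
    (cut_osc e k R \<rho> q u)
     \<le> ennreal C * (cut_energy e k R q g)"
proof -
  obtain C1 \<rho>1 where C1: "C1 \<ge> 0" "\<rho>1 \<ge> 0" and U: "\<And>R u g. R > 0 \<Longrightarrow> horiz_C1 e u g \<Longrightarrow>
    (\<integral>\<^sup>+p. ennreal (cut_gibbs e k R p * \<bar>u p\<bar> powr q) \<partial>lborel)
     \<le> ennreal C1 * (\<integral>\<^sup>+p. ennreal (\<bar>u p\<bar> powr q) * indicator (cball 0 \<rho>1) p \<partial>lborel)
      + (cut_energy e k R q g)"
    using weighted_U_bound[OF k q n, of e] by blast
  define \<rho> where "\<rho> = \<rho>1 + 1"
  have \<rho>: "\<rho> > 0" using C1 by (simp add: \<rho>_def)
  have q1: "q \<ge> 1" using q by simp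
  obtain C2 \<rho>2 where C2: "C2 \<ge> 0" and loc: "\<And>u g. horiz_C1 e u g \<Longrightarrow>
    (ball_osc q \<rho> u)
      \<le> ennreal C2 * (ball_energy q \<rho>2 g)"
    using local_poincare[OF q1, of e \<rho>] by blast
  have k0: "k \<ge> 0" using k by simp
  obtain \<delta> R0 where \<delta>: "\<delta> > 0" "R0 > 0" and low: "\<And>R p. R \<ge> R0 \<Longrightarrow> p \<in> cball 0 \<rho>2 \<Longrightarrow> \<delta> \<le> cut_gibbs e k R p"
    using cut_gibbs_lower[OF k0, of \<rho>2 e] by blast
  define V where "V = measure lborel (cball 0 \<rho> :: 'n heis set)"
  have V: "emeasure lborel (cball 0 \<rho> :: 'n heis set) = ennreal V"
    unfolding V_def using emeasure_compact_finite[OF compact_cball, of 0 \<rho>]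
    by (intro emeasure_eq_ennreal_measure) (simp add: less_top)
  have V0: "V \<ge> 0" by (simp add: V_def)
  define C where "C = C1 * C2 / \<delta> + V"
  have C: "C \<ge> 0" using C1 C2 \<delta> V0 by (simp add: C_def)
  have "(cut_osc e k R \<rho> q u)
     \<le> ennreal C * (cut_energy e k R q g)"
    if R: "R \<ge> R0" and u: "horiz_C1 e u g" for R u g
  proof -
    have R0: "R > 0" using R \<delta> by simp
    note [measurable] = horiz_C1_measurable[OF u] borel_cut_gibbs[OF R0, of e k]
    have [measurable]: "(\<lambda>p. cut_gibbs e k R p) \<in> borel_measurable borel"
      using borel_cut_gibbs[OF R0, of e k] .
    let ?J = "cut_energy e k R q g"
    let ?i = "\<lambda>p. indicator (cball 0 \<rho>) p :: ennreal"
    have shift: "horiz_C1 e (\<lambda>p. u p - c) g" for c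
      using u unfolding horiz_C1_def has_hderiv_def
      by (auto intro!: continuous_intros derivative_eq_intros)
    have "(cut_osc e k R \<rho> q u)
      \<le> (\<integral>\<^sup>+p'. ennreal C1 * (\<integral>\<^sup>+p. ennreal (\<bar>u p' - u p\<bar> powr q) * ?i p' * ?i p \<partial>lborel) + ?J * ?i p' \<partial>lborel)"
    proof (rule nn_integral_mono)
      fix p'
      show "(\<integral>\<^sup>+p. ennreal (cut_gibbs e k R p * \<bar>u p - u p'\<bar> powr q) * ?i p' \<partial>lborel)
        \<le> ennreal C1 * (\<integral>\<^sup>+p. ennreal (\<bar>u p' - u p\<bar> powr q) * ?i p' * ?i p \<partial>lborel) + ?J * ?i p'"
      proof (cases "p' \<in> cball 0 \<rho>")
        case True
        have "(\<integral>\<^sup>+p. ennreal (\<bar>u p - u p'\<bar> powr q) * indicator (cball 0 \<rho>1) p \<partial>lborel)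
          \<le> (\<integral>\<^sup>+p. ennreal (\<bar>u p' - u p\<bar> powr q) * ?i p' * ?i p \<partial>lborel)"
          using True by (intro nn_integral_mono) (auto simp: indicator_def \<rho>_def abs_minus_commute)
        then have "ennreal C1 * (\<integral>\<^sup>+p. ennreal (\<bar>u p - u p'\<bar> powr q) * indicator (cball 0 \<rho>1) p \<partial>lborel) + ?J
          \<le> ennreal C1 * (\<integral>\<^sup>+p. ennreal (\<bar>u p' - u p\<bar> powr q) * ?i p' * ?i p \<partial>lborel) + ?J"
          by (intro add_right_mono mult_left_mono) auto
        note le = order.trans[OF U[OF R0 shift[of "u p'"]] this]
        have one: "?i p' = 1" using True by simp
        show ?thesis using le unfolding one mult_1_right .
      qed simp
    qed
    also have "\<dots> = ennreal C1 * (\<integral>\<^sup>+p'. (\<integral>\<^sup>+p. ennreal (\<bar>u p' - u p\<bar> powr q) * ?i p' * ?i p \<partial>lborel) \<partial>lborel)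
        + ?J * ennreal V"
      by (subst nn_integral_add, measurable, subst nn_integral_cmult, measurable,
          subst nn_integral_cmult_indicator) (simp_all add: V)
    also have "\<dots> \<le> ennreal C1 * (ennreal C2 * (ennreal (1 / \<delta>) * ?J)) + ?J * ennreal V"
    proof (intro add_right_mono mult_left_mono order.trans[OF loc[OF u]])
      have "(ball_energy q \<rho>2 g)
        \<le> (\<integral>\<^sup>+p. ennreal (1 / \<delta>) * ennreal (cut_gibbs e k R p * norm (g p) powr q) \<partial>lborel)"
      proof (rule nn_integral_mono)
        fix p
        show "ennreal (norm (g p) powr q) * indicator (cball 0 \<rho>2) p
          \<le> ennreal (1 / \<delta>) * ennreal (cut_gibbs e k R p * norm (g p) powr q)"
        proof (cases "p \<in> cball 0 \<rho>2")
          case True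
          have "\<delta> * norm (g p) powr q \<le> cut_gibbs e k R p * norm (g p) powr q"
            using low[OF R True] by (intro mult_right_mono) auto
          then have "norm (g p) powr q \<le> 1 / \<delta> * (cut_gibbs e k R p * norm (g p) powr q)"
            using \<delta> by (simp add: field_simps)
          then have "ennreal (norm (g p) powr q) \<le> ennreal (1 / \<delta> * (cut_gibbs e k R p * norm (g p) powr q))"
            by (rule ennreal_leI)
          also have "\<dots> = ennreal (1 / \<delta>) * ennreal (cut_gibbs e k R p * norm (g p) powr q)"
            using \<delta> by (intro ennreal_mult) auto
          finally show ?thesis using True by simp
        qed simp
      qed
      also have "\<dots> = ennreal (1 / \<delta>) * ?J" by (rule nn_integral_cmult) measurable
      finally show "(ball_energy q \<rho>2 g) \<le> ennreal (1 / \<delta>) * ?J" .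
    qed auto
    also have "\<dots> = ennreal (C1 * (C2 * (1 / \<delta>))) * ?J + ennreal V * ?J"
      using C1 C2 \<delta> by (simp only: ennreal_mult divide_nonneg_nonneg zero_le_one less_imp_le mult_nonneg_nonneg mult_ac)
    also have "\<dots> = ennreal C * ?J"
      using C1 C2 \<delta> V0 by (simp add: C_def ennreal_plus distrib_right)
    finally show ?thesis .
  qed
  then show ?thesis using C \<rho> \<delta>(2) by (intro exI[of _ C] conjI exI[of _ \<rho>] exI[of _ R0]) auto
qed

section \<open>The inequality for weak sub-gradients\<close>

text \<open>The weak sub-gradient for Borel representatives, which can be used with Fubini on Borel
  product spaces.\<close>

definition weak_hgrad :: "'n::finite \<Rightarrow> ('n heis \<Rightarrow> real) \<Rightarrow> ('n heis \<Rightarrow> real ^ ('n + 'n)) \<Rightarrow> bool" where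
  "weak_hgrad e f G \<longleftrightarrow> loc_int f \<and> loc_int G \<and>
     (\<forall>i \<psi>. test_function \<psi> \<longrightarrow>
        (\<integral>h. f h * Xfield e i \<psi> h \<partial>lborel) = - (\<integral>h. G h $ i * \<psi> h \<partial>lborel))"

lemma mollify_horiz_C1:
  assumes a: "approx_unit \<epsilon> \<phi>" and w: "weak_hgrad e f G"
  shows "horiz_C1 e (mollify e \<phi> f) (mollify e \<phi> G)"
  unfolding horiz_C1_def
proof (intro conjI allI)
  have f: "loc_int f" and G: "loc_int G"
    using w by (auto simp: weak_hgrad_def)
  show "continuous_on UNIV (mollify e \<phi> f)" "continuous_on UNIV (mollify e \<phi> G)"
    by (rule mollify_continuous[OF a f], rule mollify_continuous[OF a G])
  fix i
  have "has_hderiv e i (mollify e \<phi> f) (mollify e \<phi> (\<lambda>h. G h $ i))"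
    using w by (intro mollify_has_hderiv[OF a f]) (simp add: weak_hgrad_def)
  then show "has_hderiv e i (mollify e \<phi> f) (\<lambda>p. mollify e \<phi> G p $ i)"
    by (simp add: mollify_component[OF a G])
qed

lemma approx_unit_mono: "approx_unit \<epsilon> \<phi> \<Longrightarrow> \<epsilon> \<le> \<epsilon>' \<Longrightarrow> approx_unit \<epsilon>' \<phi>"
  unfolding approx_unit_def by auto

text \<open>The weight is compared with its mollifications almost everywhere, so the origin is left out.\<close>

lemma isCont_cut_gibbs:
  assumes R: "R > 0" and h: "h \<noteq> 0"
  shows "isCont (\<lambda>g. cut_gibbs e k R (heis_mult e g h)) 0"
proof -
  have "continuous_on {p. 0 < hP e p} (cut_gibbs e k R)"
    by (intro continuous_intros continuous_on_gibbs
        continuous_on_compose2[OF continuous_on_outer_cut[OF R, of UNIV]]) auto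
  then have c: "isCont (cut_gibbs e k R) h"
    by (rule continuous_on_eq_continuous_at[OF open_hP_pos, THEN iffD1, THEN bspec])
       (use h in \<open>simp add: hP_pos_iff\<close>)
  have "continuous_on UNIV (\<lambda>g. heis_mult e g h)" by (intro continuous_intros)
  then have "isCont (\<lambda>g. heis_mult e g h) 0"
    unfolding continuous_on_eq_continuous_at[OF open_UNIV] by blast
  then show ?thesis
    using isCont_o2[of 0 "\<lambda>g. heis_mult e g h" "cut_gibbs e k R"] c by simp
qed

text \<open>The inequality for the mollified functions passes to the limit: on the gradient side Jensen moves
  the mollification onto the weight, which converges boundedly with fixed bounded support; on
  the other side a subsequence converges almost everywhere and Fatou applies.\<close>

lemma cutoff_poincare:
  fixes e :: "'n::finite"
  assumes R: "R > 0" and q: "q \<ge> 1" and C: "C \<ge> 0"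
    and ineq: "\<And>u g. horiz_C1 e u g \<Longrightarrow>
      (cut_osc e k R \<rho> q u)
       \<le> ennreal C * (cut_energy e k R q g)"
    and w: "weak_hgrad e f G"
    and fin: "\<And>r. (ball_energy q r G) < \<infinity>"
  shows "(cut_osc e k R \<rho> q f)
     \<le> ennreal C * (\<integral>\<^sup>+p. ennreal (norm (G p) powr q) * ennreal (cut_gibbs e k R p) \<partial>lborel)"
proof -
  have f: "loc_int f" and G: "loc_int G"
    using w by (auto simp: weak_hgrad_def)
  note [measurable] = loc_int_measurable[OF f] loc_int_measurable[OF G]
  have [measurable]: "(\<lambda>p. cut_gibbs e k R p) \<in> borel_measurable borel" by (rule borel_cut_gibbs[OF R])
  have "\<exists>\<phi>. \<forall>m. approx_unit (1 / real (Suc m)) (\<phi> m :: 'n heis \<Rightarrow> real)"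
    by (intro choice allI approx_unit_exists) simp
  then obtain \<phi>0 where a0: "\<And>m. approx_unit (1 / real (Suc m)) (\<phi>0 m :: 'n heis \<Rightarrow> real)" by blast
  define \<rho>3 where "\<rho>3 = max \<rho> (2 * R + 2)"
  obtain r where r: "strict_mono r"
    and AE0: "AE p in lborel. norm p \<le> \<rho>3 \<longrightarrow> (\<lambda>m. mollify e (\<phi>0 (r m)) f p) \<longlonglongrightarrow> f p"
    using mollify_AE_subseq[OF a0 f, of \<rho>3 e] by blast
  define \<phi> where "\<phi> m = \<phi>0 (r m)" for m
  have a: "approx_unit (1 / real (Suc m)) (\<phi> m)" for m
    unfolding \<phi>_def using seq_suble[OF r, of m]
    by (intro approx_unit_mono[OF a0]) (auto intro!: divide_left_mono)
  have AE: "AE p in lborel. norm p \<le> \<rho>3 \<longrightarrow> (\<lambda>m. mollify e (\<phi> m) f p) \<longlonglongrightarrow> f p"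
    using AE0 by (simp add: \<phi>_def)
  let ?u = "\<lambda>m. mollify e (\<phi> m) f" and ?g = "\<lambda>m. mollify e (\<phi> m) G"
  let ?i = "\<lambda>p. indicator (cball 0 \<rho>) p :: ennreal"
  have [measurable]: "?u m \<in> borel_measurable borel" "?g m \<in> borel_measurable borel" for m
    by (auto intro!: borel_measurable_continuous_onI mollify_continuous[OF a] f G)
  let ?W = "\<lambda>m h. \<integral>\<^sup>+x. ennreal (\<phi> m x) * ennreal (cut_gibbs e k R (heis_mult e x h)) \<partial>lborel"
  have [measurable]: "\<phi> m \<in> borel_measurable borel" for m
    by (rule approx_unit_measurable[OF a])
  have J: "(\<lambda>m. ennreal C * (\<integral>\<^sup>+h. ennreal (norm (G h) powr q) * ?W m h \<partial>lborel))
    \<longlonglongrightarrow> ennreal C * (\<integral>\<^sup>+h. ennreal (norm (G h) powr q) * ennreal (cut_gibbs e k R h) \<partial>lborel)"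
  proof (rule ennreal_tendsto_cmult)
    obtain r4 where r4: "\<And>g p. norm g \<le> 1 \<Longrightarrow> norm p \<le> 2 * R + 2 \<Longrightarrow> norm (heis_mult e g p) \<le> r4"
      using heis_mult_bounded[of 1 "2 * R + 2" e] by blast
    show "(\<lambda>m. \<integral>\<^sup>+h. ennreal (norm (G h) powr q) * ?W m h \<partial>lborel)
      \<longlonglongrightarrow> (\<integral>\<^sup>+h. ennreal (norm (G h) powr q) * ennreal (cut_gibbs e k R h) \<partial>lborel)"
    proof (rule nn_integral_dominated_convergence[where w = "\<lambda>h. ennreal (norm (G h) powr q) * indicator (cball 0 r4) h"])
      show "(\<integral>\<^sup>+h. ennreal (norm (G h) powr q) * indicator (cball 0 r4) h \<partial>lborel) < \<infinity>" by (rule fin)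
      have ind: "ennreal (cut_gibbs e k R p) \<le> indicator (cball 0 (2 * R + 2)) p" for p
        using cut_gibbs_bounds[OF R, of e p k] cut_gibbs_support[OF R, of p e k] by (auto simp: indicator_def not_le)
      show "AE h in lborel. ennreal (norm (G h) powr q) * ?W m h \<le> ennreal (norm (G h) powr q) * indicator (cball 0 r4) h" for m
        by (intro AE_I2 mult_left_mono mollified_weight_le_indicator[OF a _ ind r4]) auto
      show "AE h in lborel. (\<lambda>m. ennreal (norm (G h) powr q) * ?W m h) \<longlonglongrightarrow> ennreal (norm (G h) powr q) * ennreal (cut_gibbs e k R h)"
        using AE_lborel_singleton[of "0 :: 'n heis"]
      proof eventually_elim
        case (elim h)
        have "(\<lambda>m. \<integral>x. \<phi> m x * cut_gibbs e k R (heis_mult e x h) \<partial>lborel) \<longlonglongrightarrow> cut_gibbs e k R (heis_mult e 0 h)"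
          by (rule approx_identity[OF a _ _ isCont_cut_gibbs[OF R elim], where M = 1])
             (use cut_gibbs_bounds[OF R, where e = e and k = k] in auto)
        then have "(\<lambda>m. ennreal (\<integral>x. \<phi> m x * cut_gibbs e k R (heis_mult e x h) \<partial>lborel)) \<longlonglongrightarrow> ennreal (cut_gibbs e k R h)"
          by (simp add: tendsto_ennrealI)
        moreover have "?W m h = ennreal (\<integral>x. \<phi> m x * cut_gibbs e k R (heis_mult e x h) \<partial>lborel)" for m
        proof -
          have "?W m h = (\<integral>\<^sup>+x. ennreal (\<phi> m x * cut_gibbs e k R (heis_mult e x h)) \<partial>lborel)"
            using approx_unitD(2)[OF a] cut_gibbs_bounds[OF R, where e = e and k = k] by (intro nn_integral_cong) (simp add: ennreal_mult)
          also have "\<dots> = ennreal (\<integral>x. \<phi> m x * cut_gibbs e k R (heis_mult e x h) \<partial>lborel)"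
          proof (rule nn_integral_eq_integral)
            show "integrable lborel (\<lambda>x. \<phi> m x * cut_gibbs e k R (heis_mult e x h))"
              using cut_gibbs_bounds[OF R, where e = e and k = k]
              by (intro integrable_bounded_mult approx_unit_integrable[OF a]) auto
          qed (use approx_unitD(2)[OF a] cut_gibbs_bounds[OF R, where e = e and k = k] in auto)
          finally show ?thesis .
        qed
        ultimately show ?case by (intro ennreal_tendsto_cmult) auto
      qed
    qed measurable
  qed simp
  show ?thesis
  proof (rule double_fatou[OF _ _ _ J])
    show "(\<lambda>z. ennreal (cut_gibbs e k R (snd z) * \<bar>?u m (snd z) - ?u m (fst z)\<bar> powr q) * ?i (fst z)) \<in> borel_measurable borel" for m
    proof -
      have [measurable]: "fst \<in> borel_measurable (borel :: ('n heis \<times> 'n heis) measure)"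
        "snd \<in> borel_measurable (borel :: ('n heis \<times> 'n heis) measure)"
        by (auto intro!: borel_measurable_continuous_onI continuous_intros)
      show ?thesis by measurable
    qed
    show "AE p' in lborel. AE p in lborel. (\<lambda>m. ennreal (cut_gibbs e k R p * \<bar>?u m p - ?u m p'\<bar> powr q) * ?i p')
        \<longlonglongrightarrow> ennreal (cut_gibbs e k R p * \<bar>f p - f p'\<bar> powr q) * ?i p'"
      using AE
    proof eventually_elim
      case (elim p')
      note p' = elim
      show ?case
        using AE
      proof eventually_elim
        case (elim p)
        show ?case
        proof (cases "norm p' \<le> \<rho> \<and> norm p \<le> 2 * R + 2")
          case True
          then have "(\<lambda>m. ?u m p) \<longlonglongrightarrow> f p" "(\<lambda>m. ?u m p') \<longlonglongrightarrow> f p'"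
            using elim p' by (auto simp: \<rho>3_def)
          then have "(\<lambda>m. cut_gibbs e k R p * \<bar>?u m p - ?u m p'\<bar> powr q) \<longlonglongrightarrow> cut_gibbs e k R p * \<bar>f p - f p'\<bar> powr q"
            using q by (intro tendsto_intros tendsto_powr') auto
          then show ?thesis using True by (simp add: tendsto_ennrealI)
        next
          case False
          then have "cut_gibbs e k R p = 0 \<or> ?i p' = 0" using cut_gibbs_support[OF R, of p e k] by auto
          then show ?thesis by auto
        qed
      qed
    qed
    show "(cut_osc e k R \<rho> q (?u m))
      \<le> ennreal C * (\<integral>\<^sup>+h. ennreal (norm (G h) powr q) * ?W m h \<partial>lborel)" for m
    proof -
      have "(cut_osc e k R \<rho> q (?u m))
        \<le> ennreal C * (\<integral>\<^sup>+p. ennreal (cut_gibbs e k R p * norm (?g m p) powr q) \<partial>lborel)"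
        by (rule ineq[OF mollify_horiz_C1[OF a w]])
      also have "(\<integral>\<^sup>+p. ennreal (cut_gibbs e k R p * norm (?g m p) powr q) \<partial>lborel)
        \<le> (\<integral>\<^sup>+p. ennreal (cut_gibbs e k R p) * (\<integral>\<^sup>+x. ennreal (\<phi> m x) * ennreal (norm (G (heis_mult e (- x) p)) powr q) \<partial>lborel) \<partial>lborel)"
        using mollify_jensen[OF a G q, of e m] cut_gibbs_bounds[OF R, where e = e and k = k]
        by (intro nn_integral_mono) (simp add: ennreal_mult mult_left_mono)
      also have "\<dots> = (\<integral>\<^sup>+h. ennreal (norm (G h) powr q) * ?W m h \<partial>lborel)"
        by (rule mollified_weight[OF a, of "\<lambda>h. ennreal (norm (G h) powr q)" "\<lambda>p. ennreal (cut_gibbs e k R p)"]) measurable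
      finally show ?thesis by (simp add: mult_left_mono)
    qed
  qed
qed

lemma outer_cut_tendsto: "(\<lambda>j. outer_cut (R0 + real j) x) \<longlonglongrightarrow> 1"
proof -
  have "(\<lambda>j. x / (R0 + real j)) \<longlonglongrightarrow> 0" by real_asymp
  then have "(\<lambda>j. max 0 (1 - x / (R0 + real j))) \<longlonglongrightarrow> max 0 (1 - 0)"
    by (intro tendsto_intros)
  then have "(\<lambda>j. max 0 (1 - x / (R0 + real j)) powr 2) \<longlonglongrightarrow> max 0 (1 - 0) powr 2"
    by (intro tendsto_powr tendsto_const) auto
  then show ?thesis by (simp add: outer_cut_def)
qed

text \<open>The cutoff is removed by \<open>R \<rightarrow> \<infinity>\<close>. A finite weighted energy is locally finite because the weight is bounded
  below on balls.\<close>

lemma weighted_poincare_double: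
  fixes e :: "'n::finite"
  assumes k: "k \<ge> 1" and q: "q \<ge> 2" and n: "CARD('n) \<ge> 3"
  shows "\<exists>C\<ge>0. \<exists>\<rho>>0. \<forall>f G. weak_hgrad e f G \<longrightarrow>
    (gibbs_energy e k q G) < \<infinity> \<longrightarrow>
    (gibbs_osc e k \<rho> q f)
     \<le> ennreal C * (gibbs_energy e k q G)"
proof -
  obtain C \<rho> R0 where C: "C \<ge> 0" "\<rho> > 0" "R0 > 0" and sm: "\<And>R u g. R \<ge> R0 \<Longrightarrow> horiz_C1 e u g \<Longrightarrow>
    (cut_osc e k R \<rho> q u)
     \<le> ennreal C * (cut_energy e k R q g)"
    using smooth_poincare[OF k q n, of e] by blast
  have "(gibbs_osc e k \<rho> q f)
     \<le> ennreal C * (gibbs_energy e k q G)"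
    if w: "weak_hgrad e f G" and fin: "(gibbs_energy e k q G) < \<infinity>" for f G
  proof -
    have f: "loc_int f" and G: "loc_int G"
      using w by (auto simp: weak_hgrad_def)
    note [measurable] = loc_int_measurable[OF f] loc_int_measurable[OF G]
    have finr: "(ball_energy q r G) < \<infinity>" for r
    proof -
      obtain \<delta> where \<delta>: "\<delta> > 0" "\<And>p. p \<in> cball 0 r \<Longrightarrow> \<delta> \<le> gibbs e k p"
        using gibbs_lower[of k r e] k by auto
      have "(ball_energy q r G)
        \<le> (\<integral>\<^sup>+p. ennreal (1 / \<delta>) * (ennreal (norm (G p) powr q) * ennreal (gibbs e k p)) \<partial>lborel)"
      proof (rule nn_integral_mono)
        fix p
        show "ennreal (norm (G p) powr q) * indicator (cball 0 r) p
          \<le> ennreal (1 / \<delta>) * (ennreal (norm (G p) powr q) * ennreal (gibbs e k p))"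
        proof (cases "p \<in> cball 0 r")
          case True
          have "norm (G p) powr q * 1 \<le> norm (G p) powr q * (1 / \<delta> * gibbs e k p)"
            using \<delta>(1) \<delta>(2)[OF True] by (intro mult_left_mono) (auto simp: field_simps)
          then have "norm (G p) powr q \<le> 1 / \<delta> * (norm (G p) powr q * gibbs e k p)"
            by (simp add: mult_ac)
          then have "ennreal (norm (G p) powr q) \<le> ennreal (1 / \<delta> * (norm (G p) powr q * gibbs e k p))"
            by (rule ennreal_leI)
          also have "\<dots> = ennreal (1 / \<delta>) * (ennreal (norm (G p) powr q) * ennreal (gibbs e k p))"
            using \<delta>(1) by (subst ennreal_mult, simp, simp, subst ennreal_mult) simp_all
          finally show ?thesis using True by simp
        qed simp
      qed
      also have "\<dots> = ennreal (1 / \<delta>) * (gibbs_energy e k q G)"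
        by (rule nn_integral_cmult) measurable
      also have "\<dots> < \<infinity>" using fin by (simp add: ennreal_mult_less_top)
      finally show ?thesis .
    qed
    show ?thesis
    proof (rule double_fatou[OF _ _ _ tendsto_const])
      fix j :: nat
      have Rj: "R0 + real j > 0" "R0 + real j \<ge> R0" using C by auto
      have [measurable]: "(\<lambda>p. cut_gibbs e k (R0 + real j) p) \<in> borel_measurable borel" by (rule borel_cut_gibbs[OF Rj(1)])
      have [measurable]: "fst \<in> borel_measurable (borel :: ('n heis \<times> 'n heis) measure)"
        "snd \<in> borel_measurable (borel :: ('n heis \<times> 'n heis) measure)"
        by (auto intro!: borel_measurable_continuous_onI continuous_intros)
      show "(\<lambda>z. ennreal (cut_gibbs e k (R0 + real j) (snd z) * \<bar>f (snd z) - f (fst z)\<bar> powr q) * indicator (cball 0 \<rho>) (fst z)) \<in> borel_measurable borel"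
        by measurable
      have "(cut_osc e k (R0 + real j) \<rho> q f)
         \<le> ennreal C * (\<integral>\<^sup>+p. ennreal (norm (G p) powr q) * ennreal (cut_gibbs e k (R0 + real j) p) \<partial>lborel)"
        by (rule cutoff_poincare[OF Rj(1) _ C(1) sm[OF Rj(2)] w finr]) (use q in auto)
      also have "\<dots> \<le> ennreal C * (gibbs_energy e k q G)"
        using outer_cut_le_1[OF Rj(1) hP_nonneg, of e]
        by (intro mult_left_mono nn_integral_mono ennreal_leI) (auto intro: mult_left_le_one_le)
      finally show "(cut_osc e k (R0 + real j) \<rho> q f)
         \<le> ennreal C * (gibbs_energy e k q G)" .
    next
      show "AE p' in lborel. AE p in lborel. (\<lambda>j. ennreal (cut_gibbs e k (R0 + real j) p * \<bar>f p - f p'\<bar> powr q) * indicator (cball 0 \<rho>) p')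
          \<longlonglongrightarrow> ennreal (gibbs e k p * \<bar>f p - f p'\<bar> powr q) * indicator (cball 0 \<rho>) p'"
      proof (intro AE_I2)
        fix p' p
        have "(\<lambda>j. cut_gibbs e k (R0 + real j) p * \<bar>f p - f p'\<bar> powr q) \<longlonglongrightarrow> 1 * gibbs e k p * \<bar>f p - f p'\<bar> powr q"
          by (intro tendsto_intros outer_cut_tendsto)
        then show "(\<lambda>j. ennreal (cut_gibbs e k (R0 + real j) p * \<bar>f p - f p'\<bar> powr q) * indicator (cball 0 \<rho>) p')
          \<longlonglongrightarrow> ennreal (gibbs e k p * \<bar>f p - f p'\<bar> powr q) * indicator (cball 0 \<rho>) p'"
          by (cases "p' \<in> cball 0 \<rho>") (auto simp: tendsto_ennrealI)
      qed
    qed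
  qed
  then show ?thesis using C by (intro exI[of _ C] conjI exI[of _ \<rho>]) auto
qed

lemma jensen_cball:
  fixes f :: "'n::finite heis \<Rightarrow> real"
  assumes f: "loc_int f" and q: "q \<ge> 1" and \<rho>: "\<rho> > 0"
    and V: "emeasure lborel (cball 0 \<rho> :: 'n heis set) = ennreal V" "V > 0"
  shows "ennreal (\<bar>c - (\<integral>p. indicator (cball 0 \<rho>) p * f p \<partial>lborel) / V\<bar> powr q)
    \<le> ennreal (1 / V) * (\<integral>\<^sup>+p. ennreal (\<bar>c - f p\<bar> powr q) * indicator (cball 0 \<rho>) p \<partial>lborel)"
proof -
  note [measurable] = loc_int_measurable[OF f]
  let ?d = "\<lambda>p :: 'n heis. indicator (cball 0 \<rho>) p * (1 / V) :: real"
  let ?M = "density lborel (\<lambda>p. ennreal (?d p))"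
  have nn: "0 \<le> ?d p" for p using V by simp
  have e: "ennreal (?d p) = ennreal (1 / V) * indicator (cball 0 \<rho>) p" for p
    by (auto simp: indicator_def)
  interpret prob_space ?M
  proof (rule prob_spaceI)
    have "emeasure ?M (space ?M) = (\<integral>\<^sup>+p. ennreal (1 / V) * indicator (cball (0 :: 'n heis) \<rho>) p \<partial>lborel)"
    proof (subst emeasure_density)
      show "(\<integral>\<^sup>+p. ennreal (?d p) * indicator (space ?M) p \<partial>lborel)
        = (\<integral>\<^sup>+p. ennreal (1 / V) * indicator (cball (0 :: 'n heis) \<rho>) p \<partial>lborel)"
        unfolding e by simp
    qed measurable
    also have "\<dots> = ennreal (1 / V) * ennreal V"
      by (subst nn_integral_cmult_indicator) (auto simp: V)
    also have "\<dots> = 1" using V by (simp flip: ennreal_mult)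
    finally show "emeasure ?M (space ?M) = 1" .
  qed
  have if': "integrable lborel (\<lambda>p. indicator (cball 0 \<rho>) p *\<^sub>R f p)" using f by (simp add: loc_int_def)
  have ic: "integrable lborel (\<lambda>p. indicator (cball (0 :: 'n heis) \<rho>) p *\<^sub>R c)"
    by (rule borel_integrable_compact) auto
  have vol: "(\<integral>p. indicator (cball (0 :: 'n heis) \<rho>) p \<partial>lborel) = V"
    using V by (simp add: measure_def)
  have "integrable lborel (\<lambda>p. (1 / V) * (indicator (cball 0 \<rho>) p *\<^sub>R c - indicator (cball 0 \<rho>) p *\<^sub>R f p))"
    by (intro integrable_mult_right Bochner_Integration.integrable_diff ic if')
  then have i: "integrable lborel (\<lambda>p. ?d p *\<^sub>R (c - f p))"
    by (simp add: algebra_simps diff_divide_distrib)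
  then have iM: "integrable ?M (\<lambda>p. c - f p)"
    using nn by (subst integrable_density) auto
  have "(\<integral>p. c - f p \<partial>?M) = (\<integral>p. ?d p *\<^sub>R (c - f p) \<partial>lborel)"
    using nn by (subst integral_density) auto
  also have "\<dots> = (\<integral>p. (1 / V) * (indicator (cball 0 \<rho>) p *\<^sub>R c - indicator (cball 0 \<rho>) p *\<^sub>R f p) \<partial>lborel)"
    by (intro Bochner_Integration.integral_cong refl) (simp add: algebra_simps diff_divide_distrib)
  also have "\<dots> = (1 / V) * (V * c - (\<integral>p. indicator (cball 0 \<rho>) p * f p \<partial>lborel))"
    using Bochner_Integration.integral_diff[OF ic if'] vol by simp
  also have "\<dots> = c - (\<integral>p. indicator (cball 0 \<rho>) p * f p \<partial>lborel) / V"
    using V by (simp add: right_diff_distrib)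
  finally have int: "(\<integral>p. c - f p \<partial>?M) = c - (\<integral>p. indicator (cball 0 \<rho>) p * f p \<partial>lborel) / V" .
  have "ennreal (norm (\<integral>p. c - f p \<partial>?M) powr q) \<le> (\<integral>\<^sup>+p. ennreal (norm (c - f p) powr q) \<partial>?M)"
    by (rule jensen_powr[OF iM q])
  also have "\<dots> = (\<integral>\<^sup>+p. ennreal (?d p) * ennreal (norm (c - f p) powr q) \<partial>lborel)"
    by (rule nn_integral_density) measurable
  also have "\<dots> = (\<integral>\<^sup>+p. ennreal (1 / V) * (ennreal (\<bar>c - f p\<bar> powr q) * indicator (cball 0 \<rho>) p) \<partial>lborel)"
    unfolding e by (simp add: mult_ac)
  also have "\<dots> = ennreal (1 / V) * (\<integral>\<^sup>+p. ennreal (\<bar>c - f p\<bar> powr q) * indicator (cball 0 \<rho>) p \<partial>lborel)"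
    by (rule nn_integral_cmult) measurable
  finally show ?thesis unfolding int by simp
qed

text \<open>The constant \<open>a\<close> is the mean of \<open>f\<close> over the ball; Jensen bounds \<open>\<bar>f p - a\<bar>\<^sup>q\<close> by the mean of
  \<open>\<bar>f p - f p'\<bar>\<^sup>q\<close> over \<open>p'\<close>.\<close>

lemma weighted_poincare:
  fixes e :: "'n::finite"
  assumes k: "k \<ge> 1" and q: "q \<ge> 2" and n: "CARD('n) \<ge> 3"
  shows "\<exists>C\<ge>0. \<forall>f G. weak_hgrad e f G \<longrightarrow>
    (gibbs_energy e k q G) < \<infinity> \<longrightarrow>
    (\<exists>a. (\<integral>\<^sup>+p. ennreal (\<bar>f p - a\<bar> powr q) * ennreal (gibbs e k p) \<partial>lborel)
     \<le> ennreal C * (gibbs_energy e k q G))"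
proof -
  obtain C \<rho> where C: "C \<ge> 0" "\<rho> > 0" and main: "\<And>f G. weak_hgrad e f G \<Longrightarrow>
    (gibbs_energy e k q G) < \<infinity> \<Longrightarrow>
    (gibbs_osc e k \<rho> q f)
     \<le> ennreal C * (gibbs_energy e k q G)"
    using weighted_poincare_double[OF k q n, of e] by blast
  define V where "V = measure lborel (cball 0 \<rho> :: 'n heis set)"
  have V: "emeasure lborel (cball 0 \<rho> :: 'n heis set) = ennreal V"
    unfolding V_def using emeasure_compact_finite[OF compact_cball, of 0 \<rho>]
    by (intro emeasure_eq_ennreal_measure) (simp add: less_top)
  have V0: "V > 0" unfolding V_def using content_cball_pos[OF C(2), of "0 :: 'n heis"] by simp
  have "\<exists>a. (\<integral>\<^sup>+p. ennreal (\<bar>f p - a\<bar> powr q) * ennreal (gibbs e k p) \<partial>lborel)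
     \<le> ennreal (C / V) * (gibbs_energy e k q G)"
    if w: "weak_hgrad e f G" and fin: "(gibbs_energy e k q G) < \<infinity>" for f G
  proof -
    let ?J = "gibbs_energy e k q G"
    have f: "loc_int f" using w by (auto simp: weak_hgrad_def)
    note [measurable] = loc_int_measurable[OF f]
    define a where "a = (\<integral>p. indicator (cball 0 \<rho>) p * f p \<partial>lborel) / V"
    let ?H = "\<lambda>p p'. ennreal (gibbs e k p * \<bar>f p - f p'\<bar> powr q) * indicator (cball 0 \<rho>) p'"
    have "(\<integral>\<^sup>+p. ennreal (\<bar>f p - a\<bar> powr q) * ennreal (gibbs e k p) \<partial>lborel)
      \<le> (\<integral>\<^sup>+p. ennreal (1 / V) * (\<integral>\<^sup>+p'. ?H p p' \<partial>lborel) \<partial>lborel)"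
    proof (rule nn_integral_mono)
      fix p
      have "ennreal (\<bar>f p - a\<bar> powr q) * ennreal (gibbs e k p)
        \<le> (ennreal (1 / V) * (\<integral>\<^sup>+p'. ennreal (\<bar>f p - f p'\<bar> powr q) * indicator (cball 0 \<rho>) p' \<partial>lborel)) * ennreal (gibbs e k p)"
        using jensen_cball[OF f _ C(2) V V0, of q "f p"] q by (intro mult_right_mono) (auto simp: a_def)
      also have "\<dots> = ennreal (1 / V) * (\<integral>\<^sup>+p'. ennreal (gibbs e k p) * (ennreal (\<bar>f p - f p'\<bar> powr q) * indicator (cball 0 \<rho>) p') \<partial>lborel)"
        by (subst nn_integral_cmult) (auto simp: mult_ac)
      also have "(\<integral>\<^sup>+p'. ennreal (gibbs e k p) * (ennreal (\<bar>f p - f p'\<bar> powr q) * indicator (cball 0 \<rho>) p') \<partial>lborel)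
          = (\<integral>\<^sup>+p'. ?H p p' \<partial>lborel)"
        by (intro nn_integral_cong) (simp add: ennreal_mult mult.assoc)
      finally show "ennreal (\<bar>f p - a\<bar> powr q) * ennreal (gibbs e k p) \<le> ennreal (1 / V) * (\<integral>\<^sup>+p'. ?H p p' \<partial>lborel)" .
    qed
    also have "\<dots> = ennreal (1 / V) * (\<integral>\<^sup>+p. (\<integral>\<^sup>+p'. ?H p p' \<partial>lborel) \<partial>lborel)"
      by (rule nn_integral_cmult) measurable
    also have "(\<integral>\<^sup>+p. (\<integral>\<^sup>+p'. ?H p p' \<partial>lborel) \<partial>lborel) = (\<integral>\<^sup>+p'. (\<integral>\<^sup>+p. ?H p p' \<partial>lborel) \<partial>lborel)"
      by (rule lborel_pair.Fubini') measurable
    also have "ennreal (1 / V) * \<dots> \<le> ennreal (1 / V) * (ennreal C * ?J)"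
      by (intro mult_left_mono main[OF w fin]) simp
    also have "\<dots> = ennreal (C / V) * ?J"
    proof -
      have "ennreal (1 / V) * ennreal C = ennreal (C / V)"
        using C V0 by (simp flip: ennreal_mult)
      then show ?thesis by (simp flip: mult.assoc)
    qed
    finally show ?thesis by blast
  qed
  then show ?thesis using C V0 by (intro exI[of _ "C / V"]) auto
qed

section \<open>The normalised measure\<close>

lemma locally_integrable_borel_rep:
  fixes f :: "'n::finite heis \<Rightarrow> real"
  assumes f: "locally_integrable f"
  shows "f \<in> borel_measurable lebesgue" "\<exists>f'. loc_int f' \<and> (AE x in lborel. f x = f' x)"
proof -
  have i: "integrable lebesgue (\<lambda>x. indicator (cball 0 \<rho>) x *\<^sub>R f x)" for \<rho>
    using f by (auto simp: locally_integrable_def set_integrable_def)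
  show m: "f \<in> borel_measurable lebesgue"
  proof (rule borel_measurable_LIMSEQ_real[where u = "\<lambda>n x. indicator (cball 0 (real n)) x *\<^sub>R f x"])
    show "(\<lambda>x. indicator (cball 0 (real n)) x *\<^sub>R f x) \<in> borel_measurable lebesgue" for n
      using i by blast
    fix x :: "'n heis"
    have "eventually (\<lambda>n. real n \<ge> norm x) sequentially" by real_asymp
    then show "(\<lambda>n. indicator (cball 0 (real n)) x *\<^sub>R f x) \<longlonglongrightarrow> f x"
      by (intro tendsto_eventually, elim eventually_mono) (simp add: indicator_def)
  qed
  obtain f' where f': "f' \<in> borel_measurable lborel" "AE x in lborel. f x = f' x"
    using completion_ex_borel_measurable_real[OF m] by blast
  have [measurable]: "f' \<in> borel_measurable borel" using f' by simp
  have "integrable lborel (\<lambda>x. indicator (cball 0 \<rho>) x *\<^sub>R f' x)" for \<rho>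
  proof -
    have "integrable lebesgue (\<lambda>x. indicator (cball 0 \<rho>) x *\<^sub>R f' x)"
    proof (rule integrable_cong_AE_imp[OF i[of \<rho>]])
      show "(\<lambda>x. indicator (cball 0 \<rho>) x *\<^sub>R f' x) \<in> borel_measurable lebesgue"
        by (rule measurable_completion) measurable
      show "AE x in lebesgue. indicator (cball 0 \<rho>) x *\<^sub>R f x = indicator (cball 0 \<rho>) x *\<^sub>R f' x"
        using AE_completion[OF f'(2)] by eventually_elim simp
    qed
    then show ?thesis by (subst (asm) integrable_completion) measurable
  qed
  then show "\<exists>f'. loc_int f' \<and> (AE x in lborel. f x = f' x)"
    using f'(2) by (intro exI[of _ f']) (auto simp: loc_int_def)
qed

lemma integral_lebesgue_eq_borel_rep:
  fixes f f' w :: "'n::finite heis \<Rightarrow> real"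
  assumes f: "f \<in> borel_measurable lebesgue" and [measurable]: "f' \<in> borel_measurable borel" "w \<in> borel_measurable borel"
    and ae: "AE x in lborel. f x = f' x"
  shows "(\<integral>x. f x * w x \<partial>lebesgue) = (\<integral>x. f' x * w x \<partial>lborel)"
proof -
  have "(\<integral>x. f x * w x \<partial>lebesgue) = (\<integral>x. f' x * w x \<partial>lebesgue)"
  proof (rule integral_cong_AE)
    have "w \<in> borel_measurable lebesgue" by (rule measurable_completion) measurable
    then show "(\<lambda>x. f x * w x) \<in> borel_measurable lebesgue" using f by (intro borel_measurable_times)
    show "(\<lambda>x. f' x * w x) \<in> borel_measurable lebesgue" by (rule measurable_completion) measurable
    show "AE x in lebesgue. f x * w x = f' x * w x"
      using AE_completion[OF ae] by eventually_elim simp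
  qed
  also have "\<dots> = (\<integral>x. f' x * w x \<partial>lborel)" by (rule integral_completion) measurable
  finally show ?thesis .
qed

lemma weak_subgradient_borel_rep:
  fixes e :: "'n::finite"
  assumes w: "weak_subgradient e f G"
  shows "\<exists>f' G'. weak_hgrad e f' G' \<and> (AE x in lborel. f x = f' x) \<and> (AE x in lborel. G x = G' x)"
proof -
  have lf: "locally_integrable f" and lG: "\<And>i. locally_integrable (\<lambda>p. G p $ i)"
    and weak: "\<And>i \<phi>. test_function \<phi> \<Longrightarrow>
       (\<integral>p. f p * Xfield e i \<phi> p \<partial>lebesgue) = - (\<integral>p. G p $ i * \<phi> p \<partial>lebesgue)"
    using w by (auto simp: weak_subgradient_def)
  obtain f' where f': "loc_int f'" "AE x in lborel. f x = f' x"
    using locally_integrable_borel_rep(2)[OF lf] by blast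
  have "\<forall>i. \<exists>g. loc_int g \<and> (AE x in lborel. G x $ i = g x)"
    using locally_integrable_borel_rep(2)[OF lG] by blast
  then obtain g where g: "\<And>i. loc_int (g i)" "\<And>i. AE x in lborel. G x $ i = g i x" by metis
  define G' where "G' x = (\<Sum>i\<in>UNIV. g i x *\<^sub>R axis i (1::real))" for x
  have comp: "G' x $ i = g i x" for x i
    by (simp add: G'_def axis_def if_distrib cong: if_cong)
  have G': "loc_int G'"
    unfolding loc_int_def
  proof (intro conjI allI)
    note [measurable] = loc_int_measurable[OF g(1)]
    show "G' \<in> borel_measurable borel" unfolding G'_def by measurable
    fix \<rho>
    have "integrable lborel (\<lambda>h. \<Sum>i\<in>UNIV. (indicator (cball 0 \<rho>) h *\<^sub>R g i h) *\<^sub>R axis i (1::real))"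
      using g(1) by (intro Bochner_Integration.integrable_sum integrable_scaleR_left) (simp add: loc_int_def)
    then show "integrable lborel (\<lambda>h. indicator (cball 0 \<rho>) h *\<^sub>R G' h)"
      by (simp add: G'_def scaleR_sum_right)
  qed
  have "AE x in lborel. \<forall>i\<in>UNIV. G x $ i = g i x"
    using g(2) by (intro AE_finite_allI) auto
  then have GG': "AE x in lborel. G x = G' x"
    by eventually_elim (simp add: vec_eq_iff comp)
  have "(\<integral>h. f' h * Xfield e i \<psi> h \<partial>lborel) = - (\<integral>h. G' h $ i * \<psi> h \<partial>lborel)"
    if t: "test_function \<psi>" for i \<psi>
  proof -
    have C: "Cm m \<psi>" for m using t by (simp add: test_function_def)
    have X: "Xfield e i \<psi> \<in> borel_measurable borel"
      by (intro borel_measurable_continuous_onI continuous_Xfield C)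
    have P: "\<psi> \<in> borel_measurable borel" using C[of 0] by (intro borel_measurable_continuous_onI) simp
    show ?thesis
      using weak[OF t, of i]
      unfolding integral_lebesgue_eq_borel_rep[OF locally_integrable_borel_rep(1)[OF lf] loc_int_measurable[OF f'(1)] X f'(2)]
        integral_lebesgue_eq_borel_rep[OF locally_integrable_borel_rep(1)[OF lG] loc_int_measurable[OF g(1)] P g(2)] comp .
  qed
  then have "weak_hgrad e f' G'" using f'(1) G' by (simp add: weak_hgrad_def)
  then show ?thesis using f'(2) GG' by blast
qed

lemma nn_integral_heis_measure:
  fixes e :: "'n::finite"
  assumes F: "F' \<in> borel_measurable borel" and ae: "AE x in lborel. F x = F' x" and Z: "heis_Z e k > 0"
  shows "(\<integral>\<^sup>+p. F p \<partial>heis_measure e k) = ennreal (1 / heis_Z e k) * (\<integral>\<^sup>+p. F' p * ennreal (gibbs e k p) \<partial>lborel)"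
proof -
  note [measurable] = F
  let ?d = "\<lambda>p. ennreal (gibbs e k p / heis_Z e k)"
  have M: "heis_measure e k = density lebesgue ?d" by (simp add: heis_measure_def gibbs_def)
  have dm: "?d \<in> borel_measurable lebesgue" by (rule measurable_completion) measurable
  have d: "?d p = ennreal (1 / heis_Z e k) * ennreal (gibbs e k p)" for p
    using Z by (subst ennreal_mult[symmetric]) auto
  have Fm: "F' \<in> borel_measurable lebesgue" by (rule measurable_completion) measurable
  have "(\<integral>\<^sup>+p. F p \<partial>heis_measure e k) = (\<integral>\<^sup>+p. F' p \<partial>heis_measure e k)"
    unfolding M
  proof (rule nn_integral_cong_AE)
    show "AE x in density lebesgue ?d. F x = F' x"
      using AE_completion[OF ae] by (subst AE_density[OF dm]) auto
  qed
  also have "\<dots> = (\<integral>\<^sup>+p. ?d p * F' p \<partial>lebesgue)" unfolding M by (rule nn_integral_density[OF dm Fm])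
  also have "\<dots> = (\<integral>\<^sup>+p. ?d p * F' p \<partial>lborel)" by (rule nn_integral_completion)
  also have "\<dots> = (\<integral>\<^sup>+p. ennreal (1 / heis_Z e k) * (F' p * ennreal (gibbs e k p)) \<partial>lborel)"
    unfolding d by (simp add: mult_ac)
  also have "\<dots> = ennreal (1 / heis_Z e k) * (\<integral>\<^sup>+p. F' p * ennreal (gibbs e k p) \<partial>lborel)"
    by (rule nn_integral_cmult) measurable
  finally show ?thesis .
qed

text \<open>A positive Bochner integral \<open>Z\<close> entails that the weight is integrable.\<close>

lemma heis_measure_prob:
  assumes Z: "heis_Z e k > 0"
  shows "prob_space (heis_measure e k)"
proof (rule prob_spaceI)
  have Zi: "heis_Z e k = (\<integral>p. gibbs e k p \<partial>lborel)"
    unfolding heis_Z_def gibbs_def[symmetric] by (rule integral_completion) measurable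
  have i: "integrable lborel (gibbs e k)"
    using Z unfolding Zi by (rule contrapos_pp) (simp add: not_integrable_integral_eq)
  have "emeasure (heis_measure e k) (space (heis_measure e k)) = (\<integral>\<^sup>+p. 1 \<partial>heis_measure e k)"
    by simp
  also have "\<dots> = ennreal (1 / heis_Z e k) * (\<integral>\<^sup>+p. 1 * ennreal (gibbs e k p) \<partial>lborel)"
    by (rule nn_integral_heis_measure[OF _ _ Z]) auto
  also have "(\<integral>\<^sup>+p. 1 * ennreal (gibbs e k p) \<partial>lborel) = ennreal (heis_Z e k)"
    unfolding Zi using nn_integral_eq_integral[OF i] by simp
  also have "ennreal (1 / heis_Z e k) * ennreal (heis_Z e k) = 1"
    using Z by (simp flip: ennreal_mult)
  finally show "emeasure (heis_measure e k) (space (heis_measure e k)) = 1" .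
qed

theorem corollary5:
  fixes e :: "'n::finite" and k q :: real
  assumes "CARD('n) > 5" and "k \<ge> 1" and "q \<ge> 2"
  shows "\<exists>c::real. c > 0 \<and>
    (\<forall>(f :: 'n heis \<Rightarrow> real) G.
       integrable (heis_measure e k) f \<and> weak_subgradient e f G \<longrightarrow>
       (\<integral>\<^sup>+ p. ennreal (\<bar>f p - (\<integral>r. f r \<partial>heis_measure e k)\<bar> powr q) \<partial>heis_measure e k)
         \<le> ennreal c * (\<integral>\<^sup>+ p. ennreal (norm (G p) powr q) \<partial>heis_measure e k))"
proof (cases "heis_Z e k > 0")
  case False
  \<comment> \<open>If \<open>Z\<close> were zero, division by zero would make the density, and hence the measure, zero.\<close>
  have "heis_Z e k \<ge> 0" unfolding heis_Z_def by (intro Bochner_Integration.integral_nonneg) simp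
  then have "heis_measure e k = null_measure lebesgue"
    using False by (simp add: heis_measure_def null_measure_eq_density)
  then show ?thesis by (intro exI[of _ 1]) simp
next
  case Z: True
  interpret \<mu>: prob_space "heis_measure e k" by (rule heis_measure_prob[OF Z])
  let ?\<mu> = "heis_measure e k"
  have n: "CARD('n) \<ge> 3" using assms(1) by simp
  obtain C where C: "C \<ge> 0" and main: "\<And>f G. weak_hgrad e f G \<Longrightarrow>
    (gibbs_energy e k q G) < \<infinity> \<Longrightarrow>
    (\<exists>a. (\<integral>\<^sup>+p. ennreal (\<bar>f p - a\<bar> powr q) * ennreal (gibbs e k p) \<partial>lborel)
     \<le> ennreal C * (gibbs_energy e k q G))"
    using weighted_poincare[OF assms(2,3) n, of e] by blast
  define c where "c = 2 powr q * (C + C) + 1"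
  have c: "c > 0" using C by (simp add: c_def add_nonneg_pos)
  have "(\<integral>\<^sup>+ p. ennreal (\<bar>f p - (\<integral>r. f r \<partial>?\<mu>)\<bar> powr q) \<partial>?\<mu>)
         \<le> ennreal c * (\<integral>\<^sup>+ p. ennreal (norm (G p) powr q) \<partial>?\<mu>)"
    if f: "integrable ?\<mu> f" and w: "weak_subgradient e f G" for f G
  proof (cases "(\<integral>\<^sup>+ p. ennreal (norm (G p) powr q) \<partial>?\<mu>) = \<infinity>")
    case True
    then show ?thesis using c by (simp add: ennreal_mult_top)
  next
    case fin: False
    obtain f' G' where w': "weak_hgrad e f' G'" and ae: "AE x in lborel. f x = f' x" "AE x in lborel. G x = G' x"
      using weak_subgradient_borel_rep[OF w] by blast
    have l: "loc_int f'" "loc_int G'" using w' by (auto simp: weak_hgrad_def)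
    note [measurable] = loc_int_measurable[OF l(1)] loc_int_measurable[OF l(2)]
    let ?J = "\<integral>\<^sup>+p. ennreal (norm (G' p) powr q) * ennreal (gibbs e k p) \<partial>lborel"
    have J: "(\<integral>\<^sup>+ p. ennreal (norm (G p) powr q) \<partial>?\<mu>) = ennreal (1 / heis_Z e k) * ?J"
    proof (rule nn_integral_heis_measure[OF _ _ Z])
      show "AE p in lborel. ennreal (norm (G p) powr q) = ennreal (norm (G' p) powr q)"
        using ae(2) by eventually_elim simp
    qed measurable
    then have "?J < \<infinity>" using fin Z by (auto simp: ennreal_mult_eq_top_iff less_top)
    then obtain a where a: "(\<integral>\<^sup>+p. ennreal (\<bar>f' p - a\<bar> powr q) * ennreal (gibbs e k p) \<partial>lborel) \<le> ennreal C * ?J"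
      using main[OF w'] by blast
    let ?I = "\<integral>\<^sup>+ p. ennreal (\<bar>f p - a\<bar> powr q) \<partial>?\<mu>"
    have "?I = ennreal (1 / heis_Z e k) * (\<integral>\<^sup>+p. ennreal (\<bar>f' p - a\<bar> powr q) * ennreal (gibbs e k p) \<partial>lborel)"
    proof (rule nn_integral_heis_measure[OF _ _ Z])
      show "AE p in lborel. ennreal (\<bar>f p - a\<bar> powr q) = ennreal (\<bar>f' p - a\<bar> powr q)"
        using ae(1) by eventually_elim simp
    qed measurable
    also have "\<dots> \<le> ennreal (1 / heis_Z e k) * (ennreal C * ?J)"
      by (intro mult_left_mono a) simp
    also have "\<dots> = ennreal C * (\<integral>\<^sup>+ p. ennreal (norm (G p) powr q) \<partial>?\<mu>)"
      unfolding J by (simp add: mult_ac)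
    finally have I: "?I \<le> ennreal C * (\<integral>\<^sup>+ p. ennreal (norm (G p) powr q) \<partial>?\<mu>)" .
    have fm [measurable]: "f \<in> borel_measurable ?\<mu>" using f by simp
    \<comment> \<open>Replacing the constant \<open>a\<close> by the mean \<open>m\<close> costs a factor, because \<open>\<bar>m - a\<bar>\<^sup>q \<le> \<integral>\<bar>f - a\<bar>\<^sup>q\<close>.\<close>
    define m where "m = (\<integral>r. f r \<partial>?\<mu>)"
    have "(\<integral>r. f r - a \<partial>?\<mu>) = m - a"
      using f by (simp add: m_def \<mu>.prob_space)
    moreover have "ennreal (norm (\<integral>r. f r - a \<partial>?\<mu>) powr q) \<le> (\<integral>\<^sup>+ p. ennreal (norm (f p - a) powr q) \<partial>?\<mu>)"
      using f assms(3) by (intro \<mu>.jensen_powr) auto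
    ultimately have ma: "ennreal (\<bar>m - a\<bar> powr q) \<le> ?I" by simp
    have "(\<integral>\<^sup>+ p. ennreal (\<bar>f p - m\<bar> powr q) \<partial>?\<mu>)
      \<le> (\<integral>\<^sup>+ p. ennreal (2 powr q) * (ennreal (\<bar>f p - a\<bar> powr q) + ennreal (\<bar>m - a\<bar> powr q)) \<partial>?\<mu>)"
    proof (rule nn_integral_mono)
      fix p
      have "\<bar>f p - m\<bar> powr q \<le> (\<bar>f p - a\<bar> + \<bar>m - a\<bar>) powr q"
        using assms(3) by (intro powr_mono2) auto
      also have "\<dots> \<le> 2 powr q * (\<bar>f p - a\<bar> powr q + \<bar>m - a\<bar> powr q)"
        using assms(3) by (intro powr_add_le) auto
      finally have "ennreal (\<bar>f p - m\<bar> powr q) \<le> ennreal (2 powr q * (\<bar>f p - a\<bar> powr q + \<bar>m - a\<bar> powr q))"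
        by (rule ennreal_leI)
      then show "ennreal (\<bar>f p - m\<bar> powr q) \<le> ennreal (2 powr q) * (ennreal (\<bar>f p - a\<bar> powr q) + ennreal (\<bar>m - a\<bar> powr q))"
        by (simp add: ennreal_mult ennreal_plus)
    qed
    also have "\<dots> = ennreal (2 powr q) * (?I + ennreal (\<bar>m - a\<bar> powr q))"
      by (subst nn_integral_cmult, measurable, subst nn_integral_add, measurable) (simp add: \<mu>.emeasure_space_1)
    also have "\<dots> \<le> ennreal (2 powr q) * (?I + ?I)"
      by (intro mult_left_mono add_left_mono ma) simp
    also have "\<dots> \<le> ennreal (2 powr q) * (ennreal C * (\<integral>\<^sup>+ p. ennreal (norm (G p) powr q) \<partial>?\<mu>)
        + ennreal C * (\<integral>\<^sup>+ p. ennreal (norm (G p) powr q) \<partial>?\<mu>))"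
      by (intro mult_left_mono add_mono I) simp
    also have "\<dots> = ennreal (2 powr q * (C + C)) * (\<integral>\<^sup>+ p. ennreal (norm (G p) powr q) \<partial>?\<mu>)"
    proof -
      have "ennreal (2 powr q * (C + C)) = ennreal (2 powr q) * (ennreal C + ennreal C)"
        using C by (subst ennreal_mult) (auto simp only: ennreal_plus powr_ge_zero intro: add_nonneg_nonneg)
      then show ?thesis by (simp only: distrib_right mult.assoc)
    qed
    also have "\<dots> \<le> ennreal c * (\<integral>\<^sup>+ p. ennreal (norm (G p) powr q) \<partial>?\<mu>)"
      by (intro mult_right_mono ennreal_leI) (auto simp: c_def)
    finally show ?thesis unfolding m_def .
  qed
  then show ?thesis using c by blast
qed

end
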